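(* Let $M$ be a uniquely geodesic Riemannian manifold (with its Riemannian distance $d_M$) in which every local geodesic is a geodesic. Then for every positive integer $n$, $$\mu_n(M)=\lceil n^2/2\rceil.$$ Moreover, any set $A$ of $n$ points in $M$ for which $|\mathrm{AP}_3(M;A)|=\lceil n^2/2\rceil$ is contained in the image of a geodesic.
   Context: For a metric space $(M,d_M)$, a triple $(a,b,c)\in M^3$ is a 3-term arithmetic progression if $d_M(a,b)=d_M(b,c)=\frac12 d_M(a,c)$ (constant triples $(b,b,b)$ included). For finite $A\subseteq M$, $\mathrm{AP}_3(M;A)$ denotes the set of triples $(a,b,c)\in A^3$ that are 3-term arithmetic progressions, and $\mu_n(M):=\max\{|\mathrm{AP}_3(M;A)| : A\subseteq M,\ |A|=n\}$. A curve $\gamma:I\to M$ ($I\subseteq\mathbb R$ connected) is a geodesic if $d_M(\gamma(y),\gamma(x))=y-x$ for all $x<y$ in $I$; it is a local geodesic if every $a\in I$ has an interval $I_a$ around it such that $\gamma$ restricted to $I\cap I_a$ is a geodesic. A set $\Gamma\subseteq M$ is a geodesic segment with endpoints $p,q$ if $\Gamma=\gamma([a,b])$ for a geodesic $\gamma:[a,b]\to M$ with $\gamma(a)=p,\gamma(b)=q$. $M$ is uniquely geodesic if any two distinct points are the endpoints of a unique geodesic segment. *)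

theory Defs
  imports "HOL-Analysis.Analysis"
begin

section \<open>Progressions and geodesics in a metric space\<close>

text \<open>A metric space is given by a carrier \<open>M\<close> and a distance function \<open>d\<close>.\<close>

definition AP3 :: "('a \<Rightarrow> 'a \<Rightarrow> real) \<Rightarrow> 'a set \<Rightarrow> ('a \<times> 'a \<times> 'a) set" where
  "AP3 d A = {(a, b, c). a \<in> A \<and> b \<in> A \<and> c \<in> A \<and> d a b = d b c \<and> d b c = d a c / 2}"

definition max_AP3 :: "'a set \<Rightarrow> ('a \<Rightarrow> 'a \<Rightarrow> real) \<Rightarrow> nat \<Rightarrow> nat" where
  "max_AP3 M d n = Max {card (AP3 d A) | A. A \<subseteq> M \<and> finite A \<and> card A = n}"

definition geodesic :: "'a set \<Rightarrow> ('a \<Rightarrow> 'a \<Rightarrow> real) \<Rightarrow> real set \<Rightarrow> (real \<Rightarrow> 'a) \<Rightarrow> bool" where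
  "geodesic M d I \<gamma> \<longleftrightarrow>
     connected I \<and> \<gamma> ` I \<subseteq> M \<and> (\<forall>x\<in>I. \<forall>y\<in>I. x < y \<longrightarrow> d (\<gamma> y) (\<gamma> x) = y - x)"

definition local_geodesic :: "'a set \<Rightarrow> ('a \<Rightarrow> 'a \<Rightarrow> real) \<Rightarrow> real set \<Rightarrow> (real \<Rightarrow> 'a) \<Rightarrow> bool" where
  "local_geodesic M d I \<gamma> \<longleftrightarrow>
     connected I \<and> \<gamma> ` I \<subseteq> M \<and>
     (\<forall>a\<in>I. \<exists>l u. l < a \<and> a < u \<and> geodesic M d (I \<inter> {l<..<u}) \<gamma>)"

definition geodesic_segment :: "'a set \<Rightarrow> ('a \<Rightarrow> 'a \<Rightarrow> real) \<Rightarrow> 'a \<Rightarrow> 'a \<Rightarrow> 'a set \<Rightarrow> bool" where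
  "geodesic_segment M d p q \<Gamma> \<longleftrightarrow>
     (\<exists>a b \<gamma>. a \<le> b \<and> geodesic M d {a..b} \<gamma> \<and> \<gamma> a = p \<and> \<gamma> b = q \<and> \<Gamma> = \<gamma> ` {a..b})"

definition uniquely_geodesic :: "'a set \<Rightarrow> ('a \<Rightarrow> 'a \<Rightarrow> real) \<Rightarrow> bool" where
  "uniquely_geodesic M d \<longleftrightarrow>
     (\<forall>p\<in>M. \<forall>q\<in>M. p \<noteq> q \<longrightarrow> (\<exists>!\<Gamma>. geodesic_segment M d p q \<Gamma>))"

section \<open>Riemannian manifolds\<close>

text \<open>\<open>Ck_on k f S\<close>: \<open>f\<close> is of class \<open>C\<^sup>k\<close> on the open set \<open>S\<close>.\<close>

primrec Ck_on ::
    "nat \<Rightarrow> ('e::euclidean_space \<Rightarrow> 'f::real_normed_vector) \<Rightarrow> 'e set \<Rightarrow> bool" where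
  "Ck_on 0 f S \<longleftrightarrow> continuous_on S f"
| "Ck_on (Suc k) f S \<longleftrightarrow>
     (\<forall>x\<in>S. f differentiable at x) \<and> (\<forall>v. Ck_on k (\<lambda>x. frechet_derivative f (at x) v) S)"

definition smooth_on ::
    "('e::euclidean_space \<Rightarrow> 'f::real_normed_vector) \<Rightarrow> 'e set \<Rightarrow> bool" where
  "smooth_on f S \<longleftrightarrow> (\<forall>k. Ck_on k f S)"

text \<open>A chart is a pair \<open>(U, \<phi>)\<close>; values of \<open>\<phi>\<close> outside its domain \<open>U\<close> are irrelevant.\<close>

type_synonym ('a, 'e) chart = "'a set \<times> ('a \<Rightarrow> 'e)"

text \<open>The coordinate change \<open>\<psi> \<circ> \<phi>\<^sup>-\<^sup>1\<close>, to be considered on \<open>\<phi> ` (U \<inter> V)\<close>.\<close>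

definition transition :: "('a, 'e) chart \<Rightarrow> ('a, 'e) chart \<Rightarrow> 'e \<Rightarrow> 'e" where
  "transition c c' = snd c' \<circ> inv_into (fst c) (snd c)"

text \<open>The manifold is given by a topology \<open>X\<close> and a smooth atlas \<open>\<A>\<close>, not necessarily maximal.
  The Riemannian metric is given by its local expressions: \<open>g (U, \<phi>) x v w\<close> is the inner product
  of the tangent vectors with coordinates \<open>v\<close>, \<open>w\<close> in the chart \<open>(U, \<phi>)\<close>, at the point with
  coordinates \<open>x \<in> \<phi> ` U\<close>; \<open>metric_transition\<close> is the transformation law of a covariant
  2-tensor. The model space \<open>'e\<close> is an arbitrary Euclidean space, hence of dimension at least 1.
  Connectedness is part of the definition because otherwise the Riemannian distance is infinite
  between different components.\<close>

locale riemannian_manifold =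
  fixes X :: "'a topology"
    and \<A> :: "('a, 'e::euclidean_space) chart set"
    and g :: "('a, 'e) chart \<Rightarrow> 'e \<Rightarrow> 'e \<Rightarrow> 'e \<Rightarrow> real"
  assumes Hausdorff: "Hausdorff_space X"
    and second_countable: "second_countable X"
    and connected: "connected_space X"
    and nonempty: "topspace X \<noteq> {}"
    and chart_domain_open: "\<And>U \<phi>. (U, \<phi>) \<in> \<A> \<Longrightarrow> openin X U"
    and chart_range_open: "\<And>U \<phi>. (U, \<phi>) \<in> \<A> \<Longrightarrow> open (\<phi> ` U)"
    and chart_homeomorphic:
      "\<And>U \<phi>. (U, \<phi>) \<in> \<A> \<Longrightarrow> homeomorphic_map (subtopology X U) (top_of_set (\<phi> ` U)) \<phi>"
    and charts_cover: "(\<Union>(U, \<phi>)\<in>\<A>. U) = topspace X"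
    and transition_smooth:
      "\<And>U \<phi> V \<psi>. (U, \<phi>) \<in> \<A> \<Longrightarrow> (V, \<psi>) \<in> \<A> \<Longrightarrow>
         smooth_on (transition (U, \<phi>) (V, \<psi>)) (\<phi> ` (U \<inter> V))"
    and metric_bilinear: "\<And>U \<phi> x. (U, \<phi>) \<in> \<A> \<Longrightarrow> x \<in> \<phi> ` U \<Longrightarrow> bilinear (g (U, \<phi>) x)"
    and metric_symmetric:
      "\<And>U \<phi> x v w. (U, \<phi>) \<in> \<A> \<Longrightarrow> x \<in> \<phi> ` U \<Longrightarrow> g (U, \<phi>) x v w = g (U, \<phi>) x w v"
    and metric_positive:
      "\<And>U \<phi> x v. (U, \<phi>) \<in> \<A> \<Longrightarrow> x \<in> \<phi> ` U \<Longrightarrow> v \<noteq> 0 \<Longrightarrow> g (U, \<phi>) x v v > 0"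
    and metric_smooth:
      "\<And>U \<phi> v w. (U, \<phi>) \<in> \<A> \<Longrightarrow> smooth_on (\<lambda>x. g (U, \<phi>) x v w) (\<phi> ` U)"
    and metric_transition:
      "\<And>U \<phi> V \<psi> x v w. (U, \<phi>) \<in> \<A> \<Longrightarrow> (V, \<psi>) \<in> \<A> \<Longrightarrow> x \<in> \<phi> ` (U \<inter> V) \<Longrightarrow>
         g (U, \<phi>) x v w =
         g (V, \<psi>) (transition (U, \<phi>) (V, \<psi>) x)
           (frechet_derivative (transition (U, \<phi>) (V, \<psi>)) (at x) v)
           (frechet_derivative (transition (U, \<phi>) (V, \<psi>)) (at x) w)"

text \<open>A curve is \<open>C\<^sup>1\<close> on \<open>[a, b]\<close>, with one-sided derivatives at \<open>a\<close> and \<open>b\<close>, if its expression in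
  every chart is.\<close>

definition C1_curve_on ::
    "('a, 'e::euclidean_space) chart set \<Rightarrow> real \<Rightarrow> real \<Rightarrow> (real \<Rightarrow> 'a) \<Rightarrow> bool" where
  "C1_curve_on \<A> a b c \<longleftrightarrow>
     (\<forall>(U, \<phi>)\<in>\<A>. \<exists>D. continuous_on {t\<in>{a..b}. c t \<in> U} D \<and>
        (\<forall>t\<in>{a..b}. c t \<in> U \<longrightarrow>
           ((\<phi> \<circ> c) has_vector_derivative D t) (at t within {a..b})))"

text \<open>The set \<open>S\<close> below contains the break points; the restriction of the curve to each of the closed
  intervals between consecutive ones is \<open>C\<^sup>1\<close>. In contrast, \<open>piecewise_C1_differentiable_on\<close>
  allows the derivative to be unbounded near a break point.\<close>

definition piecewise_C1_curve ::
    "'a topology \<Rightarrow> ('a, 'e::euclidean_space) chart set \<Rightarrow> (real \<Rightarrow> 'a) \<Rightarrow> bool" where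
  "piecewise_C1_curve X \<A> c \<longleftrightarrow>
     pathin X c \<and>
     (\<exists>S. finite S \<and>
        (\<forall>a b. 0 \<le> a \<and> a < b \<and> b \<le> 1 \<and> {a<..<b} \<inter> S = {} \<longrightarrow> C1_curve_on \<A> a b c))"

text \<open>By \<open>metric_transition\<close> the speed does not depend on the choice of the chart wherever the
  curve is differentiable. At the finitely many other parameters, and at the endpoints of the
  parameter interval, its value has no effect on the length.\<close>

definition curve_speed ::
    "('a, 'e::euclidean_space) chart set \<Rightarrow> (('a, 'e) chart \<Rightarrow> 'e \<Rightarrow> 'e \<Rightarrow> 'e \<Rightarrow> real) \<Rightarrow>
     (real \<Rightarrow> 'a) \<Rightarrow> real \<Rightarrow> real" where
  "curve_speed \<A> g c t =
     (let \<kappa> = (SOME \<kappa>. \<kappa> \<in> \<A> \<and> c t \<in> fst \<kappa>);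
          v = vector_derivative (snd \<kappa> \<circ> c) (at t)
      in sqrt (g \<kappa> (snd \<kappa> (c t)) v v))"

definition curve_length ::
    "('a, 'e::euclidean_space) chart set \<Rightarrow> (('a, 'e) chart \<Rightarrow> 'e \<Rightarrow> 'e \<Rightarrow> 'e \<Rightarrow> real) \<Rightarrow>
     (real \<Rightarrow> 'a) \<Rightarrow> real" where
  "curve_length \<A> g c = integral {0..1} (curve_speed \<A> g c)"

definition riemannian_dist ::
    "'a topology \<Rightarrow> ('a, 'e::euclidean_space) chart set \<Rightarrow>
     (('a, 'e) chart \<Rightarrow> 'e \<Rightarrow> 'e \<Rightarrow> 'e \<Rightarrow> real) \<Rightarrow> 'a \<Rightarrow> 'a \<Rightarrow> real" where
  "riemannian_dist X \<A> g p q =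
     Inf {curve_length \<A> g c | c. piecewise_C1_curve X \<A> c \<and> c 0 = p \<and> c 1 = q}"

end

theory Submission
  imports Defs
begin

text \<open>Call the set of points of \<open>A\<close> on the maximal geodesic through two points of \<open>A\<close> a block. Since local
  geodesics are geodesics and geodesics do not branch, every block is isometric to a set of reals,
  and the blocks partition the pairs of distinct points of \<open>A\<close>. A block of \<open>k\<close> points contains at
  most about \<open>k\<^sup>2 / 2 - k\<close> nonconstant progressions, and the ratio of this bound to the
  number of pairs in the block increases with \<open>k\<close>. Hence the sum over the blocks is largest
  if there is only one.

  That geodesics do not branch is shown without the geodesic equation. In a chart, comparing
  with perturbed polygons shows that on a short metric geodesic the distance \<open>f\<close> from its initial point has
  a first-order expansion with a quadratic error. So the gradient of \<open>f\<close> is Lipschitz on the union of two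
  geodesics with a common initial piece. Both are integral curves of this gradient, and they agree by
  Gronwall's inequality.\<close>

section \<open>Counting progressions\<close>

text \<open>A metric geodesic read in a chart is a priori only Lipschitz, so neither a velocity nor
  a differential equation is at hand. What replaces them: at a point of a geodesic that extends in
  both directions, the distance is touched from above by a paraboloid (compare with paths that start
  closer to the point) and from below by another one (use the distance to a later point), and
  touching paraboloids share their tangent plane. Their opening is of order 1 / \<delta>, where
  \<delta> is the distance to the initial point; hence the distance is measured from a point at a
  fixed distance behind the branching point.

  In the count, the ratio is the same for k = 2h + 1 and k = 2h + 2, so monotonicity gives the bound
  but not the equality case. That case comes from two blocks through a common point: they share only
  this point, so one of them has at most (n + 1) / 2 points, which is small enough for a strict
  inequality once n \<ge> 3.\<close>

definition max_proper_AP3 :: "nat \<Rightarrow> nat" where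
  "max_proper_AP3 k = 2 * (((k - 1) div 2) * (k - 1 - (k - 1) div 2))"

lemma positive_cases:
  fixes k :: nat
  assumes "k > 0"
  shows "\<exists>h. k = 2 * h + 1 \<or> k = 2 * h + 2"
  using assms by presburger

lemma max_proper_AP3_Suc_Suc:
  assumes "k > 0"
  shows "max_proper_AP3 (Suc (Suc k)) = max_proper_AP3 k + 2 * k"
proof -
  obtain h where "k = 2 * h + 1 \<or> k = 2 * h + 2"
    using positive_cases[of k] assms by auto
  then show ?thesis
    by (elim disjE) (simp_all add: max_proper_AP3_def algebra_simps)
qed

text \<open>The element of rank j among k reals has j elements below and k - 1 - j above it, so it
  is the midpoint of at most 2 min(j, k - 1 - j) nonconstant progressions;
  \<open>max_proper_AP3\<close> is the closed form of the total. Removing the two extreme ranks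
  lowers every other term by one, whence the induction in steps of two.\<close>

lemma sum_min_eq: "2 * (\<Sum>j<k. min j (k - 1 - j)) = max_proper_AP3 k"
proof (induction k rule: nat_less_induct)
  case (1 k)
  consider "k = 0" | "k = 1" | "k = 2" | m where "k = Suc (Suc m)" "m > 0"
    by (metis One_nat_def Suc_1 not_gr0 not0_implies_Suc)
  then show ?case
  proof cases
    case 4
    \<comment> \<open>The terms for the least and the greatest rank are 0, and \<open>m - j\<close>
      is \<open>k - 1 - Suc j\<close>.\<close>
    have "(\<Sum>j<k. min j (k - 1 - j)) = (\<Sum>j<m. min (Suc j) (m - j))"
      unfolding 4(1) sum.lessThan_Suc_shift[of _ "Suc m"] sum.lessThan_Suc[of _ m] by simp
    also have "\<dots> = (\<Sum>j<m. Suc (min j (m - 1 - j)))"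
      by (intro sum.cong refl) auto
    also have "\<dots> = m + (\<Sum>j<m. min j (m - 1 - j))"
      by (simp add: sum_Suc)
    finally show ?thesis
      using 1[rule_format, of m] 4 max_proper_AP3_Suc_Suc[of m] by simp
  qed (auto simp: max_proper_AP3_def numeral_2_eq_2)
qed

text \<open>Divided by the number of ordered pairs of distinct points, the bound becomes h / (2h +
  1) with h = \<open>(k - 1) div 2\<close>. In this form it can be compared across blocks of
  different sizes.\<close>

lemma max_proper_AP3_ratio:
  assumes "k \<ge> 1"
  shows "real (max_proper_AP3 k) =
    real (k * (k - 1)) * (real ((k - 1) div 2) / real (2 * ((k - 1) div 2) + 1))"
proof -
  obtain h where "k = 2 * h + 1 \<or> k = 2 * h + 2"
    using positive_cases[of k] assms by auto
  then show ?thesis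
    by (elim disjE) (simp_all add: max_proper_AP3_def field_simps)
qed

lemma max_proper_AP3_ceiling:
  assumes "n \<ge> 1"
  shows "int (n + max_proper_AP3 n) = \<lceil>(real n)\<^sup>2 / 2\<rceil>"
proof -
  obtain h where h: "n = 2 * h + 1 \<or> n = 2 * h + 2"
    using positive_cases[of n] assms by auto
  then show ?thesis
  proof
    assume n: "n = 2 * h + 1"
    have "\<lceil>(real n)\<^sup>2 / 2\<rceil> = 2 * int h * int h + 2 * int h + 1"
      by (rule ceiling_unique) (simp_all add: n power2_eq_square field_simps)
    then show ?thesis by (simp add: n max_proper_AP3_def)
  next
    assume n: "n = 2 * h + 2"
    have "\<lceil>(real n)\<^sup>2 / 2\<rceil> = 2 * int h * int h + 4 * int h + 2"
      by (rule ceiling_unique) (simp_all add: n power2_eq_square field_simps)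
    then show ?thesis by (simp add: n max_proper_AP3_def algebra_simps)
  qed
qed

text \<open>A progression with midpoint b is determined by either end, and one end lies on each side
  of b. So the smaller side bounds their number, up to the factor 2 for the two orders.\<close>

lemma card_proper_AP3_real_le:
  fixes T :: "real set"
  assumes "finite T"
  shows "card {(a, b, c). a \<in> T \<and> b \<in> T \<and> c \<in> T \<and> a \<noteq> c \<and> a + c = 2 * b}
    \<le> max_proper_AP3 (card T)"
    (is "card ?P \<le> _")
proof -
  define lo where "lo b = card {x \<in> T. x < b}" for b
  define hi where "hi b = card {x \<in> T. x > b}" for b
  have lo_hi: "lo b + hi b = card T - 1" if "b \<in> T" for b
  proof -
    have "card ({x \<in> T. x < b} \<union> {x \<in> T. x > b}) = lo b + hi b"
      unfolding lo_def hi_def using assms by (intro card_Un_disjoint) auto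
    moreover have "{x \<in> T. x < b} \<union> {x \<in> T. x > b} = T - {b}" by auto
    ultimately show ?thesis using that assms by (simp add: card_Diff_singleton)
  qed
  have lo_mono: "lo x < lo y" if "x \<in> T" "x < y" for x y
    unfolding lo_def using that assms by (intro psubset_card_mono) auto
  have inj: "inj_on lo T"
    by (metis inj_onI lo_mono less_irrefl linorder_neqE_linordered_idom)
  \<comment> \<open>Ranks turn the sum over T into a sum over the numbers below
    \<open>card T\<close>, which depends on T only through its size.\<close>
  have img: "lo ` T = {..<card T}"
  proof (rule card_subset_eq)
    show "lo ` T \<subseteq> {..<card T}"
    proof safe
      fix b assume "b \<in> T"
      then have "{x \<in> T. x < b} \<subset> T" by auto
      then show "lo b < card T" unfolding lo_def by (rule psubset_card_mono[OF assms])
    qed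
    show "card (lo ` T) = card {..<card T}" by (simp add: card_image inj)
  qed simp
  define Q where "Q b = {(a, b', c). b' = b \<and> a \<in> T \<and> c \<in> T \<and> a \<noteq> c \<and> a + c = 2 * b}" for b
  have fin: "finite (T \<times> T \<times> T)" using assms by simp
  have finQ: "finite (Q b)" if "b \<in> T" for b
    by (rule finite_subset[OF _ fin]) (use that in \<open>auto simp: Q_def\<close>)
  have Q_le: "card (Q b) \<le> 2 * min (lo b) (card T - 1 - lo b)" if b: "b \<in> T" for b
  proof -
    \<comment> \<open>The smaller side of b; each of its points can be the first or the last
      term.\<close>
    define m where "m = (if lo b \<le> hi b then {x \<in> T. x < b} else {x \<in> T. x > b})"
    have finm: "finite m" using assms by (auto simp: m_def)
    have cm: "card m = min (lo b) (card T - 1 - lo b)"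
      using lo_hi[OF b] by (auto simp: m_def lo_def hi_def)
    have "Q b \<subseteq> (\<lambda>a. (a, b, 2 * b - a)) ` m \<union> (\<lambda>a. (2 * b - a, b, a)) ` m"
    proof
      fix t assume "t \<in> Q b"
      then obtain a c where t: "t = (a, b, c)" "a \<in> T" "c \<in> T" "a \<noteq> c" "a + c = 2 * b"
        unfolding Q_def by auto
      then have ac: "c = 2 * b - a" "a = 2 * b - c" by auto
      have "a \<in> m \<or> c \<in> m" using t by (auto simp: m_def)
      then show "t \<in> (\<lambda>a. (a, b, 2 * b - a)) ` m \<union> (\<lambda>a. (2 * b - a, b, a)) ` m"
        using t(1) ac by (metis (no_types, lifting) UnI1 UnI2 image_eqI)
    qed
    then have "card (Q b) \<le> card ((\<lambda>a. (a, b, 2 * b - a)) ` m \<union> (\<lambda>a. (2 * b - a, b, a)) ` m)"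
      using finm by (intro card_mono) auto
    also have "\<dots> \<le> card ((\<lambda>a. (a, b, 2 * b - a)) ` m) + card ((\<lambda>a. (2 * b - a, b, a)) ` m)"
      by (rule card_Un_le)
    also have "\<dots> \<le> card m + card m"
      using finm by (intro add_mono card_image_le)
    finally show ?thesis using cm by simp
  qed
  have "?P = (\<Union>b\<in>T. Q b)" unfolding Q_def by auto
  then have "card ?P \<le> (\<Sum>b\<in>T. card (Q b))"
    using card_UN_le[OF assms] by simp
  also have "\<dots> \<le> (\<Sum>b\<in>T. 2 * min (lo b) (card T - 1 - lo b))"
    by (intro sum_mono Q_le)
  also have "\<dots> = 2 * (\<Sum>b\<in>T. min (lo b) (card T - 1 - lo b))"
    by (simp add: sum_distrib_left)
  also have "(\<Sum>b\<in>T. min (lo b) (card T - 1 - lo b)) = (\<Sum>j\<in>lo ` T. min j (card T - 1 - j))"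
    by (simp add: sum.reindex[OF inj])
  finally show ?thesis unfolding img sum_min_eq .
qed

section \<open>Double counting of pairs over the blocks\<close>

lemma card_off_diagonal:
  assumes "finite K"
  shows "card {(p, q). p \<in> K \<and> q \<in> K \<and> p \<noteq> q} = card K * (card K - 1)"
proof -
  have eq: "{(p, q). p \<in> K \<and> q \<in> K \<and> p \<noteq> q} = Sigma K (\<lambda>p. K - {p})" by auto
  show ?thesis unfolding eq using assms by (simp add: card_SigmaI)
qed

text \<open>In the application \<open>blk p q\<close> is the trace on \<open>A\<close> of the maximal geodesic through \<open>p\<close> and \<open>q\<close>, and
  \<open>P\<close> is the set of nonconstant progressions in \<open>A\<close>.\<close>

locale blocks =
  fixes A :: "'a set" and blk :: "'a \<Rightarrow> 'a \<Rightarrow> 'a set" and P :: "('a \<times> 'a \<times> 'a) set"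
  assumes finite: "finite A"
    and blk_sub: "\<And>p q. p \<in> A \<Longrightarrow> q \<in> A \<Longrightarrow> p \<noteq> q \<Longrightarrow> blk p q \<subseteq> A"
    and in_blk: "\<And>p q. p \<in> A \<Longrightarrow> q \<in> A \<Longrightarrow> p \<noteq> q \<Longrightarrow> p \<in> blk p q \<and> q \<in> blk p q"
    and blk_eq: "\<And>p q x y. p \<in> A \<Longrightarrow> q \<in> A \<Longrightarrow> p \<noteq> q \<Longrightarrow> x \<in> blk p q \<Longrightarrow> y \<in> blk p q \<Longrightarrow>
      x \<noteq> y \<Longrightarrow> blk x y = blk p q"
    and P_sub: "\<And>a b c. (a, b, c) \<in> P \<Longrightarrow> a \<in> A \<and> b \<in> A \<and> c \<in> A \<and> a \<noteq> c"
    and P_blk: "\<And>p q. p \<in> A \<Longrightarrow> q \<in> A \<Longrightarrow> p \<noteq> q \<Longrightarrow>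
      card {(a, b, c) \<in> P. a \<in> blk p q \<and> c \<in> blk p q} \<le> max_proper_AP3 (card (blk p q))"
begin

definition "lines = {blk p q | p q. p \<in> A \<and> q \<in> A \<and> p \<noteq> q}"

lemma lineE:
  assumes "K \<in> lines"
  obtains p q where "p \<in> A" "q \<in> A" "p \<noteq> q" "K = blk p q"
  using assms by (auto simp: lines_def)

lemma blk_in_lines: "p \<in> A \<Longrightarrow> q \<in> A \<Longrightarrow> p \<noteq> q \<Longrightarrow> blk p q \<in> lines"
  by (auto simp: lines_def)

lemma finite_lines: "finite lines"
proof (rule finite_subset)
  show "lines \<subseteq> Pow A"
  proof
    fix K assume "K \<in> lines"
    then show "K \<in> Pow A" by (elim lineE) (simp add: blk_sub)
  qed
qed (use finite in simp)

lemma line_props: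
  assumes "K \<in> lines"
  shows "K \<subseteq> A" "finite K" "2 \<le> card K" "card K \<le> card A"
proof -
  obtain p q where pq: "p \<in> A" "q \<in> A" "p \<noteq> q" "K = blk p q"
    using assms by (auto simp: lines_def)
  show sub: "K \<subseteq> A" using blk_sub pq by simp
  then show fin: "finite K" using finite finite_subset by blast
  have "card {p, q} \<le> card K" using in_blk[OF pq(1-3)] pq(4) fin by (intro card_mono) auto
  then show "2 \<le> card K" using pq(3) by simp
  show "card K \<le> card A" using sub finite by (rule card_mono[rotated])
qed

lemma lines_eqI:
  assumes "K \<in> lines" "x \<in> K" "y \<in> K" "x \<noteq> y"
  shows "K = blk x y"
  by (rule lineE[OF assms(1)]) (metis assms(2-4) blk_eq)

text \<open>Every ordered pair of distinct points of A lies in exactly one block: in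
  \<open>blk p q\<close> by \<open>in_blk\<close>, and in no other by
  \<open>lines_eqI\<close>.\<close>

lemma sum_lines: "(\<Sum>K\<in>lines. card K * (card K - 1)) = card A * (card A - 1)"
proof -
  have "{(p, q). p \<in> A \<and> q \<in> A \<and> p \<noteq> q} = (\<Union>K\<in>lines. {(p, q). p \<in> K \<and> q \<in> K \<and> p \<noteq> q})"
    (is "?L = ?R")
  proof
    show "?L \<subseteq> ?R" using in_blk blk_in_lines by force
    show "?R \<subseteq> ?L" using line_props(1) by auto
  qed
  then have "card A * (card A - 1) = card (\<Union>K\<in>lines. {(p, q). p \<in> K \<and> q \<in> K \<and> p \<noteq> q})"
    using card_off_diagonal[OF finite] by simp
  also have "\<dots> = (\<Sum>K\<in>lines. card {(p, q). p \<in> K \<and> q \<in> K \<and> p \<noteq> q})"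
  proof (intro card_UN_disjoint finite_lines ballI impI)
    fix K assume "K \<in> lines"
    then show "finite {(p, q). p \<in> K \<and> q \<in> K \<and> p \<noteq> q}"
      using line_props(2)[of K] by (auto intro!: finite_subset[of "{(p, q). p \<in> K \<and> q \<in> K \<and> p \<noteq> q}" "K \<times> K"])
  next
    fix K K' assume "K \<in> lines" "K' \<in> lines" "K \<noteq> K'"
    then have "\<not> (x \<in> K \<and> y \<in> K \<and> x \<in> K' \<and> y \<in> K' \<and> x \<noteq> y)" for x y
      by (metis lines_eqI)
    then show "{(p, q). p \<in> K \<and> q \<in> K \<and> p \<noteq> q} \<inter> {(p, q). p \<in> K' \<and> q \<in> K' \<and> p \<noteq> q} = {}"
      by blast
  qed
  also have "\<dots> = (\<Sum>K\<in>lines. card K * (card K - 1))"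
    by (intro sum.cong refl card_off_diagonal line_props(2))
  finally show ?thesis ..
qed

definition ratio :: "nat \<Rightarrow> real" where
  "ratio k = real ((k - 1) div 2) / real (2 * ((k - 1) div 2) + 1)"

lemma ratio_mono: "k \<le> n \<Longrightarrow> ratio k \<le> ratio n"
proof -
  assume "k \<le> n"
  then have "(k - 1) div 2 \<le> (n - 1) div 2" by (intro div_le_mono) simp
  then show ?thesis unfolding ratio_def by (simp add: field_simps)
qed

text \<open>The premise \<open>k < n\<close> would not suffice: the sizes 3 and 4 have the same
  ratio.\<close>

lemma ratio_strict: "2 * k \<le> n + 1 \<Longrightarrow> 3 \<le> n \<Longrightarrow> ratio k < ratio n"
proof -
  assume "2 * k \<le> n + 1" "3 \<le> n"
  then have "(k - 1) div 2 < (n - 1) div 2" by presburger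
  then show ?thesis unfolding ratio_def by (simp add: field_simps)
qed

text \<open>Each progression is charged to the block through its two ends.\<close>

lemma card_P_le_sum: "real (card P) \<le> (\<Sum>K\<in>lines. real (card K * (card K - 1)) * ratio (card K))"
proof -
  have finP: "finite P"
    by (rule finite_subset[of _ "A \<times> A \<times> A"]) (use P_sub finite in auto)
  have "P = (\<Union>K\<in>lines. {(a, b, c) \<in> P. a \<in> K \<and> c \<in> K})"
  proof (intro equalityI subsetI)
    fix t assume t: "t \<in> P"
    obtain a b c where abc: "t = (a, b, c)" by (cases t)
    then have "a \<in> A" "c \<in> A" "a \<noteq> c" using P_sub t by auto
    then show "t \<in> (\<Union>K\<in>lines. {(a, b, c) \<in> P. a \<in> K \<and> c \<in> K})"
      using t abc in_blk blk_in_lines by (intro UN_I[of "blk a c"]) auto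
  qed auto
  then have "card P \<le> (\<Sum>K\<in>lines. card {(a, b, c) \<in> P. a \<in> K \<and> c \<in> K})"
    using card_UN_le[OF finite_lines, of "\<lambda>K. {(a, b, c) \<in> P. a \<in> K \<and> c \<in> K}"] by simp
  also have "\<dots> \<le> (\<Sum>K\<in>lines. max_proper_AP3 (card K))"
  proof (rule sum_mono)
    fix K assume "K \<in> lines"
    then show "card {(a, b, c) \<in> P. a \<in> K \<and> c \<in> K} \<le> max_proper_AP3 (card K)"
      by (elim lineE) (simp add: P_blk)
  qed
  finally have "real (card P) \<le> (\<Sum>K\<in>lines. real (max_proper_AP3 (card K)))"
    by (metis of_nat_le_iff of_nat_sum)
  also have "\<dots> = (\<Sum>K\<in>lines. real (card K * (card K - 1)) * ratio (card K))"
  proof (intro sum.cong refl)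
    fix K assume "K \<in> lines"
    then show "real (max_proper_AP3 (card K)) = real (card K * (card K - 1)) * ratio (card K)"
      unfolding ratio_def using line_props(3)[of K] by (intro max_proper_AP3_ratio) simp
  qed
  finally show ?thesis .
qed

lemma sum_ratio:
  assumes "card A \<ge> 1"
  shows "(\<Sum>K\<in>lines. real (card K * (card K - 1)) * ratio (card A)) = max_proper_AP3 (card A)"
proof -
  have "(\<Sum>K\<in>lines. real (card K * (card K - 1)) * ratio (card A)) =
    real (\<Sum>K\<in>lines. card K * (card K - 1)) * ratio (card A)"
    by (simp only: of_nat_sum sum_distrib_right)
  then show ?thesis
    unfolding sum_lines max_proper_AP3_ratio[OF assms] ratio_def .
qed

lemma card_P_le:
  assumes "card A \<ge> 1"
  shows "card P \<le> max_proper_AP3 (card A)"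
proof -
  have "real (card P) \<le> (\<Sum>K\<in>lines. real (card K * (card K - 1)) * ratio (card K))"
    by (rule card_P_le_sum)
  also have "\<dots> \<le> (\<Sum>K\<in>lines. real (card K * (card K - 1)) * ratio (card A))"
    by (intro sum_mono mult_left_mono ratio_mono line_props) auto
  finally show ?thesis unfolding sum_ratio[OF assms] by simp
qed

lemma card_P_eq_imp_line:
  assumes "card A \<ge> 3" "card P = max_proper_AP3 (card A)"
  shows "A \<in> lines"
proof (rule ccontr)
  assume no: "A \<notin> lines"
  have "\<exists>K\<in>lines. 2 * card K \<le> card A + 1"
  proof -
    have "\<exists>p q. p \<in> A \<and> q \<in> A \<and> p \<noteq> q"
      using assms(1) finite by (metis card_le_Suc0_iff_eq not_less_eq_eq numeral_3_eq_3 le_SucI)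
    then obtain p q where pq: "p \<in> A" "q \<in> A" "p \<noteq> q" by blast
    define K where "K = blk p q"
    have K: "K \<in> lines" "p \<in> K" "q \<in> K" using in_blk[OF pq] blk_in_lines[OF pq] by (simp_all add: K_def)
    \<comment> \<open>A point outside the first block gives a second block through p.\<close>
    then obtain r where r: "r \<in> A" "r \<notin> K" using no line_props(1)[of K] by (metis subsetI subset_antisym)
    have pr: "p \<noteq> r" using r K by auto
    define K' where "K' = blk p r"
    have K': "K' \<in> lines" "p \<in> K'" "r \<in> K'" using in_blk[OF pq(1) r(1) pr] blk_in_lines[OF pq(1) r(1) pr] by (simp_all add: K'_def)
    have int: "K \<inter> K' = {p}"
    proof -
      have "x = p" if "x \<in> K" "x \<in> K'" for x
        using lines_eqI[OF K(1) K(2) that(1)] lines_eqI[OF K'(1) K'(2) that(2)] r(2) K'(3) by auto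
      then show ?thesis using K(2) K'(2) by blast
    qed
    have "card (K \<union> K') \<le> card A"
      using line_props(1)[OF K(1)] line_props(1)[OF K'(1)] finite by (intro card_mono) auto
    then have "card K + card K' \<le> card A + 1"
      using card_Un_Int[OF line_props(2)[OF K(1)] line_props(2)[OF K'(1)]] int by simp
    then have "2 * card K \<le> card A + 1 \<or> 2 * card K' \<le> card A + 1" by linarith
    then show ?thesis using K K' by blast
  qed
  then obtain K where K: "K \<in> lines" "2 * card K \<le> card A + 1" by blast
  have pos: "real (card K * (card K - 1)) > 0" using line_props(3)[OF K(1)] by simp
  have "real (card P) \<le> (\<Sum>K\<in>lines. real (card K * (card K - 1)) * ratio (card K))"
    by (rule card_P_le_sum)
  also have "\<dots> < (\<Sum>K\<in>lines. real (card K * (card K - 1)) * ratio (card A))"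
  proof (rule sum_strict_mono_ex1[OF finite_lines])
    show "\<forall>K\<in>lines. real (card K * (card K - 1)) * ratio (card K) \<le> real (card K * (card K - 1)) * ratio (card A)"
      by (intro ballI mult_left_mono ratio_mono line_props) auto
    show "\<exists>K\<in>lines. real (card K * (card K - 1)) * ratio (card K) < real (card K * (card K - 1)) * ratio (card A)"
      using K pos ratio_strict[OF K(2) assms(1)] by (intro bexI[of _ K] mult_strict_left_mono)
  qed
  finally show False using sum_ratio assms by simp
qed

end

section \<open>Geodesics in metric spaces\<close>

locale metric_on =
  fixes M :: "'a set" and d :: "'a \<Rightarrow> 'a \<Rightarrow> real"
  assumes d_refl: "\<And>p. p \<in> M \<Longrightarrow> d p p = 0"
    and d_sym: "\<And>p q. p \<in> M \<Longrightarrow> q \<in> M \<Longrightarrow> d p q = d q p"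
    and d_triangle: "\<And>p q r. p \<in> M \<Longrightarrow> q \<in> M \<Longrightarrow> r \<in> M \<Longrightarrow> d p r \<le> d p q + d q r"
    and d_pos: "\<And>p q. p \<in> M \<Longrightarrow> q \<in> M \<Longrightarrow> p \<noteq> q \<Longrightarrow> d p q > 0"
begin

lemma d_nonneg: "p \<in> M \<Longrightarrow> q \<in> M \<Longrightarrow> d p q \<ge> 0"
  by (cases "p = q") (simp_all add: d_refl d_pos less_imp_le)

lemma d_eq_0_iff: "p \<in> M \<Longrightarrow> q \<in> M \<Longrightarrow> d p q = 0 \<longleftrightarrow> p = q"
  using d_pos[of p q] d_refl[of p] by force

lemma geodesicI:
  assumes "connected I" "\<And>t. t \<in> I \<Longrightarrow> \<gamma> t \<in> M"
    and "\<And>s t. s \<in> I \<Longrightarrow> t \<in> I \<Longrightarrow> s < t \<Longrightarrow> d (\<gamma> s) (\<gamma> t) = t - s"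
  shows "geodesic M d I \<gamma>"
  unfolding geodesic_def
proof (intro conjI ballI impI)
  fix s t assume "s \<in> I" "t \<in> I" "s < t"
  then show "d (\<gamma> t) (\<gamma> s) = t - s"
    using assms(3)[of s t] d_sym[OF assms(2) assms(2), of s t] by simp
qed (use assms in auto)

lemma geodesic_in: "geodesic M d I \<gamma> \<Longrightarrow> t \<in> I \<Longrightarrow> \<gamma> t \<in> M"
  by (auto simp: geodesic_def)

lemma geodesic_dist:
  assumes "geodesic M d I \<gamma>" "s \<in> I" "t \<in> I"
  shows "d (\<gamma> s) (\<gamma> t) = \<bar>s - t\<bar>"
proof -
  have *: "d (\<gamma> t) (\<gamma> s) = t - s" if "s \<in> I" "t \<in> I" "s < t" for s t
    using assms(1) that by (auto simp: geodesic_def)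
  have "\<gamma> s \<in> M" "\<gamma> t \<in> M" using assms geodesic_in by blast+
  then show ?thesis
    using *[of s t] *[of t s] assms(2,3) d_sym[of "\<gamma> s" "\<gamma> t"] d_refl[of "\<gamma> s"]
    by (cases s t rule: linorder_cases) auto
qed

lemma geodesic_subset:
  "geodesic M d I \<gamma> \<Longrightarrow> J \<subseteq> I \<Longrightarrow> connected J \<Longrightarrow> geodesic M d J \<gamma>"
  by (auto simp: geodesic_def)

lemma geodesic_shift:
  assumes "geodesic M d {a..b} \<gamma>" "a' = a + s" "b' \<le> b + s"
  shows "geodesic M d {a'..b'} (\<lambda>t. \<gamma> (t - s))"
proof (rule geodesicI)
  show "\<gamma> (t - s) \<in> M" if "t \<in> {a'..b'}" for t
    using geodesic_in[OF assms(1), of "t - s"] that assms by auto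
  show "d (\<gamma> (u - s)) (\<gamma> (t - s)) = t - u" if "u \<in> {a'..b'}" "t \<in> {a'..b'}" "u < t" for u t
    using geodesic_dist[OF assms(1), of "u - s" "t - s"] that assms by auto
qed simp

end

text \<open>Trees satisfy all assumptions but \<open>nonbranching\<close>, and the bound fails for them.\<close>

locale geodesic_space = metric_on +
  assumes unique: "uniquely_geodesic M d"
    and local_imp_global: "\<And>I \<gamma>. local_geodesic M d I \<gamma> \<Longrightarrow> geodesic M d I \<gamma>"
    and nonbranching: "\<And>a b c \<gamma> \<gamma>'. a < c \<Longrightarrow> c \<le> b \<Longrightarrow> geodesic M d {a..b} \<gamma> \<Longrightarrow>
      geodesic M d {a..b} \<gamma>' \<Longrightarrow> (\<And>t. t \<in> {a..c} \<Longrightarrow> \<gamma> t = \<gamma>' t) \<Longrightarrow> \<gamma> b = \<gamma>' b"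
begin

text \<open>A normal form: the parameter is the distance from p. The constant curve supplies the
  case p = q, of which \<open>uniquely_geodesic\<close> says nothing.\<close>

lemma geodesic_exists:
  assumes "p \<in> M" "q \<in> M"
  obtains \<gamma> where "geodesic M d {0..d p q} \<gamma>" "\<gamma> 0 = p" "\<gamma> (d p q) = q"
proof (cases "p = q")
  case True
  then have "geodesic M d {0..d p q} (\<lambda>_. p)"
    using assms by (intro geodesicI) (auto simp: d_refl)
  then show ?thesis using that[of "\<lambda>_. p"] True by simp
next
  case False
  then obtain a b \<gamma> where \<gamma>: "a \<le> b" "geodesic M d {a..b} \<gamma>" "\<gamma> a = p" "\<gamma> b = q"
    using unique assms unfolding uniquely_geodesic_def geodesic_segment_def by metis
  have "d p q = b - a" using geodesic_dist[OF \<gamma>(2), of a b] \<gamma> by auto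
  then show ?thesis
    using geodesic_shift[OF \<gamma>(2), of 0 "-a" "d p q"] \<gamma> by (intro that[of "\<lambda>t. \<gamma> (t - - a)"]) auto
qed

text \<open>Uniqueness of the segment as a set determines the parametrisation too, because the
  parameter of a point is recovered from its distance to the starting point.\<close>

lemma geodesic_unique:
  assumes "geodesic M d {a..b} \<gamma>" "geodesic M d {a..b} \<gamma>'" "\<gamma> a = \<gamma>' a" "\<gamma> b = \<gamma>' b" "t \<in> {a..b}"
  shows "\<gamma> t = \<gamma>' t"
proof (cases "a = b")
  case True
  then show ?thesis using assms by auto
next
  case False
  then have ab: "a < b" using assms by auto
  have M: "\<gamma> a \<in> M" "\<gamma> b \<in> M" using assms ab by (auto intro: geodesic_in)
  have "d (\<gamma> a) (\<gamma> b) = b - a" using geodesic_dist[OF assms(1), of a b] ab by auto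
  then have "\<gamma> a \<noteq> \<gamma> b" using d_refl M ab by auto
  moreover have "geodesic_segment M d (\<gamma> a) (\<gamma> b) (\<gamma> ` {a..b})"
    "geodesic_segment M d (\<gamma> a) (\<gamma> b) (\<gamma>' ` {a..b})"
    unfolding geodesic_segment_def using assms ab by (metis less_imp_le)+
  ultimately have "\<gamma> ` {a..b} = \<gamma>' ` {a..b}"
    using unique M unfolding uniquely_geodesic_def by blast
  then obtain t' where t': "t' \<in> {a..b}" "\<gamma> t = \<gamma>' t'" using assms(5) by blast
  have "d (\<gamma> a) (\<gamma> t) = t - a" using geodesic_dist[OF assms(1), of a t] assms ab by auto
  moreover have "d (\<gamma>' a) (\<gamma>' t') = t' - a" using geodesic_dist[OF assms(2), of a t'] t' by auto
  ultimately show ?thesis using t' assms(3) by auto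
qed

text \<open>Metric betweenness; b may coincide with a or c.\<close>

definition btw :: "'a \<Rightarrow> 'a \<Rightarrow> 'a \<Rightarrow> bool" where
  "btw a b c \<longleftrightarrow> d a b + d b c = d a c"

lemma btw_sym: "a \<in> M \<Longrightarrow> b \<in> M \<Longrightarrow> c \<in> M \<Longrightarrow> btw a b c \<longleftrightarrow> btw c b a"
  using d_sym unfolding btw_def by (metis add.commute)

lemma geodesic_through:
  assumes "a \<in> M" "b \<in> M" "c \<in> M" "btw a b c"
  obtains \<gamma> where "geodesic M d {0..d a c} \<gamma>" "\<gamma> 0 = a" "\<gamma> (d a b) = b" "\<gamma> (d a c) = c"
proof -
  obtain \<gamma>1 where \<gamma>1: "geodesic M d {0..d a b} \<gamma>1" "\<gamma>1 0 = a" "\<gamma>1 (d a b) = b"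
    using geodesic_exists assms by blast
  obtain \<gamma>2 where \<gamma>2: "geodesic M d {0..d b c} \<gamma>2" "\<gamma>2 0 = b" "\<gamma>2 (d b c) = c"
    using geodesic_exists assms by blast
  define l where "l = d a b"
  define \<gamma> where "\<gamma> t = (if t \<le> l then \<gamma>1 t else \<gamma>2 (t - l))" for t
  have ac: "d a c = l + d b c" using assms by (simp add: btw_def l_def)
  have nn: "0 \<le> l" "0 \<le> d b c" using d_nonneg assms by (auto simp: l_def)
  have low: "\<gamma> t = \<gamma>1 t" "t \<in> {0..d a b}" if "t \<in> {0..l}" for t
    using that by (auto simp: \<gamma>_def l_def)
  have high: "\<gamma> t = \<gamma>2 (t - l)" "t - l \<in> {0..d b c}" if "t \<in> {l..l + d b c}" for t
    using that \<gamma>1 \<gamma>2 by (auto simp: \<gamma>_def l_def)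
  have "geodesic M d {0..d a c} \<gamma>"
  proof (rule geodesicI)
    show M: "\<gamma> t \<in> M" if "t \<in> {0..d a c}" for t
    proof (cases "t \<le> l")
      case True
      then show ?thesis using low[of t] that geodesic_in[OF \<gamma>1(1), of t] by auto
    next
      case False
      then show ?thesis using high[of t] that geodesic_in[OF \<gamma>2(1), of "t - l"] ac by auto
    qed
    fix s t assume st: "s \<in> {0..d a c}" "t \<in> {0..d a c}" "s < t"
    consider "t \<le> l" | "l \<le> s" | "s < l" "l < t" by linarith
    then show "d (\<gamma> s) (\<gamma> t) = t - s"
    proof cases
      case 1
      then show ?thesis using low[of s] low[of t] st geodesic_dist[OF \<gamma>1(1), of s t] by auto
    next
      case 2
      then show ?thesis
        using high[of s] high[of t] st geodesic_dist[OF \<gamma>2(1), of "s - l" "t - l"] ac by auto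
    next
      case 3
      have sM: "\<gamma> s \<in> M" "\<gamma> t \<in> M" using M st by auto
      have 1: "d (\<gamma> s) b = l - s" "d a (\<gamma> s) = s"
        using low[of s] 3 st geodesic_dist[OF \<gamma>1(1), of s l] geodesic_dist[OF \<gamma>1(1), of 0 s] \<gamma>1
        by (auto simp: l_def)
      have 2: "d b (\<gamma> t) = t - l" "d (\<gamma> t) c = d a c - t"
        using high[of t] 3 st geodesic_dist[OF \<gamma>2(1), of 0 "t - l"]
          geodesic_dist[OF \<gamma>2(1), of "t - l" "d b c"] \<gamma>2 ac by auto
      \<comment> \<open>The route through b bounds the distance from above. It cannot be smaller,
        since the route from a to c via \<open>\<gamma> s\<close> and \<open>\<gamma> t\<close>
        would then be shorter than \<open>d a c\<close>.\<close>
      have "d a c \<le> d a (\<gamma> s) + d (\<gamma> s) c" "d (\<gamma> s) c \<le> d (\<gamma> s) (\<gamma> t) + d (\<gamma> t) c"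
        "d (\<gamma> s) (\<gamma> t) \<le> d (\<gamma> s) b + d b (\<gamma> t)"
        using d_triangle assms sM by blast+
      then show ?thesis using 1 2 by linarith
    qed
  qed simp
  moreover have "\<gamma> 0 = a" "\<gamma> l = b" "\<gamma> (d a c) = c"
    using low[of 0] low[of l] high[of "d a c"] nn \<gamma>1 \<gamma>2 ac by (auto simp: l_def)
  ultimately show ?thesis using that by (simp add: l_def)
qed

text \<open>By uniqueness, b and b' lie on one geodesic from a to c, at the parameters
  \<open>d a b\<close> and \<open>d a b'\<close>.\<close>

lemma btw_same:
  assumes "a \<in> M" "b \<in> M" "c \<in> M" "b' \<in> M" "btw a b c" "btw a b' c"
  shows "d b b' = \<bar>d a b - d a b'\<bar>"
proof -
  obtain \<gamma> where \<gamma>: "geodesic M d {0..d a c} \<gamma>" "\<gamma> 0 = a" "\<gamma> (d a b) = b" "\<gamma> (d a c) = c"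
    using geodesic_through assms by metis
  obtain \<gamma>' where \<gamma>': "geodesic M d {0..d a c} \<gamma>'" "\<gamma>' 0 = a" "\<gamma>' (d a b') = b'" "\<gamma>' (d a c) = c"
    using geodesic_through assms by metis
  have r: "d a b \<in> {0..d a c}" "d a b' \<in> {0..d a c}"
    using assms d_nonneg[of a b] d_nonneg[of a b'] d_nonneg[of b c] d_nonneg[of b' c]
    by (auto simp: btw_def)
  then have "\<gamma> (d a b') = b'"
    using geodesic_unique[OF \<gamma>(1) \<gamma>'(1), of "d a b'"] \<gamma> \<gamma>' by simp
  then show ?thesis using geodesic_dist[OF \<gamma>(1) r] \<gamma> by simp
qed

text \<open>The geodesics from \<open>a\<close> to \<open>c\<close> and from \<open>b\<close> to \<open>e\<close> share the segment from \<open>b\<close> to \<open>c\<close>, so they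
  form a local geodesic.\<close>

lemma btw_extend:
  assumes M: "a \<in> M" "b \<in> M" "c \<in> M" "e \<in> M" and "btw a b c" "btw b c e" "b \<noteq> c"
  shows "d a e = d a b + d b c + d c e"
proof -
  obtain \<gamma>1 where \<gamma>1: "geodesic M d {0..d a c} \<gamma>1" "\<gamma>1 0 = a" "\<gamma>1 (d a b) = b" "\<gamma>1 (d a c) = c"
    using geodesic_through assms by metis
  obtain \<gamma>2 where \<gamma>2: "geodesic M d {0..d b e} \<gamma>2" "\<gamma>2 0 = b" "\<gamma>2 (d b c) = c" "\<gamma>2 (d b e) = e"
    using geodesic_through assms by metis
  define l where "l = d a b"
  define m where "m = d a c"
  define r where "r = l + d b e"
  have bc: "d b c > 0" "m = l + d b c" "0 \<le> l" "m \<le> r" "r = m + d c e"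
    using d_pos[of b c] d_nonneg[of a b] d_nonneg[of c e] assms
    by (auto simp: l_def m_def r_def btw_def)
  define \<gamma>2' where "\<gamma>2' = (\<lambda>t. \<gamma>2 (t - l))"
  have g2': "geodesic M d {l..r} \<gamma>2'"
    unfolding \<gamma>2'_def by (rule geodesic_shift[OF \<gamma>2(1)]) (auto simp: r_def)
  have eq: "\<gamma>1 t = \<gamma>2' t" if "t \<in> {l..m}" for t
  proof (rule geodesic_unique[OF _ _ _ _ that])
    show "geodesic M d {l..m} \<gamma>1" "geodesic M d {l..m} \<gamma>2'"
      using geodesic_subset[OF \<gamma>1(1)] geodesic_subset[OF g2'] bc by (auto simp: m_def)
    show "\<gamma>1 l = \<gamma>2' l" "\<gamma>1 m = \<gamma>2' m" using \<gamma>1 \<gamma>2 bc by (auto simp: \<gamma>2'_def l_def m_def)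
  qed
  define \<gamma> where "\<gamma> t = (if t \<le> m then \<gamma>1 t else \<gamma>2' t)" for t
  have low: "\<gamma> t = \<gamma>1 t" if "t \<le> m" for t using that by (simp add: \<gamma>_def)
  have high: "\<gamma> t = \<gamma>2' t" if "t \<ge> l" for t using that eq[of t] by (auto simp: \<gamma>_def)
  have "local_geodesic M d {0..r} \<gamma>"
    unfolding local_geodesic_def
  proof (intro conjI ballI)
    show "\<gamma> ` {0..r} \<subseteq> M"
    proof safe
      fix t assume t: "t \<in> {0..r}"
      show "\<gamma> t \<in> M"
        using low[of t] high[of t] geodesic_in[OF \<gamma>1(1), of t] geodesic_in[OF g2', of t] t bc
        by (cases "t \<le> m") (auto simp: m_def)
    qed
    fix t assume t: "t \<in> {0..r}"
    \<comment> \<open>The two pieces overlap between l and m, an interval of positive length because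
      b \<noteq> c. Hence each parameter has a neighbourhood on which one piece describes the
      curve.\<close>
    show "\<exists>x u. x < t \<and> t < u \<and> geodesic M d ({0..r} \<inter> {x<..<u}) \<gamma>"
    proof (cases "t < m")
      case True
      have "geodesic M d ({0..r} \<inter> {-1<..<m}) \<gamma>"
      proof (rule geodesicI)
        show "connected ({0..r} \<inter> {-1<..<m})"
          by (intro is_interval_connected is_interval_Int is_interval_cc is_interval_oo)
        show "\<gamma> t \<in> M" if "t \<in> {0..r} \<inter> {-1<..<m}" for t
          using geodesic_in[OF \<gamma>1(1), of t] that low[of t] by (auto simp: m_def)
        show "d (\<gamma> s) (\<gamma> t) = t - s"
          if "s \<in> {0..r} \<inter> {-1<..<m}" "t \<in> {0..r} \<inter> {-1<..<m}" "s < t" for s t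
          using geodesic_dist[OF \<gamma>1(1), of s t] that low[of t] low[of s] by (auto simp: m_def)
      qed
      then show ?thesis using True t by (intro exI[of _ "-1"] exI[of _ m]) auto
    next
      case False
      have "geodesic M d ({0..r} \<inter> {l<..<r + 1}) \<gamma>"
      proof (rule geodesicI)
        show "connected ({0..r} \<inter> {l<..<r + 1})"
          by (intro is_interval_connected is_interval_Int is_interval_cc is_interval_oo)
        show "\<gamma> t \<in> M" if "t \<in> {0..r} \<inter> {l<..<r + 1}" for t
          using geodesic_in[OF g2', of t] that high[of t] by auto
        show "d (\<gamma> s) (\<gamma> t) = t - s"
          if "s \<in> {0..r} \<inter> {l<..<r + 1}" "t \<in> {0..r} \<inter> {l<..<r + 1}" "s < t" for s t
          using geodesic_dist[OF g2', of s t] that high[of t] high[of s] by auto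
      qed
      then show ?thesis using False t bc by (intro exI[of _ l] exI[of _ "r + 1"]) auto
    qed
  qed simp
  from geodesic_dist[OF local_imp_global[OF this], of 0 r]
  have "d (\<gamma> 0) (\<gamma> r) = r" using bc by auto
  moreover have "\<gamma> 0 = a" "\<gamma> r = e"
    using low[of 0] high[of r] bc \<gamma>1 \<gamma>2 by (auto simp: \<gamma>2'_def r_def)
  ultimately show ?thesis using bc by (simp add: l_def m_def)
qed

text \<open>This is where \<open>nonbranching\<close> enters: the geodesics from a to c and from a
  to c' coincide up to b by uniqueness, hence up to the nearer of c and c'.\<close>

lemma btw_ray:
  assumes M: "a \<in> M" "b \<in> M" "c \<in> M" "c' \<in> M" and btw: "btw a b c" "btw a b c'" and "a \<noteq> b"
  shows "d c c' = \<bar>d a c - d a c'\<bar>"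
proof -
  have *: "d c c' = d a c' - d a c"
    if M: "c \<in> M" "c' \<in> M" and btw: "btw a b c" "btw a b c'" and le: "d a c \<le> d a c'" for c c'
  proof -
    obtain \<gamma> where \<gamma>: "geodesic M d {0..d a c} \<gamma>" "\<gamma> 0 = a" "\<gamma> (d a b) = b" "\<gamma> (d a c) = c"
      by (rule geodesic_through[OF assms(1,2) M(1) btw(1)])
    obtain \<gamma>' where \<gamma>': "geodesic M d {0..d a c'} \<gamma>'" "\<gamma>' 0 = a" "\<gamma>' (d a b) = b" "\<gamma>' (d a c') = c'"
      by (rule geodesic_through[OF assms(1,2) M(2) btw(2)])
    have pos: "0 < d a b" "d a b \<le> d a c"
      using d_pos[of a b] d_nonneg[of b c] assms(1,2,7) M btw by (auto simp: btw_def)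
    have "\<gamma> (d a c) = \<gamma>' (d a c)"
    proof (rule nonbranching[OF pos \<gamma>(1)])
      show "geodesic M d {0..d a c} \<gamma>'" using geodesic_subset[OF \<gamma>'(1)] le by auto
      fix t assume t: "t \<in> {0..d a b}"
      show "\<gamma> t = \<gamma>' t"
        by (rule geodesic_unique[OF geodesic_subset[OF \<gamma>(1)] geodesic_subset[OF \<gamma>'(1)] _ _ t])
          (use pos le \<gamma> \<gamma>' in auto)
    qed
    then show ?thesis using geodesic_dist[OF \<gamma>'(1), of "d a c" "d a c'"] \<gamma> \<gamma>' pos le by auto
  qed
  show ?thesis
    using *[OF M(3,4) btw] *[OF M(4,3) btw(2,1)] d_sym[OF M(3,4)] by linarith
qed

text \<open>The maximal geodesic through p and q, described by betweenness alone, so that no maximal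
  extension has to be constructed.\<close>

definition line :: "'a \<Rightarrow> 'a \<Rightarrow> 'a set" where
  "line p q = {x \<in> M. btw x p q \<or> btw p x q \<or> btw p q x}"

text \<open>Arc length along the line, with origin p and positive on the side of q.\<close>

definition coord :: "'a \<Rightarrow> 'a \<Rightarrow> 'a \<Rightarrow> real" where
  "coord p q x = (if btw x p q then - d p x else d p x)"

text \<open>Points beyond p are compared along rays from q, points on different sides of p through
  the additivity \<open>opp\<close>, and points on the side of q by uniqueness, along rays from p,
  or through q, according to their position relative to q.\<close>

lemma coord_dist:
  assumes "p \<in> M" "q \<in> M" "p \<noteq> q" "x \<in> line p q" "y \<in> line p q"
  shows "d x y = \<bar>coord p q x - coord p q y\<bar>"
proof -
  have M: "x \<in> M" "y \<in> M" using assms by (auto simp: line_def)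
  note sym = d_sym[OF assms(1) M(1)] d_sym[OF assms(1) M(2)] d_sym[OF assms(2) M(1)]
    d_sym[OF assms(2) M(2)] d_sym[OF assms(1,2)] d_sym[OF M]
  note nn = d_nonneg[OF assms(1) M(1)] d_nonneg[OF assms(1) M(2)]
  have opp: "d x y = d p x + d p y"
    if M: "x \<in> M" "y \<in> M" and xy: "btw x p q" "btw p y q \<or> btw p q y" for x y
    using xy(2)
  proof
    assume "btw p y q"
    then show ?thesis
      using xy d_triangle[of x y q] d_triangle[of x p y] M assms d_sym[of x p]
      by (auto simp: btw_def)
  next
    assume "btw p q y"
    \<comment> \<open>The segment from p to q, with \<open>p \<noteq> q\<close>, is the overlap that
      \<open>btw_extend\<close> asks for.\<close>
    then have "d x y = d x p + d p q + d q y" by (intro btw_extend) (use M assms xy in auto)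
    then show ?thesis using \<open>btw p q y\<close> d_sym[of x p] M assms by (auto simp: btw_def)
  qed
  have mid: "d x y = \<bar>d p x - d p y\<bar>"
    if M: "x \<in> M" "y \<in> M" and xy: "btw p x q" "btw p q y" for x y
    using xy d_triangle[of x q y] d_triangle[of p x y] M assms d_nonneg[of x q] d_nonneg[of q y]
    by (auto simp: btw_def)
  consider "btw x p q" "btw y p q" | "btw x p q" "\<not> btw y p q" | "\<not> btw x p q" "btw y p q"
    | "\<not> btw x p q" "\<not> btw y p q" by blast
  then show ?thesis
  proof cases
    case 1
    have "d x y = \<bar>d q x - d q y\<bar>"
      using 1 assms M btw_sym[of x p q] btw_sym[of y p q] by (intro btw_ray[of q p]) auto
    then show ?thesis using 1 sym by (auto simp: coord_def btw_def)
  next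
    case 2
    then have "d x y = d p x + d p y" using assms M by (intro opp) (auto simp: line_def)
    then show ?thesis using 2 nn by (simp add: coord_def)
  next
    case 3
    then have "d y x = d p y + d p x" using assms M by (intro opp) (auto simp: line_def)
    then show ?thesis using 3 nn sym by (simp add: coord_def)
  next
    case 4
    then have "(btw p x q \<or> btw p q x) \<and> (btw p y q \<or> btw p q y)"
      using assms by (auto simp: line_def)
    then have "d x y = \<bar>d p x - d p y\<bar>"
      using btw_same[of p x q y] btw_ray[of p q x y] mid[of x y] mid[of y x] M assms sym by fastforce
    then show ?thesis using 4 by (simp add: coord_def)
  qed
qed

lemma coord_inj:
  assumes "p \<in> M" "q \<in> M" "p \<noteq> q"
  shows "inj_on (coord p q) (line p q)"
proof (rule inj_onI)
  fix x y assume xy: "x \<in> line p q" "y \<in> line p q" "coord p q x = coord p q y"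
  then have "d x y = 0" using coord_dist assms by simp
  then show "x = y" using xy d_eq_0_iff by (auto simp: line_def)
qed

lemma in_line: "p \<in> M \<Longrightarrow> q \<in> M \<Longrightarrow> p \<in> line p q \<and> q \<in> line p q"
  by (auto simp: line_def btw_def d_refl)

lemma line_subset:
  assumes "p \<in> M" "q \<in> M" "p \<noteq> q" "x \<in> line p q" "y \<in> line p q"
  shows "line p q \<subseteq> line x y"
proof
  fix z assume z: "z \<in> line p q"
  \<comment> \<open>Distances on the line are differences of coordinates, and among three reals one
    always lies between the other two.\<close>
  have "btw z x y \<or> btw x z y \<or> btw x y z"
    unfolding btw_def
    using coord_dist[OF assms(1-3) z assms(4)] coord_dist[OF assms(1-5)] coord_dist[OF assms(1-3) z assms(5)]
      coord_dist[OF assms(1-3) assms(4) z] coord_dist[OF assms(1-3) assms(5) z]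
    by argo
  then show "z \<in> line x y" using z by (auto simp: line_def)
qed

lemma line_eq:
  assumes "p \<in> M" "q \<in> M" "p \<noteq> q" "x \<in> line p q" "y \<in> line p q" "x \<noteq> y"
  shows "line x y = line p q"
proof
  have M: "x \<in> M" "y \<in> M" using assms by (auto simp: line_def)
  have sub: "line p q \<subseteq> line x y" by (rule line_subset[OF assms(1-5)])
  then show "line p q \<subseteq> line x y" .
  show "line x y \<subseteq> line p q"
    by (rule line_subset[OF M assms(6)]) (use sub in_line assms in blast)+
qed

end

section \<open>Progressions on lines, and a set that attains the bound\<close>

lemma card_even_less: "card {i. i < n \<and> even i} = (n + 1) div 2"
proof (induction n)
  case (Suc n)
  have "{i. i < Suc n \<and> even i} = {i. i < n \<and> even i} \<union> (if even n then {n} else {})"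
    by (auto simp: less_Suc_eq)
  then show ?case using Suc by (auto simp: card_insert_if)
qed simp

lemma card_odd_less: "card {i. i < n \<and> odd i} = n div 2"
proof (induction n)
  case (Suc n)
  have "{i. i < Suc n \<and> odd i} = {i. i < n \<and> odd i} \<union> (if odd n then {n} else {})"
    by (auto simp: less_Suc_eq)
  then show ?case using Suc by (auto simp: card_insert_if)
qed simp

text \<open>Indices i, k of equal parity are the ends of a progression of integers, i = k included;
  this counts the progressions in n equidistant points.\<close>

lemma card_even_sum:
  assumes "n \<ge> 1"
  shows "card {(i, k). i < n \<and> k < n \<and> even (i + k)} = n + max_proper_AP3 n"
proof -
  have eq: "{(i, k). i < n \<and> k < n \<and> even (i + k)} =
    {i. i < n \<and> even i} \<times> {i. i < n \<and> even i} \<union> {i. i < n \<and> odd i} \<times> {i. i < n \<and> odd i}"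
    by auto
  have "card {(i, k). i < n \<and> k < n \<and> even (i + k)} =
    ((n + 1) div 2) * ((n + 1) div 2) + (n div 2) * (n div 2)"
    unfolding eq
    by (subst card_Un_disjoint) (auto simp: card_cartesian_product card_even_less card_odd_less)
  moreover obtain h where "n = 2 * h + 1 \<or> n = 2 * h + 2"
    using positive_cases[of n] assms by auto
  ultimately show ?thesis
    by (elim disjE) (simp_all add: max_proper_AP3_def algebra_simps)
qed

context geodesic_space
begin

definition proper_AP3 :: "'a set \<Rightarrow> ('a \<times> 'a \<times> 'a) set" where
  "proper_AP3 A = {(a, b, c) \<in> AP3 d A. a \<noteq> c}"

lemma finite_AP3: "finite A \<Longrightarrow> finite (AP3 d A)"
  by (rule finite_subset[of _ "A \<times> A \<times> A"]) (auto simp: AP3_def)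

lemma card_AP3:
  assumes "A \<subseteq> M" "finite A"
  shows "card (AP3 d A) = card A + card (proper_AP3 A)"
proof -
  have "AP3 d A = (\<lambda>b. (b, b, b)) ` A \<union> proper_AP3 A"
  proof (intro equalityI subsetI)
    fix t assume t: "t \<in> AP3 d A"
    obtain a b c where abc: "t = (a, b, c)" by (cases t)
    have M: "a \<in> M" "b \<in> M" "c \<in> M" using t abc assms by (auto simp: AP3_def)
    show "t \<in> (\<lambda>b. (b, b, b)) ` A \<union> proper_AP3 A"
    proof (cases "a = c")
      case True
      \<comment> \<open>Equal ends make the distance to the midpoint vanish, so the triple is
        constant.\<close>
      then have "d a b = 0" using t abc d_refl M by (auto simp: AP3_def)
      then show ?thesis using True t abc d_eq_0_iff M by (auto simp: AP3_def)
    qed (use t abc in \<open>auto simp: proper_AP3_def\<close>)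
  next
    fix t assume "t \<in> (\<lambda>b. (b, b, b)) ` A \<union> proper_AP3 A"
    then show "t \<in> AP3 d A" using assms d_refl by (auto simp: AP3_def proper_AP3_def)
  qed
  moreover have "finite (proper_AP3 A)"
    by (rule finite_subset[OF _ finite_AP3[OF assms(2)]]) (auto simp: proper_AP3_def)
  ultimately have "card (AP3 d A) = card ((\<lambda>b. (b, b, b)) ` A) + card (proper_AP3 A)"
    using assms by (simp only:) (intro card_Un_disjoint; auto simp: proper_AP3_def)
  moreover have "card ((\<lambda>b. (b, b, b)) ` A) = card A"
    by (intro card_image inj_onI) simp
  ultimately show ?thesis by simp
qed

lemma card_proper_AP3_line:
  assumes "A \<subseteq> M" "finite A" "p \<in> A" "q \<in> A" "p \<noteq> q"
  shows "card {(a, b, c) \<in> proper_AP3 A. a \<in> line p q \<inter> A \<and> c \<in> line p q \<inter> A}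
    \<le> max_proper_AP3 (card (line p q \<inter> A))" (is "card ?S \<le> _")
proof -
  define T where "T = coord p q ` (line p q \<inter> A)"
  have pq: "p \<in> M" "q \<in> M" using assms by auto
  have finT: "finite T" using assms by (simp add: T_def)
  have inj: "inj_on (coord p q) (line p q \<inter> A)"
    using coord_inj[OF pq assms(5)] by (rule inj_on_subset) simp
  let ?R = "{(a, b, c). a \<in> T \<and> b \<in> T \<and> c \<in> T \<and> a \<noteq> c \<and> a + c = 2 * b}"
  let ?f = "\<lambda>(a, b, c). (coord p q a, coord p q b, coord p q c)"
  have S: "a \<in> line p q \<inter> A" "b \<in> line p q \<inter> A" "c \<in> line p q \<inter> A"
    "coord p q a \<noteq> coord p q c" "coord p q a + coord p q c = 2 * coord p q b"
    if "(a, b, c) \<in> ?S" for a b c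
  proof -
    have abc: "a \<in> A" "b \<in> A" "c \<in> A" "a \<in> line p q" "c \<in> line p q" "a \<noteq> c"
      "d a b = d b c" "d b c = d a c / 2"
      using that by (auto simp: proper_AP3_def AP3_def)
    \<comment> \<open>The midpoint is not assumed to lie in the block; betweenness puts it on the
      line through the ends, which is the same line.\<close>
    then have "btw a b c" by (simp add: btw_def)
    then have "b \<in> line a c" using abc assms by (auto simp: line_def)
    then have b: "b \<in> line p q" using line_eq[OF pq assms(5) abc(4,5,6)] by simp
    then show "a \<in> line p q \<inter> A" "b \<in> line p q \<inter> A" "c \<in> line p q \<inter> A" using abc by auto
    then show ac: "coord p q a \<noteq> coord p q c" using inj abc by (auto dest: inj_onD)
    \<comment> \<open>Opposite signs of the two coordinate differences would make the ends
      equal.\<close>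
    show "coord p q a + coord p q c = 2 * coord p q b"
      using coord_dist[OF pq assms(5) abc(4) b] coord_dist[OF pq assms(5) b abc(5)]
        coord_dist[OF pq assms(5) abc(4,5)] abc(7,8) ac by argo
  qed
  have "card ?S \<le> card ?R"
  proof (rule card_inj_on_le)
    show "inj_on ?f ?S"
    proof (rule inj_onI)
      fix t t' assume t: "t \<in> ?S" "t' \<in> ?S" "?f t = ?f t'"
      obtain a b c a' b' c' where eq: "t = (a, b, c)" "t' = (a', b', c')"
        by (metis prod_cases3)
      then have "coord p q a = coord p q a'" "coord p q b = coord p q b'" "coord p q c = coord p q c'"
        using t(3) by simp_all
      then show "t = t'"
        using inj_onD[OF inj, of a a'] inj_onD[OF inj, of b b'] inj_onD[OF inj, of c c']
          S(1-3)[OF t(1)[unfolded eq]] S(1-3)[OF t(2)[unfolded eq]] unfolding eq by blast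
    qed
    show "?f ` ?S \<subseteq> ?R"
    proof
      fix u assume "u \<in> ?f ` ?S"
      then obtain t where t: "t \<in> ?S" "u = ?f t" by (rule imageE)
      obtain a b c where abc: "t = (a, b, c)" by (metis prod_cases3)
      show "u \<in> ?R" using S[OF t(1)[unfolded abc]] by (simp add: T_def t(2) abc)
    qed
    show "finite ?R"
      by (rule finite_subset[of _ "T \<times> T \<times> T"]) (use finT in auto)
  qed
  also have "\<dots> \<le> max_proper_AP3 (card T)" by (rule card_proper_AP3_real_le[OF finT])
  also have "card T = card (line p q \<inter> A)" unfolding T_def by (rule card_image[OF inj])
  finally show ?thesis .
qed

lemma blocks_line:
  assumes "A \<subseteq> M" "finite A"
  shows "blocks A (\<lambda>p q. line p q \<inter> A) (proper_AP3 A)"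
proof
  show "p \<in> line p q \<inter> A \<and> q \<in> line p q \<inter> A" if "p \<in> A" "q \<in> A" "p \<noteq> q" for p q
    using in_line[of p q] that assms by auto
  show "line x y \<inter> A = line p q \<inter> A"
    if "p \<in> A" "q \<in> A" "p \<noteq> q" "x \<in> line p q \<inter> A" "y \<in> line p q \<inter> A" "x \<noteq> y" for p q x y
    using line_eq[of p q x y] that assms by auto
  show "a \<in> A \<and> b \<in> A \<and> c \<in> A \<and> a \<noteq> c" if "(a, b, c) \<in> proper_AP3 A" for a b c
    using that by (auto simp: proper_AP3_def AP3_def)
qed (use assms card_proper_AP3_line in auto)

lemma card_AP3_le:
  assumes "A \<subseteq> M" "finite A" "card A \<ge> 1"
  shows "card (AP3 d A) \<le> card A + max_proper_AP3 (card A)"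
  using blocks.card_P_le[OF blocks_line[OF assms(1,2)] assms(3)] card_AP3[OF assms(1,2)] by simp

text \<open>The points with least and greatest coordinate span a geodesic; every point of A is
  between them, so by uniqueness it lies on that geodesic.\<close>

lemma line_subset_geodesic:
  assumes "A \<subseteq> line p q" "finite A" "A \<noteq> {}" "p \<in> M" "q \<in> M" "p \<noteq> q"
  shows "\<exists>I \<gamma>. geodesic M d I \<gamma> \<and> A \<subseteq> \<gamma> ` I"
proof -
  have "\<exists>v\<in>A. \<forall>x\<in>A. f v \<le> f x" for f :: "'a \<Rightarrow> real"
    using arg_min_if_finite(1)[OF assms(2,3), of f] arg_min_least[OF assms(2,3), of _ f] by blast
  from this[of "coord p q"] this[of "\<lambda>x. - coord p q x"]
  obtain u v where u: "u \<in> A" "\<And>x. x \<in> A \<Longrightarrow> coord p q u \<le> coord p q x"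
    and v: "v \<in> A" "\<And>x. x \<in> A \<Longrightarrow> coord p q x \<le> coord p q v"
    unfolding neg_le_iff_le by blast
  have M: "A \<subseteq> M" using assms by (auto simp: line_def)
  obtain \<gamma> where \<gamma>: "geodesic M d {0..d u v} \<gamma>" "\<gamma> 0 = u" "\<gamma> (d u v) = v"
    by (rule geodesic_exists[OF subsetD[OF M u(1)] subsetD[OF M v(1)]])
  have "x \<in> \<gamma> ` {0..d u v}" if x: "x \<in> A" for x
  proof -
    have xM: "x \<in> M" "u \<in> M" "v \<in> M" using x M u v by auto
    have line: "x \<in> line p q" "u \<in> line p q" "v \<in> line p q" using x u v assms by auto
    have "btw u x v"
      unfolding btw_def
      using u(2)[OF x] v(2)[OF x] coord_dist[OF assms(4-6) line(2,1)]
        coord_dist[OF assms(4-6) line(1,3)] coord_dist[OF assms(4-6) line(2,3)] by linarith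
    then obtain \<gamma>' where \<gamma>': "geodesic M d {0..d u v} \<gamma>'" "\<gamma>' 0 = u" "\<gamma>' (d u x) = x" "\<gamma>' (d u v) = v"
      by (rule geodesic_through[OF xM(2,1,3)])
    have r: "d u x \<in> {0..d u v}"
      using \<open>btw u x v\<close> d_nonneg[of u x] d_nonneg[of x v] xM by (simp add: btw_def)
    then have "\<gamma> (d u x) = x"
      using geodesic_unique[OF \<gamma>(1) \<gamma>'(1)] \<gamma> \<gamma>' by simp
    then show ?thesis using r by force
  qed
  then show ?thesis using \<gamma>(1) by blast
qed

text \<open>Counting forces a single block from three points on; one or two points lie on a geodesic
  trivially.\<close>

lemma extremal_AP3_geodesic:
  assumes "A \<subseteq> M" "finite A" "card A \<ge> 1" "card (AP3 d A) = card A + max_proper_AP3 (card A)"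
  shows "\<exists>I \<gamma>. geodesic M d I \<gamma> \<and> A \<subseteq> \<gamma> ` I"
proof (cases "card A = 1")
  case True
  then obtain a where a: "A = {a}" using card_1_singletonE by blast
  then have "geodesic M d {0} (\<lambda>_. a)" using assms(1) by (intro geodesicI) auto
  then show ?thesis using a by (intro exI[of _ "{0}"] exI[of _ "\<lambda>_. a"]) auto
next
  case False
  have "\<exists>p q. p \<in> A \<and> q \<in> A \<and> p \<noteq> q \<and> A \<subseteq> line p q"
  proof (cases "card A = 2")
    case True
    then obtain p q where "A = {p, q}" "p \<noteq> q" by (meson card_2_iff)
    moreover from this have "A \<subseteq> line p q" using in_line[of p q] assms(1) by simp
    ultimately show ?thesis by blast
  next
    case 2: False
    interpret blocks A "\<lambda>p q. line p q \<inter> A" "proper_AP3 A" by (rule blocks_line[OF assms(1,2)])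
    have "A \<in> lines"
      using card_AP3[OF assms(1,2)] assms(3,4) False 2 by (intro card_P_eq_imp_line) auto
    then obtain p q where "p \<in> A" "q \<in> A" "p \<noteq> q" "A = line p q \<inter> A" by (rule lineE)
    then show ?thesis by blast
  qed
  then show ?thesis using line_subset_geodesic[of A] assms(1,2) by blast
qed

lemma equidistant_set:
  assumes "p \<in> M" "q \<in> M" "p \<noteq> q" "n \<ge> 1"
  obtains A where "A \<subseteq> M" "finite A" "card A = n" "card (AP3 d A) = n + max_proper_AP3 n"
proof -
  obtain \<gamma> where \<gamma>: "geodesic M d {0..d p q} \<gamma>" using geodesic_exists assms by blast
  \<comment> \<open>Dividing by n, not by n - 1, also makes sense for n = 1; the end point q is then
    not among the chosen points.\<close>
  define h where "h = d p q / n"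
  define pt where "pt i = \<gamma> (real i * h)" for i :: nat
  have h: "h > 0" using d_pos assms by (simp add: h_def)
  have r: "real i * h \<in> {0..d p q}" if "i < n" for i
  proof -
    have "real i * h \<le> real n * h" using that h by (intro mult_right_mono) auto
    moreover have "0 \<le> real i * h" using h by simp
    moreover have "real n * h = d p q" using assms(4) by (simp add: h_def)
    ultimately show ?thesis by simp
  qed
  have dist: "d (pt i) (pt j) = \<bar>real i - real j\<bar> * h" if "i < n" "j < n" for i j
    unfolding pt_def geodesic_dist[OF \<gamma> r[OF that(1)] r[OF that(2)]]
    using h by (simp add: abs_mult flip: left_diff_distrib)
  have M: "pt i \<in> M" if "i < n" for i
    unfolding pt_def using geodesic_in[OF \<gamma> r[OF that]] .
  have inj: "inj_on pt {..<n}"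
  proof (rule inj_onI)
    fix i j assume ij: "i \<in> {..<n}" "j \<in> {..<n}" "pt i = pt j"
    then have "d (pt i) (pt j) = 0" using d_refl M by auto
    then show "i = j" using dist[of i j] ij h by auto
  qed
  define A where "A = pt ` {..<n}"
  have A: "A \<subseteq> M" "finite A" "card A = n" using M inj by (auto simp: A_def card_image)
  let ?S = "{(i, k). i < n \<and> k < n \<and> even (i + k)}"
  have "card ?S \<le> card (AP3 d A)"
  proof (rule card_inj_on_le)
    show "inj_on (\<lambda>(i, k). (pt i, pt ((i + k) div 2), pt k)) ?S"
      using inj by (auto simp: inj_on_def)
    show "(\<lambda>(i, k). (pt i, pt ((i + k) div 2), pt k)) ` ?S \<subseteq> AP3 d A"
    proof safe
      fix i k assume ik: "i < n" "k < n" "even (i + k)"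
      from ik(3) obtain j where j: "i + k = 2 * j" by (rule evenE)
      then have jn: "j < n" using ik by linarith
      have "real i + real k = 2 * real j" using j by linarith
      then have "real i = 2 * real j - real k" by simp
      then have "real i - real j = real j - real k" "real i - real k = 2 * (real j - real k)"
        by simp_all
      then have "\<bar>real i - real j\<bar> = \<bar>real j - real k\<bar>" "\<bar>real i - real k\<bar> = 2 * \<bar>real j - real k\<bar>"
        by (simp_all only: abs_mult abs_numeral)
      then have "d (pt i) (pt j) = d (pt j) (pt k)" "d (pt j) (pt k) = d (pt i) (pt k) / 2"
        using dist[OF ik(1) jn] dist[OF jn ik(2)] dist[OF ik(1,2)] by simp_all
      then show "(pt i, pt ((i + k) div 2), pt k) \<in> AP3 d A"
        using ik jn j by (auto simp: AP3_def A_def)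
    qed
    show "finite (AP3 d A)" by (rule finite_AP3[OF A(2)])
  qed
  then have "n + max_proper_AP3 n \<le> card (AP3 d A)" using card_even_sum assms(4) by simp
  then show ?thesis using that[OF A] card_AP3_le[OF A(1,2)] A(3) assms(4) by simp
qed

theorem max_AP3_eq:
  assumes "p \<in> M" "q \<in> M" "p \<noteq> q" "n \<ge> 1"
  shows "max_AP3 M d n = n + max_proper_AP3 n"
  unfolding max_AP3_def
proof (rule Max_eqI)
  have bound: "x \<le> n + max_proper_AP3 n"
    if "x \<in> {card (AP3 d A) |A. A \<subseteq> M \<and> finite A \<and> card A = n}" for x
    using that card_AP3_le assms(4) by auto
  then show "finite {card (AP3 d A) |A. A \<subseteq> M \<and> finite A \<and> card A = n}"
    by (meson finite_nat_set_iff_bounded_le)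
  show "y \<le> n + max_proper_AP3 n" if "y \<in> {card (AP3 d A) |A. A \<subseteq> M \<and> finite A \<and> card A = n}" for y
    using bound that .
  show "n + max_proper_AP3 n \<in> {card (AP3 d A) |A. A \<subseteq> M \<and> finite A \<and> card A = n}"
    by (rule equidistant_set[OF assms]) (metis (mono_tags, lifting) mem_Collect_eq)
qed

end

section \<open>Geodesics do not branch\<close>

text \<open>\<open>\<psi>\<close> is the inverse of a chart around the point \<open>\<psi> x0\<close>, and \<open>DG x w v\<close> is the derivative of
  \<open>\<lambda>x. G x v v\<close> in the direction \<open>w\<close>.\<close>

locale local_metric = metric_on M d
  for M :: "'a set" and d :: "'a \<Rightarrow> 'a \<Rightarrow> real" +
  fixes \<psi> :: "'e::euclidean_space \<Rightarrow> 'a" and x0 :: 'e and R r0 K :: real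
    and G DG :: "'e \<Rightarrow> 'e \<Rightarrow> 'e \<Rightarrow> real"
  assumes R: "R > 0" and r0: "r0 > 0" and K: "K \<ge> 1"
    and psi_in: "\<And>x. x \<in> ball x0 R \<Longrightarrow> \<psi> x \<in> M"
    and bil: "\<And>x. x \<in> ball x0 R \<Longrightarrow> bilinear (G x)"
    and G_sym: "\<And>x v w. x \<in> ball x0 R \<Longrightarrow> G x v w = G x w v"
    and G_lower: "\<And>x v. x \<in> ball x0 R \<Longrightarrow> (norm v)\<^sup>2 \<le> K * G x v v"
    and G_upper: "\<And>x v w. x \<in> ball x0 R \<Longrightarrow> \<bar>G x v w\<bar> \<le> K * norm v * norm w"
    and G_lip: "\<And>x y v w. x \<in> ball x0 R \<Longrightarrow> y \<in> ball x0 R \<Longrightarrow>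
      \<bar>G y v w - G x v w\<bar> \<le> K * norm (y - x) * norm v * norm w"
    and DG_linear: "\<And>x v. x \<in> ball x0 R \<Longrightarrow> linear (\<lambda>w. DG x w v)"
    and DG_bound: "\<And>x w v. x \<in> ball x0 R \<Longrightarrow> \<bar>DG x w v\<bar> \<le> K * norm w * (norm v)\<^sup>2"
    and G_taylor: "\<And>x y v. x \<in> ball x0 R \<Longrightarrow> y \<in> ball x0 R \<Longrightarrow>
      \<bar>G y v v - G x v v - DG x (y - x) v\<bar> \<le> K * (norm (y - x))\<^sup>2 * (norm v)\<^sup>2"
    and d_upper: "\<And>x y. x \<in> ball x0 R \<Longrightarrow> y \<in> ball x0 R \<Longrightarrow>
      (d (\<psi> x) (\<psi> y))\<^sup>2 \<le> G x (y - x) (y - x) + K * norm (y - x) ^ 3"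
    and d_lower: "\<And>x y. x \<in> ball x0 R \<Longrightarrow> y \<in> ball x0 R \<Longrightarrow>
      G x (y - x) (y - x) \<le> (d (\<psi> x) (\<psi> y))\<^sup>2 + K * norm (y - x) ^ 3"
    and d_comp: "\<And>x y. x \<in> ball x0 R \<Longrightarrow> y \<in> ball x0 R \<Longrightarrow> norm (y - x) \<le> K * d (\<psi> x) (\<psi> y)"
    and near: "\<And>p. p \<in> M \<Longrightarrow> d (\<psi> x0) p < r0 \<Longrightarrow> p \<in> \<psi> ` ball x0 R"
begin

section \<open>Perturbed polygons and the semiconcavity of the distance\<close>

lemma half_ball: "x \<in> ball x0 (R/2) \<Longrightarrow> norm w \<le> R/2 \<Longrightarrow> x + w \<in> ball x0 R"
proof -
  assume "x \<in> ball x0 (R/2)" "norm w \<le> R/2"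
  moreover have "dist x0 (x + w) \<le> dist x0 x + norm w"
    using dist_triangle[of x0 "x + w" x] by (simp add: dist_norm)
  ultimately show ?thesis by simp
qed

lemma half_ball_subset: "x \<in> ball x0 (R/2) \<Longrightarrow> x \<in> ball x0 R"
  using R by auto

text \<open>The squared length of the moved edge is expanded in w. The terms linear in w are kept
  exactly, because along the polygon they add up to a linear functional; the rest is bounded by
  \<eta>^2 |w|^2 and by cubic terms in h and \<eta>. The constant \<open>2 * K^3\<close> comes from
  K^3 + 2K^2 + K \<le> 4K^3 after division by 2h.\<close>

lemma perturbed_step:
  fixes w :: 'e
  assumes z: "z \<in> ball x0 (R/2)" "z + \<Delta> \<in> ball x0 (R/2)"
    and h: "h > 0" "h \<le> \<eta>" "d (\<psi> z) (\<psi> (z + \<Delta>)) = h"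
    and \<tau>: "0 \<le> \<tau>" "\<tau> + \<eta> \<le> 1" and w: "norm w \<le> R/2"
  shows "d (\<psi> (z + \<tau> *\<^sub>R w)) (\<psi> (z + \<Delta> + (\<tau> + \<eta>) *\<^sub>R w)) \<le>
    h + (\<tau> * DG z w \<Delta> + 2 * \<eta> * G z \<Delta> w) / (2 * h) + 2 * K^3 * \<eta>\<^sup>2 * (norm w)\<^sup>2 / h +
    (K^4 * h^3 + K * (K + R)^3 * \<eta>^3) / (2 * h)"
proof -
  define z' where "z' = z + \<tau> *\<^sub>R w"
  define \<Delta>' where "\<Delta>' = \<Delta> + \<eta> *\<^sub>R w"
  have \<eta>: "0 < \<eta>" using h by simp
  have zb: "z \<in> ball x0 R" "z + \<Delta> \<in> ball x0 R" using z half_ball_subset by auto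
  have n1: "norm (\<tau> *\<^sub>R w) \<le> norm w" "norm ((\<tau> + \<eta>) *\<^sub>R w) \<le> norm w"
    using \<tau> \<eta> by (auto intro!: mult_left_le_one_le)
  have z'b: "z' \<in> ball x0 R" unfolding z'_def using n1 w by (intro half_ball z) auto
  have z''b: "z' + \<Delta>' \<in> ball x0 R"
  proof -
    have "z' + \<Delta>' = (z + \<Delta>) + (\<tau> + \<eta>) *\<^sub>R w" by (simp add: z'_def \<Delta>'_def algebra_simps)
    then show ?thesis using half_ball[OF z(2)] n1 w by (metis order_trans)
  qed
  have n\<Delta>: "norm \<Delta> \<le> K * h" using d_comp[OF zb] h by simp
  have n\<Delta>\<eta>: "norm \<Delta> \<le> K * \<eta>" using n\<Delta> mult_left_mono[OF h(2), of K] K by linarith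
  have n\<Delta>2: "(norm \<Delta>)\<^sup>2 \<le> K\<^sup>2 * h\<^sup>2"
    using power_mono[OF n\<Delta>, of 2] by (simp add: power_mult_distrib)
  have n\<Delta>3: "norm \<Delta> ^ 3 \<le> K^3 * h^3"
    using power_mono[OF n\<Delta>, of 3] by (simp add: power_mult_distrib)
  have n\<Delta>': "norm \<Delta>' \<le> (K + R) * \<eta>"
  proof -
    have "norm \<Delta>' \<le> norm \<Delta> + \<eta> * norm w"
      unfolding \<Delta>'_def using norm_triangle_ineq[of \<Delta> "\<eta> *\<^sub>R w"] \<eta> by simp
    also have "\<dots> \<le> K * \<eta> + \<eta> * R"
    proof (intro add_mono mult_left_mono)
      show "norm \<Delta> \<le> K * \<eta>" by (rule n\<Delta>\<eta>)
    qed (use w R \<eta> in auto)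
    finally show ?thesis by (simp add: algebra_simps)
  qed
  have n\<Delta>'3: "norm \<Delta>' ^ 3 \<le> (K + R)^3 * \<eta>^3"
    using power_mono[OF n\<Delta>', of 3] by (simp add: power_mult_distrib)
  note bl = bil[OF z'b] bil[OF zb(1)]
  note bsimps = bilinear_ladd[OF bl(1)] bilinear_radd[OF bl(1)] bilinear_lmul[OF bl(1)] bilinear_rmul[OF bl(1)]
  have \<eta>2: "h * \<eta> \<le> \<eta>\<^sup>2" "h\<^sup>2 \<le> \<eta>\<^sup>2"
    using h by (auto simp: power2_eq_square intro: mult_mono)
  have zz': "z' - z = \<tau> *\<^sub>R w" by (simp add: z'_def)
  define W where "W = (norm w)\<^sup>2"
  have W0: "W \<ge> 0" by (simp add: W_def)
  \<comment> \<open>Three parts of the form at the moved base point: Taylor for the pure \<Delta>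
    part, the Lipschitz bound for the mixed part, the plain bound for the part quadratic in
    w.\<close>
  have t1: "G z' \<Delta> \<Delta> \<le> G z \<Delta> \<Delta> + \<tau> * DG z w \<Delta> + K^3 * (\<eta>\<^sup>2 * W)"
  proof -
    have "G z' \<Delta> \<Delta> \<le> G z \<Delta> \<Delta> + DG z (\<tau> *\<^sub>R w) \<Delta> + K * (norm (\<tau> *\<^sub>R w))\<^sup>2 * (norm \<Delta>)\<^sup>2"
      using G_taylor[OF zb(1) z'b, of \<Delta>] by (simp add: zz')
    moreover have "DG z (\<tau> *\<^sub>R w) \<Delta> = \<tau> * DG z w \<Delta>"
      using linear_cmul[OF DG_linear[OF zb(1)]] by simp
    moreover have "K * (norm (\<tau> *\<^sub>R w))\<^sup>2 * (norm \<Delta>)\<^sup>2 \<le> K * W * (K\<^sup>2 * \<eta>\<^sup>2)"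
    proof (intro mult_mono)
      show "(norm (\<tau> *\<^sub>R w))\<^sup>2 \<le> W" unfolding W_def using n1 by (intro power_mono) auto
      show "(norm \<Delta>)\<^sup>2 \<le> K\<^sup>2 * \<eta>\<^sup>2"
        using n\<Delta>2 mult_left_mono[OF \<eta>2(2), of "K\<^sup>2"] by simp
    qed (use K W0 in auto)
    ultimately show ?thesis by (simp add: power2_eq_square power3_eq_cube mult_ac)
  qed
  have t2: "\<eta> * G z' \<Delta> w \<le> \<eta> * G z \<Delta> w + K\<^sup>2 * (\<eta>\<^sup>2 * W)"
  proof -
    have "G z' \<Delta> w \<le> G z \<Delta> w + K * norm (\<tau> *\<^sub>R w) * norm \<Delta> * norm w"
      using G_lip[OF zb(1) z'b, of \<Delta> w] by (simp add: zz')
    also have "K * norm (\<tau> *\<^sub>R w) * norm \<Delta> * norm w \<le> K * norm w * (K * \<eta>) * norm w"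
      using n1 K \<eta> n\<Delta>\<eta> by (intro mult_mono) auto
    finally have "\<eta> * G z' \<Delta> w \<le> \<eta> * (G z \<Delta> w + K * norm w * (K * \<eta>) * norm w)"
      using \<eta> by simp
    then show ?thesis by (simp add: W_def algebra_simps power2_eq_square)
  qed
  have t3: "G z' w w \<le> K * W"
    using G_upper[OF z'b, of w w] by (simp add: W_def power2_eq_square mult_ac)
  have "G z' \<Delta>' \<Delta>' = G z' \<Delta> \<Delta> + 2 * (\<eta> * G z' \<Delta> w) + \<eta>\<^sup>2 * G z' w w"
    unfolding \<Delta>'_def using G_sym[OF z'b, of w \<Delta>]
    by (simp add: bsimps algebra_simps power2_eq_square)
  also have "\<dots> \<le> (G z \<Delta> \<Delta> + \<tau> * DG z w \<Delta> + K^3 * (\<eta>\<^sup>2 * W)) + 2 * (\<eta> * G z \<Delta> w + K\<^sup>2 * (\<eta>\<^sup>2 * W)) + \<eta>\<^sup>2 * (K * W)"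
    using t1 t2 t3 by (intro add_mono mult_left_mono) auto
  also have "\<dots> = G z \<Delta> \<Delta> + (\<tau> * DG z w \<Delta> + 2 * \<eta> * G z \<Delta> w) + (K^3 + 2 * K\<^sup>2 + K) * (\<eta>\<^sup>2 * W)"
    by (simp add: algebra_simps)
  also have "\<dots> \<le> (h\<^sup>2 + K * (K^3 * h^3)) + (\<tau> * DG z w \<Delta> + 2 * \<eta> * G z \<Delta> w) + (4 * K^3) * (\<eta>\<^sup>2 * W)"
  proof -
    have "G z \<Delta> \<Delta> \<le> h\<^sup>2 + K * (K^3 * h^3)"
      using d_lower[OF zb] mult_left_mono[OF n\<Delta>3, of K] K
      unfolding add_diff_cancel_left' h(3) by linarith
    moreover have "K\<^sup>2 \<le> K^3" "K \<le> K^3" using K power_increasing[of 1 3 K] by (auto intro: power_increasing)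
    then have "(K^3 + 2 * K\<^sup>2 + K) * (\<eta>\<^sup>2 * W) \<le> (4 * K^3) * (\<eta>\<^sup>2 * W)"
      using W0 by (intro mult_right_mono) auto
    ultimately show ?thesis by linarith
  qed
  finally have G': "G z' \<Delta>' \<Delta>' \<le> (h\<^sup>2 + K * (K^3 * h^3)) + (\<tau> * DG z w \<Delta> + 2 * \<eta> * G z \<Delta> w) + (4 * K^3) * (\<eta>\<^sup>2 * W)" .
  define D where "D = d (\<psi> z') (\<psi> (z' + \<Delta>'))"
  have "D\<^sup>2 \<le> G z' \<Delta>' \<Delta>' + K * norm \<Delta>' ^ 3"
    using d_upper[OF z'b z''b] by (simp add: D_def)
  also have "\<dots> \<le> (h\<^sup>2 + K * (K^3 * h^3)) + (\<tau> * DG z w \<Delta> + 2 * \<eta> * G z \<Delta> w) + (4 * K^3) * (\<eta>\<^sup>2 * W)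
      + K * ((K + R)^3 * \<eta>^3)"
    using G' n\<Delta>'3 K by (intro add_mono mult_left_mono) auto
  finally have D2: "D\<^sup>2 \<le> h\<^sup>2 + (\<tau> * DG z w \<Delta> + 2 * \<eta> * G z \<Delta> w) + 4 * K^3 * \<eta>\<^sup>2 * W
      + (K^4 * h^3 + K * (K + R)^3 * \<eta>^3)"
    by (simp add: power_numeral_reduce mult_ac)
  \<comment> \<open>This is the bound of the square root by its tangent at h^2; it turns an estimate
    of D^2 into one of D after division by 2h.\<close>
  have "2 * h * D \<le> D\<^sup>2 + h\<^sup>2"
    using sum_squares_bound[of h D] by (simp add: power2_eq_square)
  then have "2 * h * D \<le> 2 * h\<^sup>2 + (\<tau> * DG z w \<Delta> + 2 * \<eta> * G z \<Delta> w) + 4 * K^3 * \<eta>\<^sup>2 * W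
      + (K^4 * h^3 + K * (K + R)^3 * \<eta>^3)"
    using D2 by linarith
  then have "D \<le> (2 * h\<^sup>2 + (\<tau> * DG z w \<Delta> + 2 * \<eta> * G z \<Delta> w) + 4 * K^3 * \<eta>\<^sup>2 * W
      + (K^4 * h^3 + K * (K + R)^3 * \<eta>^3)) / (2 * h)"
    using h(1) by (simp add: pos_le_divide_eq mult_ac)
  also have "\<dots> = h + (\<tau> * DG z w \<Delta> + 2 * \<eta> * G z \<Delta> w) / (2 * h) + 2 * K^3 * \<eta>\<^sup>2 * W / h +
    (K^4 * h^3 + K * (K + R)^3 * \<eta>^3) / (2 * h)"
    using h(1) by (simp add: field_simps power2_eq_square)
  finally have "D \<le> \<dots>" .
  moreover have "z' + \<Delta>' = z + \<Delta> + (\<tau> + \<eta>) *\<^sub>R w"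
    by (simp add: z'_def \<Delta>'_def algebra_simps)
  ultimately show ?thesis unfolding D_def W_def z'_def by simp
qed

lemma polygon_inequality:
  assumes "\<And>i. i \<le> N \<Longrightarrow> p i \<in> M"
  shows "d (p 0) (p N) \<le> (\<Sum>i<N. d (p i) (p (Suc i)))"
  using assms
proof (induction N)
  case (Suc N)
  then have "d (p 0) (p N) \<le> (\<Sum>i<N. d (p i) (p (Suc i)))" by simp
  moreover have "d (p 0) (p (Suc N)) \<le> d (p 0) (p N) + d (p N) (p (Suc N))"
    using Suc.prems by (intro d_triangle) auto
  ultimately show ?case by simp
qed (simp add: d_refl)

text \<open>The \<open>i\<close>-th of \<open>N + 1\<close> equidistant points on the geodesic is moved by \<open>(i / N) w\<close>. The error of each
  edge is cubic in \<open>1 / N\<close> before the division by \<open>h\<close>, so the sum of the errors is of order \<open>1 / N\<close>.\<close>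

lemma perturbed_curve:
  fixes x :: "real \<Rightarrow> 'e" and N :: nat
  assumes \<epsilon>: "0 < \<epsilon>" "\<epsilon> \<le> 1"
    and x: "\<And>t. t \<in> {0..\<epsilon>} \<Longrightarrow> x t \<in> ball x0 (R/2)"
    and iso: "\<And>s t. s \<in> {0..\<epsilon>} \<Longrightarrow> t \<in> {0..\<epsilon>} \<Longrightarrow> d (\<psi> (x s)) (\<psi> (x t)) = \<bar>s - t\<bar>"
    and N: "N > 0"
  shows "\<exists>A. norm A \<le> 2 * K^3 \<and> (\<forall>w. norm w \<le> R/2 \<longrightarrow> d (\<psi> (x 0)) (\<psi> (x \<epsilon> + w)) \<le>
      \<epsilon> + A \<bullet> w + 2 * K^3 / \<epsilon> * (norm w)\<^sup>2 + (K^4 * \<epsilon>^3 + K * (K + R)^3) / (2 * \<epsilon>) / real N)"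
proof -
  define \<eta> where "\<eta> = 1 / real N"
  define h where "h = \<epsilon> * \<eta>"
  define z where "z i = x (real i * h)" for i
  define l where "l i w = (real i * \<eta>) * DG (z i) w (z (Suc i) - z i) + 2 * \<eta> * G (z i) (z (Suc i) - z i) w" for i w
  \<comment> \<open>The Riesz vector of the sum of the linear parts \<open>l i\<close>, divided by
    2h as in \<open>perturbed_step\<close>.\<close>
  define A where "A = (\<Sum>b\<in>Basis. ((\<Sum>i<N. l i b) / (2 * h)) *\<^sub>R b)"
  have \<eta>: "0 < \<eta>" "real N * \<eta> = 1" using N by (auto simp: \<eta>_def)
  have h: "0 < h" "h \<le> \<eta>" "real N * h = \<epsilon>" using \<eta> \<epsilon> by (auto simp: h_def)
  have t: "real i * h \<in> {0..\<epsilon>}" if "i \<le> N" for i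
  proof -
    have "real i * h \<le> real N * h" using that h by (intro mult_right_mono) auto
    then show ?thesis using h by simp
  qed
  have zb: "z i \<in> ball x0 (R/2)" if "i \<le> N" for i unfolding z_def using x t that by blast
  have zR: "z i \<in> ball x0 R" if "i \<le> N" for i using zb[OF that] half_ball_subset by blast
  have dz: "d (\<psi> (z i)) (\<psi> (z (Suc i))) = h" if "i < N" for i
  proof -
    have "d (\<psi> (z i)) (\<psi> (z (Suc i))) = \<bar>real i * h - real (Suc i) * h\<bar>"
      unfolding z_def using that by (intro iso t) auto
    then show ?thesis using h by (simp add: algebra_simps)
  qed
  have n\<Delta>: "norm (z (Suc i) - z i) \<le> K * h" if "i < N" for i
    using d_comp[of "z i" "z (Suc i)"] zR dz that by simp
  have l_lin: "linear (l i)" if "i < N" for i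
  proof -
    have 1: "linear (\<lambda>w. DG (z i) w (z (Suc i) - z i))" using DG_linear zR that by simp
    have 2: "linear (\<lambda>w. G (z i) (z (Suc i) - z i) w)"
      using bil[OF zR[of i]] that by (simp add: bilinear_def)
    show ?thesis
      unfolding l_def by (rule linearI)
        (simp_all add: linear_add[OF 1] linear_add[OF 2] linear_cmul[OF 1] linear_cmul[OF 2] algebra_simps)
  qed
  have A: "A \<bullet> w = (\<Sum>i<N. l i w) / (2 * h)" for w
  proof -
    have lin: "linear (\<lambda>w. (\<Sum>i<N. l i w) / (2 * h))"
    proof (rule linearI)
      show "(\<Sum>i<N. l i (v + w)) / (2 * h) = (\<Sum>i<N. l i v) / (2 * h) + (\<Sum>i<N. l i w) / (2 * h)" for v w
        using l_lin by (simp add: linear_add sum.distrib add_divide_distrib)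
      show "(\<Sum>i<N. l i (c *\<^sub>R w)) / (2 * h) = c *\<^sub>R ((\<Sum>i<N. l i w) / (2 * h))" for c w
        using l_lin by (simp add: linear_cmul sum_distrib_left)
    qed
    have "(\<Sum>i<N. l i w) / (2 * h) = (\<lambda>w. (\<Sum>i<N. l i w) / (2 * h)) (\<Sum>b\<in>Basis. (w \<bullet> b) *\<^sub>R b)"
      by (simp only: euclidean_representation)
    also have "\<dots> = (\<Sum>b\<in>Basis. (w \<bullet> b) *\<^sub>R ((\<Sum>i<N. l i b) / (2 * h)))"
      by (simp only: linear_sum[OF lin] linear_cmul[OF lin])
    also have "\<dots> = A \<bullet> w"
      unfolding A_def by (simp add: inner_sum_left inner_commute[of w] mult_ac)
    finally show ?thesis by simp
  qed
  have l_bound: "l i w \<le> 3 * K^3 * \<eta> * h * norm w" if "i < N" for i w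
  proof -
    have b: "z i \<in> ball x0 R" using zR that by simp
    have i: "0 \<le> real i * \<eta>" "real i * \<eta> \<le> 1" using that \<eta> N by (auto simp: \<eta>_def)
    have "DG (z i) w (z (Suc i) - z i) \<le> K * norm w * (norm (z (Suc i) - z i))\<^sup>2"
      using DG_bound[OF b, of w "z (Suc i) - z i"] by simp
    also have "\<dots> \<le> K * norm w * (K * h)\<^sup>2"
      using n\<Delta>[OF that] K by (intro mult_left_mono power_mono) auto
    also have "\<dots> = K^3 * norm w * (h * h)" by (simp add: power2_eq_square power3_eq_cube)
    also have "\<dots> \<le> K^3 * norm w * (\<eta> * h)"
      using h K by (intro mult_left_mono mult_right_mono) auto
    finally have 1: "DG (z i) w (z (Suc i) - z i) \<le> K^3 * norm w * (\<eta> * h)" .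
    have "(real i * \<eta>) * DG (z i) w (z (Suc i) - z i) \<le> (real i * \<eta>) * (K^3 * norm w * (\<eta> * h))"
      using 1 i by (intro mult_left_mono) auto
    also have "\<dots> \<le> K^3 * norm w * (\<eta> * h)"
      using i K \<eta> h by (intro mult_left_le_one_le) auto
    finally have 2: "(real i * \<eta>) * DG (z i) w (z (Suc i) - z i) \<le> K^3 * norm w * (\<eta> * h)" .
    have "G (z i) (z (Suc i) - z i) w \<le> K * norm (z (Suc i) - z i) * norm w"
      using G_upper[OF b, of "z (Suc i) - z i" w] by simp
    also have "\<dots> \<le> K * (K * h) * norm w"
      using n\<Delta>[OF that] K by (intro mult_right_mono mult_left_mono) auto
    also have "\<dots> = K^2 * (h * norm w)" by (simp add: power2_eq_square)
    also have "\<dots> \<le> K^3 * (h * norm w)"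
      using K h power_increasing[of 2 3 K] by (intro mult_right_mono) auto
    finally have "2 * \<eta> * G (z i) (z (Suc i) - z i) w \<le> 2 * \<eta> * (K^3 * (h * norm w))"
      using \<eta> by simp
    then show ?thesis unfolding l_def using 2 by (simp add: algebra_simps)
  qed
  \<comment> \<open>A bound independent of N; it keeps the vectors A in a compact set when N
    grows.\<close>
  have A_bound: "A \<bullet> w \<le> 2 * K^3 * norm w" for w
  proof -
    have "(\<Sum>i<N. l i w) \<le> (\<Sum>i<N. 3 * K^3 * \<eta> * h * norm w)"
      by (intro sum_mono l_bound) auto
    also have "\<dots> = 3 * K^3 * h * norm w * (real N * \<eta>)" by simp
    finally have "A \<bullet> w \<le> (3 * K^3 * h * norm w) / (2 * h)"
      unfolding A \<eta> using h by (intro divide_right_mono) auto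
    also have "\<dots> = (3/2) * (K^3 * norm w)" using h by simp
    also have "\<dots> \<le> 2 * (K^3 * norm w)" using K by (intro mult_right_mono) auto
    finally show ?thesis by simp
  qed
  show ?thesis
  proof (intro exI[of _ A] conjI allI impI)
    have "norm A * norm A \<le> 2 * K^3 * norm A"
      using A_bound[of A] by (simp add: power2_norm_eq_inner[symmetric] power2_eq_square)
    then show "norm A \<le> 2 * K^3"
      using K by (cases "A = 0") auto
    fix w :: 'e assume w: "norm w \<le> R/2"
    define p where "p i = \<psi> (z i + (real i * \<eta>) *\<^sub>R w)" for i
    define E where "E = (K^4 * h^3 + K * (K + R)^3 * \<eta>^3) / (2 * h)"
    have i\<eta>: "0 \<le> real i * \<eta> \<and> real i * \<eta> \<le> 1" if "i \<le> N" for i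
      using that \<eta> N by (auto simp: \<eta>_def)
    have pM: "p i \<in> M" if "i \<le> N" for i
      unfolding p_def
    proof (intro psi_in half_ball zb that)
      show "norm ((real i * \<eta>) *\<^sub>R w) \<le> R/2"
        using w i\<eta>[OF that] mult_left_le_one_le[of "norm w" "real i * \<eta>"] by auto
    qed
    have step: "d (p i) (p (Suc i)) \<le> h + l i w / (2 * h) + 2 * K^3 * \<eta>\<^sup>2 * (norm w)\<^sup>2 / h + E"
      if "i < N" for i
    proof -
      have eq: "z i + (z (Suc i) - z i) = z (Suc i)" by simp
      have eq2: "real i * \<eta> + \<eta> = real (Suc i) * \<eta>" by (simp add: algebra_simps)
      have "d (\<psi> (z i + (real i * \<eta>) *\<^sub>R w)) (\<psi> (z i + (z (Suc i) - z i) + (real i * \<eta> + \<eta>) *\<^sub>R w))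
        \<le> h + ((real i * \<eta>) * DG (z i) w (z (Suc i) - z i) + 2 * \<eta> * G (z i) (z (Suc i) - z i) w) / (2 * h)
          + 2 * K^3 * \<eta>\<^sup>2 * (norm w)\<^sup>2 / h + (K^4 * h^3 + K * (K + R)^3 * \<eta>^3) / (2 * h)"
        using zb dz that i\<eta>[of i] i\<eta>[of "Suc i"] h w
        by (intro perturbed_step) (auto simp: eq2)
      then show ?thesis unfolding eq eq2 p_def l_def E_def .
    qed
    have "d (p 0) (p N) \<le> (\<Sum>i<N. d (p i) (p (Suc i)))"
      by (rule polygon_inequality) (rule pM)
    also have "\<dots> \<le> (\<Sum>i<N. h + l i w / (2 * h) + 2 * K^3 * \<eta>\<^sup>2 * (norm w)\<^sup>2 / h + E)"
      by (intro sum_mono step) auto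
    also have "\<dots> = real N * h + A \<bullet> w + real N * (2 * K^3 * \<eta>\<^sup>2 * (norm w)\<^sup>2 / h) + real N * E"
      by (simp add: sum.distrib A sum_divide_distrib)
    \<comment> \<open>The number of edges cancels: N \<eta>^2 / h = 1 / \<epsilon>.\<close>
    also have "real N * (2 * K^3 * \<eta>\<^sup>2 * (norm w)\<^sup>2 / h) = 2 * K^3 / \<epsilon> * (norm w)\<^sup>2"
      unfolding h_def \<eta>_def using N \<epsilon> by (simp add: power2_eq_square)
    also have "real N * E = (K^4 * \<epsilon>^3 + K * (K + R)^3) / (2 * \<epsilon>) / real N"
      unfolding E_def h_def \<eta>_def using N \<epsilon>
      by (simp add: field_simps power_numeral_reduce)
    finally have "d (p 0) (p N) \<le> \<epsilon> + A \<bullet> w + 2 * K^3 / \<epsilon> * (norm w)\<^sup>2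
      + (K^4 * \<epsilon>^3 + K * (K + R)^3) / (2 * \<epsilon>) / real N" using h by simp
    moreover have "p 0 = \<psi> (x 0)" "p N = \<psi> (x \<epsilon> + w)" using \<eta> h by (simp_all add: p_def z_def)
    ultimately show "d (\<psi> (x 0)) (\<psi> (x \<epsilon> + w)) \<le> \<epsilon> + A \<bullet> w + 2 * K^3 / \<epsilon> * (norm w)\<^sup>2
      + (K^4 * \<epsilon>^3 + K * (K + R)^3) / (2 * \<epsilon>) / real N" by simp
  qed
qed

text \<open>The number of edges tends to infinity. The limit of a convergent subsequence of the
  vectors A is as required, since the error, of order 1 / N, disappears. The distance from the
  initial point is thus semiconcave at the end point, with a constant of order 1 /
  \<epsilon>.\<close>

lemma semiconcave:
  fixes x :: "real \<Rightarrow> 'e"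
  assumes \<epsilon>: "0 < \<epsilon>" "\<epsilon> \<le> 1"
    and x: "\<And>t. t \<in> {0..\<epsilon>} \<Longrightarrow> x t \<in> ball x0 (R/2)"
    and iso: "\<And>s t. s \<in> {0..\<epsilon>} \<Longrightarrow> t \<in> {0..\<epsilon>} \<Longrightarrow> d (\<psi> (x s)) (\<psi> (x t)) = \<bar>s - t\<bar>"
  shows "\<exists>A. \<forall>w. norm w \<le> R/2 \<longrightarrow>
    d (\<psi> (x 0)) (\<psi> (x \<epsilon> + w)) \<le> \<epsilon> + A \<bullet> w + 2 * K^3 / \<epsilon> * (norm w)\<^sup>2"
proof -
  define E where "E = (K^4 * \<epsilon>^3 + K * (K + R)^3) / (2 * \<epsilon>)"
  have "\<exists>A. norm A \<le> 2 * K^3 \<and> (\<forall>w. norm w \<le> R/2 \<longrightarrow> d (\<psi> (x 0)) (\<psi> (x \<epsilon> + w)) \<le>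
      \<epsilon> + A \<bullet> w + 2 * K^3 / \<epsilon> * (norm w)\<^sup>2 + E / real (Suc n))" for n
    unfolding E_def by (rule perturbed_curve[OF assms zero_less_Suc[of n]])
  then obtain A :: "nat \<Rightarrow> 'e" where A: "\<And>n. norm (A n) \<le> 2 * K^3"
    "\<And>n w. norm w \<le> R/2 \<Longrightarrow> d (\<psi> (x 0)) (\<psi> (x \<epsilon> + w)) \<le>
      \<epsilon> + A n \<bullet> w + 2 * K^3 / \<epsilon> * (norm w)\<^sup>2 + E / real (Suc n)"
    by metis
  have "compact (cball (0::'e) (2 * K^3))" by simp
  moreover have "\<forall>n. A n \<in> cball 0 (2 * K^3)" using A(1) by simp
  ultimately obtain B r where B: "strict_mono (r :: nat \<Rightarrow> nat)" "(A \<circ> r) \<longlonglongrightarrow> B"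
    unfolding compact_def by blast
  show ?thesis
  proof (intro exI[of _ B] allI impI)
    fix w :: 'e assume w: "norm w \<le> R/2"
    have "(\<lambda>n. E / real (Suc n)) \<longlonglongrightarrow> 0"
      using LIMSEQ_Suc[OF lim_const_over_n[of E]] by simp
    from LIMSEQ_subseq_LIMSEQ[OF this B(1)]
    have "(\<lambda>n. E / real (Suc (r n))) \<longlonglongrightarrow> 0" by (simp add: o_def)
    moreover have "(\<lambda>n. A (r n) \<bullet> w) \<longlonglongrightarrow> B \<bullet> w"
      using B(2) by (intro tendsto_intros) (simp add: o_def)
    ultimately have "(\<lambda>n. \<epsilon> + A (r n) \<bullet> w + 2 * K^3 / \<epsilon> * (norm w)\<^sup>2 + E / real (Suc (r n)))
      \<longlonglongrightarrow> \<epsilon> + B \<bullet> w + 2 * K^3 / \<epsilon> * (norm w)\<^sup>2 + 0"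
      by (intro tendsto_add tendsto_const)
    then have "d (\<psi> (x 0)) (\<psi> (x \<epsilon> + w)) \<le> \<epsilon> + B \<bullet> w + 2 * K^3 / \<epsilon> * (norm w)\<^sup>2 + 0"
      by (rule LIMSEQ_le_const) (use A(2)[OF w] in blast)
    then show "d (\<psi> (x 0)) (\<psi> (x \<epsilon> + w)) \<le> \<epsilon> + B \<bullet> w + 2 * K^3 / \<epsilon> * (norm w)\<^sup>2" by simp
  qed
qed


text \<open>Differentiability with a quadratic remainder: A is the Euclidean gradient in the chart.
  The constant C is explicit because the Lipschitz bound for the gradient uses the same one at two
  points.\<close>

definition expansion :: "('e \<Rightarrow> real) \<Rightarrow> real \<Rightarrow> 'e \<Rightarrow> 'e \<Rightarrow> bool" where
  "expansion f C x A \<longleftrightarrow> (\<forall>w. norm w \<le> R/2 \<longrightarrow> \<bar>f (x + w) - f x - A \<bullet> w\<bar> \<le> C * (norm w)\<^sup>2)"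

text \<open>Both the distance from the initial point and the negative distance from the end point of a
  geodesic have a quadratic bound at its interior points, from above and from below respectively.\<close>

lemma expansion_along_geodesic:
  fixes x :: "real \<Rightarrow> 'e"
  assumes \<delta>: "0 < \<delta>" "\<delta> \<le> 1"
    and x: "\<And>t. t \<in> {-\<delta>..\<delta>} \<Longrightarrow> x t \<in> ball x0 (R/2)"
    and iso: "\<And>s t. s \<in> {-\<delta>..\<delta>} \<Longrightarrow> t \<in> {-\<delta>..\<delta>} \<Longrightarrow> d (\<psi> (x s)) (\<psi> (x t)) = \<bar>s - t\<bar>"
    and t: "t \<in> {0..\<delta>/2}"
  shows "\<exists>A. expansion (\<lambda>y. d (\<psi> (x (-\<delta>))) (\<psi> y)) (4 * K^3 / \<delta>) (x t) A"
proof -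
  define C where "C = 4 * K^3 / \<delta>"
  define f where "f y = d (\<psi> (x (-\<delta>))) (\<psi> y)" for y
  have C: "C > 0" using \<delta> K by (simp add: C_def)
  have M: "\<psi> (x s) \<in> M" if "s \<in> {-\<delta>..\<delta>}" for s using psi_in half_ball_subset x that by blast
  have Mw: "\<psi> (x t + w) \<in> M" if "norm w \<le> R/2" for w
    using psi_in half_ball[OF x that, of t] t \<delta> by auto
  have ft: "f (x t) = t + \<delta>" using iso[of "-\<delta>" t] t \<delta> by (simp add: f_def)
  \<comment> \<open>From the point \<delta>/2 before t up to t. This length does not vary with t,
    and so neither does the constant 2K^3 / (\<delta>/2) = 4K^3 / \<delta>.\<close>
  have "\<exists>A. \<forall>w. norm w \<le> R/2 \<longrightarrow> d (\<psi> (x (t - \<delta>/2 + 0))) (\<psi> (x (t - \<delta>/2 + \<delta>/2) + w)) \<le>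
    \<delta>/2 + A \<bullet> w + 2 * K^3 / (\<delta>/2) * (norm w)\<^sup>2"
  proof (rule semiconcave[where x = "\<lambda>s. x (t - \<delta>/2 + s)"])
    fix s s' assume s: "s \<in> {0..\<delta>/2}" "s' \<in> {0..\<delta>/2}"
    then have "t - \<delta>/2 + s \<in> {-\<delta>..\<delta>}" "t - \<delta>/2 + s' \<in> {-\<delta>..\<delta>}" using t \<delta> by auto
    then show "d (\<psi> (x (t - \<delta>/2 + s))) (\<psi> (x (t - \<delta>/2 + s'))) = \<bar>s - s'\<bar>"
      using iso by simp
  next
    fix s assume "s \<in> {0..\<delta>/2}"
    then show "x (t - \<delta>/2 + s) \<in> ball x0 (R/2)" using t \<delta> by (intro x) auto
  qed (use \<delta> in auto)
  then obtain A where A: "\<And>w. norm w \<le> R/2 \<Longrightarrow>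
    d (\<psi> (x (t - \<delta>/2))) (\<psi> (x t + w)) \<le> \<delta>/2 + A \<bullet> w + C * (norm w)\<^sup>2"
    by (auto simp: C_def)
  \<comment> \<open>The same bound along the reversed geodesic, from the point \<delta>/2 after t;
    the triangle inequality turns it into a lower bound for f.\<close>
  have "\<exists>B. \<forall>w. norm w \<le> R/2 \<longrightarrow> d (\<psi> (x (t + \<delta>/2 - 0))) (\<psi> (x (t + \<delta>/2 - \<delta>/2) + w)) \<le>
    \<delta>/2 + B \<bullet> w + 2 * K^3 / (\<delta>/2) * (norm w)\<^sup>2"
  proof (rule semiconcave[where x = "\<lambda>s. x (t + \<delta>/2 - s)"])
    fix s s' assume s: "s \<in> {0..\<delta>/2}" "s' \<in> {0..\<delta>/2}"
    then have "t + \<delta>/2 - s \<in> {-\<delta>..\<delta>}" "t + \<delta>/2 - s' \<in> {-\<delta>..\<delta>}" using t \<delta> by auto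
    then show "d (\<psi> (x (t + \<delta>/2 - s))) (\<psi> (x (t + \<delta>/2 - s'))) = \<bar>s - s'\<bar>"
      using iso by simp
  next
    fix s assume "s \<in> {0..\<delta>/2}"
    then show "x (t + \<delta>/2 - s) \<in> ball x0 (R/2)" using t \<delta> by (intro x) auto
  qed (use \<delta> in auto)
  then obtain B where B: "\<And>w. norm w \<le> R/2 \<Longrightarrow>
    d (\<psi> (x (t + \<delta>/2))) (\<psi> (x t + w)) \<le> \<delta>/2 + B \<bullet> w + C * (norm w)\<^sup>2"
    by (auto simp: C_def)
  have upper: "f (x t + w) \<le> f (x t) + A \<bullet> w + C * (norm w)\<^sup>2" if w: "norm w \<le> R/2" for w
  proof -
    have "f (x t + w) \<le> d (\<psi> (x (-\<delta>))) (\<psi> (x (t - \<delta>/2))) + d (\<psi> (x (t - \<delta>/2))) (\<psi> (x t + w))"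
      unfolding f_def using t \<delta> by (intro d_triangle M Mw w) auto
    moreover have "d (\<psi> (x (-\<delta>))) (\<psi> (x (t - \<delta>/2))) = t + \<delta>/2"
      using iso[of "-\<delta>" "t - \<delta>/2"] t \<delta> by auto
    ultimately show ?thesis using A[OF w] ft by linarith
  qed
  have lower: "f (x t + w) \<ge> f (x t) - B \<bullet> w - C * (norm w)\<^sup>2" if w: "norm w \<le> R/2" for w
  proof -
    have s1: "d (\<psi> (x (t + \<delta>/2))) (\<psi> (x t + w)) = d (\<psi> (x t + w)) (\<psi> (x (t + \<delta>/2)))"
      using t \<delta> by (intro d_sym M Mw w) auto
    have "d (\<psi> (x (-\<delta>))) (\<psi> (x (t + \<delta>/2))) \<le> f (x t + w) + d (\<psi> (x t + w)) (\<psi> (x (t + \<delta>/2)))"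
      unfolding f_def using t \<delta> by (intro d_triangle M Mw w) auto
    moreover have "d (\<psi> (x (-\<delta>))) (\<psi> (x (t + \<delta>/2))) = t + \<delta>/2 + \<delta>"
      using iso[of "-\<delta>" "t + \<delta>/2"] t \<delta> by auto
    ultimately show ?thesis using B[OF w] ft s1 by linarith
  qed
  have AB: "A + B = 0"
  proof (rule ccontr)
    assume ne: "A + B \<noteq> 0"
    \<comment> \<open>With the first bound on s the quadratic terms cannot compensate the linear
      one; the second bound keeps w within R/2.\<close>
    define s where "s = min (1 / (4 * C)) (R / (2 * norm (A + B)))"
    define w where "w = (-s) *\<^sub>R (A + B)"
    have s: "s > 0" "s \<le> 1 / (4 * C)" "s \<le> R / (2 * norm (A + B))"
      using C R ne by (auto simp: s_def)
    have nw: "norm w = s * norm (A + B)" using s(1) by (simp add: w_def)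
    have w: "norm w \<le> R/2" using s(3) ne unfolding nw by (simp add: field_simps)
    have "- ((A + B) \<bullet> w) \<le> 2 * C * (norm w)\<^sup>2"
      using upper[OF w] lower[OF w] by (simp add: inner_add_left)
    moreover have "- ((A + B) \<bullet> w) = s * (norm (A + B))\<^sup>2"
      unfolding w_def by (simp only: inner_scaleR_right power2_norm_eq_inner)
    ultimately have "s * (norm (A + B))\<^sup>2 \<le> (2 * C * s) * (s * (norm (A + B))\<^sup>2)"
      unfolding nw by (simp add: power2_eq_square mult_ac)
    moreover have "2 * C * s \<le> 1/2" using s(2) C by (simp add: field_simps)
    then have "(2 * C * s) * (s * (norm (A + B))\<^sup>2) \<le> (1/2) * (s * (norm (A + B))\<^sup>2)"
      using s(1) by (intro mult_right_mono) auto
    moreover have "s * (norm (A + B))\<^sup>2 > 0" using s(1) ne by simp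
    ultimately show False by linarith
  qed
  then have "B = - A" by (simp add: eq_neg_iff_add_eq_0 add.commute)
  then have "expansion f C (x t) A"
    unfolding expansion_def using upper lower by (force simp: abs_le_iff)
  then show ?thesis unfolding f_def C_def by blast
qed

text \<open>The value at y + w is computed from the expansions at x and at y, with w of length
  \<sigma> along A - B. The errors 4C\<sigma>^2, C\<sigma>^2 and C\<sigma>^2 add up to the constant
  6.\<close>

lemma expansion_lipschitz:
  assumes e: "expansion f C x A" "expansion f C y B" and xy: "norm (y - x) \<le> R/4" and C: "C \<ge> 0"
  shows "norm (A - B) \<le> 6 * C * norm (y - x)"
proof -
  \<comment> \<open>A free \<sigma> in place of |y - x| also covers y = x: there \<sigma> tends to
    0, and the gradient is seen to be unique.\<close>
  have bound: "norm (A - B) \<le> 6 * C * \<sigma>" if \<sigma>: "norm (y - x) \<le> \<sigma>" "0 < \<sigma>" "\<sigma> \<le> R/4" for \<sigma>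
  proof (cases "A = B")
    case False
    define w where "w = (\<sigma> / norm (A - B)) *\<^sub>R (A - B)"
    have nw: "norm w = \<sigma>" using False \<sigma>(2) by (simp add: w_def)
    have nyw: "norm (y - x + w) \<le> 2 * \<sigma>" using norm_triangle_ineq[of "y - x" w] nw \<sigma>(1) by simp
    have "\<bar>f (x + (y - x + w)) - f x - A \<bullet> (y - x + w)\<bar> \<le> C * (norm (y - x + w))\<^sup>2"
      by (rule e(1)[unfolded expansion_def, rule_format]) (use nyw \<sigma> in linarith)
    also have "\<dots> \<le> C * (2 * \<sigma>)\<^sup>2" using C nyw by (intro mult_left_mono power_mono) auto
    finally have 1: "\<bar>f (y + w) - f x - A \<bullet> (y - x + w)\<bar> \<le> C * (2 * \<sigma>)\<^sup>2" by (simp add: algebra_simps)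
    have "\<bar>f (x + (y - x)) - f x - A \<bullet> (y - x)\<bar> \<le> C * (norm (y - x))\<^sup>2"
      by (rule e(1)[unfolded expansion_def, rule_format]) (use \<sigma> in linarith)
    also have "\<dots> \<le> C * \<sigma>\<^sup>2" using C \<sigma> by (intro mult_left_mono power_mono) auto
    finally have 2: "\<bar>f y - f x - A \<bullet> (y - x)\<bar> \<le> C * \<sigma>\<^sup>2" by simp
    have 3: "\<bar>f (y + w) - f y - B \<bullet> w\<bar> \<le> C * \<sigma>\<^sup>2"
      unfolding nw[symmetric]
      by (rule e(2)[unfolded expansion_def, rule_format]) (use nw \<sigma> in linarith)
    have "A \<bullet> (y - x + w) = A \<bullet> (y - x) + A \<bullet> w" by (simp add: inner_add_right)
    then have "A \<bullet> w - B \<bullet> w \<le> C * (2 * \<sigma>)\<^sup>2 + 2 * (C * \<sigma>\<^sup>2)" using 1 2 3 by linarith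
    moreover have "A \<bullet> w - B \<bullet> w = \<sigma> * norm (A - B)"
    proof -
      have "A \<bullet> w - B \<bullet> w = (A - B) \<bullet> w" by (simp only: inner_diff_left)
      also have "\<dots> = (\<sigma> / norm (A - B)) * (norm (A - B))\<^sup>2"
        unfolding w_def by (simp only: inner_scaleR_right power2_norm_eq_inner)
      finally have "A \<bullet> w - B \<bullet> w = (\<sigma> / norm (A - B)) * (norm (A - B))\<^sup>2" .
      then show ?thesis using False by (simp add: power2_eq_square)
    qed
    ultimately have "\<sigma> * norm (A - B) \<le> \<sigma> * (6 * C * \<sigma>)" by (simp add: power2_eq_square algebra_simps)
    then show ?thesis using \<sigma>(2) by simp
  qed (use C \<sigma> in simp)
  show ?thesis
  proof (cases "y = x")
    case True
    have "norm (A - B) \<le> 0 + e" if e: "e > 0" for e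
    proof -
      define \<sigma> where "\<sigma> = min (R/4) (e / (6 * C + 1))"
      have "0 < \<sigma>" using R C e by (auto simp: \<sigma>_def)
      moreover have "\<sigma> \<le> R/4" unfolding \<sigma>_def by (rule min.cobounded1)
      ultimately have \<sigma>: "0 < \<sigma>" "\<sigma> \<le> R/4" by auto
      have "\<sigma> \<le> e / (6 * C + 1)" by (simp add: \<sigma>_def)
      then have "(6 * C + 1) * \<sigma> \<le> e" using C by (simp add: pos_le_divide_eq mult.commute)
      then have "6 * C * \<sigma> \<le> e" using \<sigma> by (simp add: algebra_simps)
      then show ?thesis using bound[of \<sigma>] \<sigma> True by simp
    qed
    then have "norm (A - B) \<le> 0" by (rule field_le_epsilon)
    then show ?thesis using True by simp
  qed (use bound[of "norm (y - x)"] xy in auto)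
qed

section \<open>The Riemannian gradient and the velocity of a geodesic\<close>

lemma gradient_exists:
  assumes "x \<in> ball x0 R"
  shows "\<exists>V. \<forall>v. G x V v = A \<bullet> v"
proof -
  \<comment> \<open>Lowering of an index: T V is the Euclidean representative of the covector
    \<open>G x V\<close>. Positivity makes T injective, hence surjective by dimension.\<close>
  define T where "T V = (\<Sum>b\<in>Basis. G x V b *\<^sub>R b)" for V
  note b = bil[OF assms]
  have "linear T"
    unfolding T_def by (rule linearI)
      (simp_all add: bilinear_ladd[OF b] bilinear_lmul[OF b] scaleR_left_distrib sum.distrib scaleR_right.sum)
  have T: "T V \<bullet> v = G x V v" for V v
  proof -
    have lin: "linear (G x V)" using b by (simp add: bilinear_def)
    have "G x V v = G x V (\<Sum>b\<in>Basis. (v \<bullet> b) *\<^sub>R b)" by (simp only: euclidean_representation)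
    also have "\<dots> = (\<Sum>b\<in>Basis. (v \<bullet> b) *\<^sub>R G x V b)"
      by (simp only: linear_sum[OF lin] linear_cmul[OF lin])
    also have "\<dots> = T V \<bullet> v"
      unfolding T_def by (simp add: inner_sum_left inner_commute[of v] mult_ac)
    finally show ?thesis by simp
  qed
  have "inj T"
  proof -
    have "V = 0" if "T V = 0" for V
    proof -
      have "G x V V = 0" using T[of V V] that by simp
      then show ?thesis using G_lower[OF assms, of V] by simp
    qed
    then show ?thesis using linear_injective_0[OF \<open>linear T\<close>] by blast
  qed
  then have "surj T" using linear_injective_imp_surjective \<open>linear T\<close> by blast
  then obtain V where "T V = A" by (metis surjD)
  then show ?thesis using T by metis
qed

text \<open>The square of V - W in the form \<open>G x\<close> splits into the difference of the
  covectors and the change of the form from x to y, applied to W. The latter is controlled because a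
  vector of Riemannian length at most 1 has Euclidean norm at most K.\<close>

lemma gradient_lipschitz:
  assumes xy: "x \<in> ball x0 R" "y \<in> ball x0 R"
    and V: "\<And>v. G x V v = A \<bullet> v" and W: "\<And>v. G y W v = B \<bullet> v" "G y W W \<le> 1"
  shows "norm (V - W) \<le> K * (norm (A - B) + K\<^sup>2 * norm (y - x))"
proof (cases "V = W")
  case False
  have nW: "norm W \<le> K"
  proof -
    have "(norm W)\<^sup>2 \<le> K * 1" using G_lower[OF xy(2), of W] W(2) K
      by (meson mult_left_mono order_trans zero_le_one)
    also have "\<dots> \<le> K\<^sup>2" using K by (simp add: power2_eq_square)
    finally show ?thesis by (rule power2_le_imp_le) (use K in simp)
  qed
  define u where "u = V - W"
  have "G x u u = G x V u - G x W u"
    unfolding u_def by (simp add: bilinear_lsub[OF bil[OF xy(1)]])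
  also have "\<dots> = (A - B) \<bullet> u + (G y W u - G x W u)" using V W(1) by (simp add: inner_diff_left)
  also have "\<dots> \<le> norm (A - B) * norm u + K * norm (y - x) * norm W * norm u"
    using norm_cauchy_schwarz[of "A - B" u] G_lip[OF xy, of W u] by linarith
  also have "\<dots> \<le> norm (A - B) * norm u + K * norm (y - x) * K * norm u"
    using nW K by (intro add_mono mult_right_mono mult_left_mono) auto
  finally have "K * G x u u \<le> K * (norm (A - B) * norm u + K * norm (y - x) * K * norm u)"
    using K by simp
  then have "(norm u)\<^sup>2 \<le> K * (norm (A - B) * norm u + K * norm (y - x) * K * norm u)"
    using G_lower[OF xy(1), of u] by linarith
  then have "norm u * norm u \<le> norm u * (K * (norm (A - B) + K\<^sup>2 * norm (y - x)))"
    by (simp add: power2_eq_square algebra_simps)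
  then show ?thesis using False unfolding u_def by simp
qed (use K in simp)

text \<open>Let q be the squared length of V. Along s V the function grows by s q up to order s^2,
  while the distance is at most s sqrt(q + O(s)). As s tends to 0, q \<le> sqrt q.\<close>

lemma gradient_norm_le:
  assumes x: "x \<in> ball x0 (R/2)" and f: "expansion f C x A"
    and lip: "\<And>w. norm w \<le> R/2 \<Longrightarrow> f (x + w) - f x \<le> d (\<psi> x) (\<psi> (x + w))"
    and V: "\<And>v. G x V v = A \<bullet> v"
  shows "G x V V \<le> 1"
proof -
  define q where "q = G x V V"
  have xR: "x \<in> ball x0 R" using half_ball_subset x by blast
  have q0: "q \<ge> 0" using G_lower[OF xR, of V] K unfolding q_def
    by (smt (verit) mult_pos_neg zero_le_power2)
  have ev: "\<forall>\<^sub>F s in at_right 0. q - C * s * (norm V)\<^sup>2 \<le> sqrt (q + K * s * norm V ^ 3)"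
  proof -
    have "\<forall>\<^sub>F s in at_right 0. s \<in> {0<..<R / (2 * (norm V + 1))}"
      using R by (intro eventually_at_right_real divide_pos_pos) (auto simp: add_nonneg_pos)
    then show ?thesis
    proof eventually_elim
      case (elim s)
      have pV: "0 < 2 * (norm V + 1)" by (simp add: add_nonneg_pos)
      have "s * (2 * (norm V + 1)) < R"
        using elim pos_less_divide_eq[OF pV] by simp
      moreover have "s * (2 * (norm V + 1)) = 2 * (s * (norm V + 1))" by (simp only: mult.left_commute)
      ultimately have "s * (norm V + 1) \<le> R/2" by linarith
      with elim have s: "0 < s" "s * (norm V + 1) \<le> R/2" by simp_all
      have w: "norm (s *\<^sub>R V) \<le> R/2" using s by (simp add: algebra_simps)
      have AV: "A \<bullet> V = q" using V[of V] by (simp add: q_def)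
      have "A \<bullet> (s *\<^sub>R V) - C * (norm (s *\<^sub>R V))\<^sup>2 \<le> d (\<psi> x) (\<psi> (x + s *\<^sub>R V))"
        using f[unfolded expansion_def, rule_format, OF w] lip[OF w] by linarith
      also have "\<dots> \<le> sqrt (G x (s *\<^sub>R V) (s *\<^sub>R V) + K * norm (s *\<^sub>R V) ^ 3)"
        using d_upper[OF xR half_ball[OF x w]] by (intro real_le_rsqrt) simp
      also have "G x (s *\<^sub>R V) (s *\<^sub>R V) = s\<^sup>2 * q"
        unfolding q_def by (simp add: bilinear_lmul[OF bil[OF xR]] bilinear_rmul[OF bil[OF xR]] power2_eq_square)
      also have "s\<^sup>2 * q + K * norm (s *\<^sub>R V) ^ 3 = s\<^sup>2 * (q + K * s * norm V ^ 3)"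
        using s by (simp add: power_mult_distrib algebra_simps power2_eq_square power3_eq_cube)
      also have "sqrt \<dots> = s * sqrt (q + K * s * norm V ^ 3)"
        using s by (simp add: real_sqrt_mult)
      finally have "s * (q - C * s * (norm V)\<^sup>2) \<le> s * sqrt (q + K * s * norm V ^ 3)"
        using s AV by (simp add: algebra_simps power_mult_distrib power2_eq_square)
      then show ?case using s by simp
    qed
  qed
  have "((\<lambda>s. q - C * s * (norm V)\<^sup>2) \<longlongrightarrow> q - C * 0 * (norm V)\<^sup>2) (at_right 0)"
    by (intro tendsto_intros)
  moreover have "((\<lambda>s. sqrt (q + K * s * norm V ^ 3)) \<longlongrightarrow> sqrt (q + K * 0 * norm V ^ 3)) (at_right 0)"
    by (intro tendsto_intros)
  ultimately have "q - C * 0 * (norm V)\<^sup>2 \<le> sqrt (q + K * 0 * norm V ^ 3)"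
    by (intro tendsto_le[OF _ _ _ ev]) auto
  then have "q \<le> sqrt q" by simp
  then have "q\<^sup>2 \<le> q" using q0 by (metis power_mono real_sqrt_pow2)
  then have "q * q \<le> q * 1" by (simp add: power2_eq_square)
  then show ?thesis using q0 unfolding q_def[symmetric]
    by (cases "q = 0") (auto simp: mult_le_cancel_left)
qed

text \<open>The equality case of the Cauchy-Schwarz inequality: for the chord u over a time h, both
  u and h V have squared length at most h^2 up to cubic errors, and their product is h^2 up to a
  cubic error. So u - h V has squared length O(|h|^3), and its norm is o(h).\<close>

lemma geodesic_velocity:
  fixes x :: "real \<Rightarrow> 'e"
  assumes f: "expansion f C (x t) A" and C: "C \<ge> 0"
    and \<eta>: "\<eta> > 0"
    and x: "\<And>h. \<bar>h\<bar> < \<eta> \<Longrightarrow> x (t + h) \<in> ball x0 (R/4)"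
    and fx: "\<And>h. \<bar>h\<bar> < \<eta> \<Longrightarrow> f (x (t + h)) = f (x t) + h"
    and iso: "\<And>h. \<bar>h\<bar> < \<eta> \<Longrightarrow> d (\<psi> (x t)) (\<psi> (x (t + h))) = \<bar>h\<bar>"
    and V: "\<And>v. G (x t) V v = A \<bullet> v" "G (x t) V V \<le> 1"
  shows "(x has_vector_derivative V) (at t)"
proof -
  define Q where "Q = K * (K^4 + 2 * C * K\<^sup>2)"
  have Q: "Q > 0" using K C unfolding Q_def by (intro mult_pos_pos add_pos_nonneg) auto
  have xt: "x t \<in> ball x0 (R/4)" using x[of 0] \<eta> by simp
  have xtR: "x t \<in> ball x0 R" using xt R by auto
  note b = bil[OF xtR]
  have main: "(norm (x (t + h) - x t - h *\<^sub>R V))\<^sup>2 \<le> Q * \<bar>h\<bar> ^ 3" if h: "\<bar>h\<bar> < \<eta>" for h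
  proof -
    define u where "u = x (t + h) - x t"
    have xhR: "x (t + h) \<in> ball x0 R" using x[OF h] R by auto
    have nu: "norm u \<le> K * \<bar>h\<bar>" using d_comp[OF xtR xhR] iso[OF h] by (simp add: u_def)
    have nuR: "norm u \<le> R/2"
    proof -
      have "norm u = dist (x (t + h)) (x t)" by (simp add: u_def dist_norm)
      also have "\<dots> \<le> dist x0 (x (t + h)) + dist x0 (x t)" by (rule dist_triangle3)
      finally show ?thesis using x[OF h] xt by simp
    qed
    have 1: "G (x t) u u \<le> \<bar>h\<bar>\<^sup>2 + K * (K * \<bar>h\<bar>) ^ 3"
    proof -
      have "G (x t) u u \<le> \<bar>h\<bar>\<^sup>2 + K * norm u ^ 3"
        using d_lower[OF xtR xhR] iso[OF h] by (simp add: u_def)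
      also have "\<dots> \<le> \<bar>h\<bar>\<^sup>2 + K * (K * \<bar>h\<bar>) ^ 3"
        using nu K by (intro add_left_mono mult_left_mono power_mono) auto
      finally show ?thesis .
    qed
    have 2: "\<bar>h - A \<bullet> u\<bar> \<le> C * (K * \<bar>h\<bar>)\<^sup>2"
    proof -
      have "\<bar>f (x t + u) - f (x t) - A \<bullet> u\<bar> \<le> C * (norm u)\<^sup>2"
        using f nuR by (simp add: expansion_def)
      also have "\<dots> \<le> C * (K * \<bar>h\<bar>)\<^sup>2"
        using nu C by (intro mult_left_mono power_mono) auto
      finally show ?thesis using fx[OF h] by (simp add: u_def)
    qed
    have "G (x t) (u - h *\<^sub>R V) (u - h *\<^sub>R V) = G (x t) u u - 2 * (h * (A \<bullet> u)) + h\<^sup>2 * G (x t) V V"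
      using V(1)[of u] G_sym[OF xtR, of u V]
      by (simp add: bilinear_lsub[OF b] bilinear_rsub[OF b] bilinear_lmul[OF b] bilinear_rmul[OF b] power2_eq_square algebra_simps)
    also have "\<dots> \<le> (\<bar>h\<bar>\<^sup>2 + K * (K * \<bar>h\<bar>) ^ 3) - 2 * (h\<^sup>2 - \<bar>h\<bar> * (C * (K * \<bar>h\<bar>)\<^sup>2)) + h\<^sup>2 * 1"
    proof (intro add_mono diff_mono mult_left_mono)
      show "G (x t) u u \<le> \<bar>h\<bar>\<^sup>2 + K * (K * \<bar>h\<bar>) ^ 3" by (rule 1)
      have "h * (h - A \<bullet> u) \<le> \<bar>h\<bar> * \<bar>h - A \<bullet> u\<bar>" by (metis abs_ge_self abs_mult)
      also have "\<dots> \<le> \<bar>h\<bar> * (C * (K * \<bar>h\<bar>)\<^sup>2)" using 2 by (intro mult_left_mono) auto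
      finally show "h\<^sup>2 - \<bar>h\<bar> * (C * (K * \<bar>h\<bar>)\<^sup>2) \<le> h * (A \<bullet> u)"
        by (simp add: algebra_simps power2_eq_square)
    qed (use V in auto)
    also have "\<dots> = (K^4 + 2 * C * K\<^sup>2) * \<bar>h\<bar> ^ 3"
      by (simp add: power_numeral_reduce algebra_simps)
    finally have "K * G (x t) (u - h *\<^sub>R V) (u - h *\<^sub>R V) \<le> K * ((K^4 + 2 * C * K\<^sup>2) * \<bar>h\<bar> ^ 3)"
      using K by simp
    then show ?thesis
      using G_lower[OF xtR, of "u - h *\<^sub>R V"] unfolding Q_def u_def[symmetric] by (simp add: mult_ac)
  qed
  show ?thesis
    unfolding has_vector_derivative_def has_derivative_at_alt
  proof (intro conjI allI impI)
    show "bounded_linear (\<lambda>h. h *\<^sub>R V)" by (rule bounded_linear_scaleR_left)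
    fix e :: real assume e: "e > 0"
    \<comment> \<open>The square of the error is at most Q |h| times h^2, which leads to the choice
      e^2 / Q.\<close>
    show "\<exists>d>0. \<forall>s. norm (s - t) < d \<longrightarrow> norm (x s - x t - (s - t) *\<^sub>R V) \<le> e * norm (s - t)"
    proof (intro exI[of _ "min \<eta> (e\<^sup>2 / Q)"] conjI allI impI)
      show "0 < min \<eta> (e\<^sup>2 / Q)" using \<eta> e Q by simp
      fix s assume s: "norm (s - t) < min \<eta> (e\<^sup>2 / Q)"
      define h where "h = s - t"
      have h: "\<bar>h\<bar> < \<eta>" "Q * \<bar>h\<bar> \<le> e\<^sup>2" using s Q by (auto simp: h_def pos_less_divide_eq mult.commute)
      have "(norm (x s - x t - h *\<^sub>R V))\<^sup>2 \<le> Q * \<bar>h\<bar> ^ 3" using main[OF h(1)] by (simp add: h_def)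
      also have "\<dots> = (Q * \<bar>h\<bar>) * \<bar>h\<bar>\<^sup>2" by (simp add: power_numeral_reduce)
      also have "\<dots> \<le> e\<^sup>2 * \<bar>h\<bar>\<^sup>2" using h(2) by (intro mult_right_mono) auto
      finally have "(norm (x s - x t - h *\<^sub>R V))\<^sup>2 \<le> (e * \<bar>h\<bar>)\<^sup>2" by (simp add: power_mult_distrib)
      then have "norm (x s - x t - h *\<^sub>R V) \<le> e * \<bar>h\<bar>" by (rule power2_le_imp_le) (use e in auto)
      then show "norm (x s - x t - (s - t) *\<^sub>R V) \<le> e * norm (s - t)" by (simp add: h_def)
    qed
  qed
qed


text \<open>Two geodesics with a common initial piece are integral curves of the gradient of the distance
  from its initial point. As this gradient is Lipschitz on the union of the two curves, Gronwall's
  argument applies to \<open>D\<close>, the square of their distance in the chart.\<close>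

lemma local_nonbranching_coordinates:
  fixes x y :: "real \<Rightarrow> 'e"
  assumes \<delta>: "0 < \<delta>" "\<delta> \<le> 1"
    and x: "\<And>t. t \<in> {-\<delta>..\<delta>} \<Longrightarrow> x t \<in> ball x0 (R/8)"
    and y: "\<And>t. t \<in> {-\<delta>..\<delta>} \<Longrightarrow> y t \<in> ball x0 (R/8)"
    and iso_x: "\<And>s t. s \<in> {-\<delta>..\<delta>} \<Longrightarrow> t \<in> {-\<delta>..\<delta>} \<Longrightarrow> d (\<psi> (x s)) (\<psi> (x t)) = \<bar>s - t\<bar>"
    and iso_y: "\<And>s t. s \<in> {-\<delta>..\<delta>} \<Longrightarrow> t \<in> {-\<delta>..\<delta>} \<Longrightarrow> d (\<psi> (y s)) (\<psi> (y t)) = \<bar>s - t\<bar>"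
    and eq: "x 0 = y 0" "x (-\<delta>) = y (-\<delta>)"
    and t: "t \<in> {0..\<delta>/2}"
  shows "x t = y t"
proof -
  define C where "C = 4 * K^3 / \<delta>"
  \<comment> \<open>The Lipschitz constant of the gradient: up to the factor K, 6C comes from the
    expansions and K^2 from the variation of the metric.\<close>
  define Q where "Q = K * (6 * C + K\<^sup>2)"
  define f where "f z = d (\<psi> (x (-\<delta>))) (\<psi> z)" for z
  have C: "C \<ge> 0" using K \<delta> by (simp add: C_def)
  \<comment> \<open>Stated for a curve z with the common initial point, so that it applies to x and
    to y with the same function f.\<close>
  have velocity: "\<exists>A V. expansion f C (z t) A \<and> (\<forall>v. G (z t) V v = A \<bullet> v) \<and> G (z t) V V \<le> 1 \<and>
      (z has_vector_derivative V) (at t)"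
    if z: "\<And>t. t \<in> {-\<delta>..\<delta>} \<Longrightarrow> z t \<in> ball x0 (R/8)"
      and iso: "\<And>s t. s \<in> {-\<delta>..\<delta>} \<Longrightarrow> t \<in> {-\<delta>..\<delta>} \<Longrightarrow> d (\<psi> (z s)) (\<psi> (z t)) = \<bar>s - t\<bar>"
      and z0: "z (-\<delta>) = x (-\<delta>)" and t: "0 < t" "t < \<delta>/2" for z :: "real \<Rightarrow> 'e" and t
  proof -
    have z2: "z t \<in> ball x0 (R/2)" if "t \<in> {-\<delta>..\<delta>}" for t using z[OF that] R by auto
    have zt: "z t \<in> ball x0 (R/2)" "z t \<in> ball x0 R" using z2[of t] half_ball_subset t \<delta> by auto
    have "\<exists>A. expansion (\<lambda>w. d (\<psi> (z (-\<delta>))) (\<psi> w)) (4 * K^3 / \<delta>) (z t) A"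
      using expansion_along_geodesic[OF \<delta> z2 iso] t by auto
    then obtain A where A: "expansion f C (z t) A"
      unfolding z0 f_def[symmetric] C_def[symmetric] by blast
    obtain V where V: "\<forall>v. G (z t) V v = A \<bullet> v" using gradient_exists[OF zt(2)] by blast
    have "G (z t) V V \<le> 1"
    proof (rule gradient_norm_le[OF zt(1) A])
      fix w :: 'e assume w: "norm w \<le> R/2"
      have "f (z t + w) \<le> f (z t) + d (\<psi> (z t)) (\<psi> (z t + w))"
        unfolding f_def using z2[of "-\<delta>"] half_ball[OF zt(1) w] zt \<delta> z0 half_ball_subset
        by (intro d_triangle psi_in) auto
      then show "f (z t + w) - f (z t) \<le> d (\<psi> (z t)) (\<psi> (z t + w))" by simp
    qed (use V in blast)
    moreover from this have "(z has_vector_derivative V) (at t)"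
    proof (rule geodesic_velocity[where x = z and t = t, OF A C, rotated -1])
      show "0 < min t (\<delta>/2)" using t \<delta> by simp
      fix h assume h: "\<bar>h\<bar> < min t (\<delta>/2)"
      then have th: "t + h \<in> {-\<delta>..\<delta>}" "t \<in> {-\<delta>..\<delta>}" "-\<delta> \<in> {-\<delta>..\<delta>}" using t by auto
      show "z (t + h) \<in> ball x0 (R/4)" using z[OF th(1)] R by auto
      show "f (z (t + h)) = f (z t) + h"
        unfolding f_def z0[symmetric] using iso[OF th(3,1)] iso[OF th(3,2)] th by simp
      show "d (\<psi> (z t)) (\<psi> (z (t + h))) = \<bar>h\<bar>" using iso[OF th(2,1)] by simp
    qed (use V in blast)
    ultimately show ?thesis using A V by blast
  qed
  define D where "D s = (norm (x s - y s))\<^sup>2" for s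
  have cont: "continuous_on {0..\<delta>/2} z"
    if z: "\<And>t. t \<in> {-\<delta>..\<delta>} \<Longrightarrow> z t \<in> ball x0 (R/8)"
      and iso: "\<And>s t. s \<in> {-\<delta>..\<delta>} \<Longrightarrow> t \<in> {-\<delta>..\<delta>} \<Longrightarrow> d (\<psi> (z s)) (\<psi> (z t)) = \<bar>s - t\<bar>"
    for z :: "real \<Rightarrow> 'e"
  proof -
    have "K-lipschitz_on {0..\<delta>/2} z"
    proof (rule lipschitz_onI)
      fix s u assume "s \<in> {0..\<delta>/2}" "u \<in> {0..\<delta>/2}"
      then have su: "s \<in> {-\<delta>..\<delta>}" "u \<in> {-\<delta>..\<delta>}" using \<delta> by auto
      have "z s \<in> ball x0 R" "z u \<in> ball x0 R" using z[OF su(1)] z[OF su(2)] R by auto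
      from d_comp[OF this(2,1)] show "dist (z s) (z u) \<le> K * dist s u"
        using iso[OF su(2,1)] by (simp add: dist_norm abs_minus_commute)
    qed (use K in simp)
    then show ?thesis by (rule lipschitz_on_continuous_on)
  qed
  \<comment> \<open>The exponent has 2Q because D is a squared distance. Derivatives are used on the
    open interval, and continuity at its ends.\<close>
  have "D t * exp (- 2 * Q * t) \<le> D 0 * exp (- 2 * Q * 0)"
  proof (cases "t = 0")
    case False
    then have t0: "0 < t" using t by simp
    show ?thesis
    proof (rule DERIV_nonpos_imp_decreasing_open[where f = "\<lambda>s. D s * exp (- 2 * Q * s)", OF less_imp_le[OF t0]])
      have sub: "{0..t} \<subseteq> {0..\<delta>/2}" using t by auto
      show "continuous_on {0..t} (\<lambda>s. D s * exp (- 2 * Q * s))"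
        unfolding D_def
        by (intro continuous_intros continuous_on_subset[OF cont[OF x iso_x] sub]
            continuous_on_subset[OF cont[OF y iso_y] sub])
    next
      fix s assume s: "0 < s" "s < t"
      then have s2: "s < \<delta>/2" using t by simp
      obtain A V where A: "expansion f C (x s) A" "\<And>v. G (x s) V v = A \<bullet> v"
        "(x has_vector_derivative V) (at s)"
        using velocity[OF x iso_x refl s(1) s2] by blast
      obtain B W where B: "expansion f C (y s) B" "\<And>v. G (y s) W v = B \<bullet> v" "G (y s) W W \<le> 1"
        "(y has_vector_derivative W) (at s)"
        using velocity[OF y iso_y eq(2)[symmetric] s(1) s2] by blast
      have sd: "s \<in> {-\<delta>..\<delta>}" using s s2 \<delta> by auto
      have b: "x s \<in> ball x0 R" "y s \<in> ball x0 R" using x[OF sd] y[OF sd] R by auto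
      \<comment> \<open>The radius R/8 serves here: \<open>expansion_lipschitz\<close> requires |y -
        x| \<le> R/4.\<close>
      have "norm (y s - x s) = dist (y s) (x s)" by (simp add: dist_norm)
      also have "\<dots> \<le> dist x0 (y s) + dist x0 (x s)" by (rule dist_triangle3)
      finally have n: "norm (y s - x s) \<le> R/4" using x[OF sd] y[OF sd] by simp
      have "norm (V - W) \<le> K * (norm (A - B) + K\<^sup>2 * norm (y s - x s))"
        by (rule gradient_lipschitz[OF b A(2) B(2,3)])
      also have "\<dots> \<le> K * (6 * C * norm (y s - x s) + K\<^sup>2 * norm (y s - x s))"
        using expansion_lipschitz[OF A(1) B(1) n C] K by (intro mult_left_mono add_right_mono) auto
      also have "\<dots> = Q * norm (x s - y s)"
        by (simp add: Q_def algebra_simps norm_minus_commute)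
      finally have VW: "norm (V - W) \<le> Q * norm (x s - y s)" .
      have "((\<lambda>s. x s - y s) has_vector_derivative V - W) (at s)"
        using A(3) B(4) by (rule has_vector_derivative_diff)
      then have "((\<lambda>s. x s - y s) has_derivative (\<lambda>h. h *\<^sub>R (V - W))) (at s)"
        by (simp add: has_vector_derivative_def)
      from has_derivative_inner[OF this this]
      have "(D has_derivative (\<lambda>h. (x s - y s) \<bullet> (h *\<^sub>R (V - W)) + (h *\<^sub>R (V - W)) \<bullet> (x s - y s))) (at s)"
        unfolding D_def power2_norm_eq_inner .
      moreover have "(\<lambda>h. (x s - y s) \<bullet> (h *\<^sub>R (V - W)) + (h *\<^sub>R (V - W)) \<bullet> (x s - y s)) =
          (*) (2 * ((x s - y s) \<bullet> (V - W)))"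
        by (rule ext) (simp add: inner_commute[of "V - W"])
      ultimately have "(D has_real_derivative 2 * ((x s - y s) \<bullet> (V - W))) (at s)"
        unfolding has_field_derivative_def by simp
      then have der: "((\<lambda>s. D s * exp (- 2 * Q * s)) has_real_derivative
          2 * ((x s - y s) \<bullet> (V - W)) * exp (- 2 * Q * s) + D s * (exp (- 2 * Q * s) * (- 2 * Q))) (at s)"
        by (auto intro!: derivative_eq_intros)
      have "(x s - y s) \<bullet> (V - W) \<le> norm (x s - y s) * norm (V - W)" by (rule norm_cauchy_schwarz)
      also have "\<dots> \<le> norm (x s - y s) * (Q * norm (x s - y s))"
        using VW by (intro mult_left_mono) auto
      finally have "(x s - y s) \<bullet> (V - W) \<le> Q * D s" by (simp add: D_def power2_eq_square mult_ac)
      then have "(2 * ((x s - y s) \<bullet> (V - W)) - 2 * Q * D s) * exp (- 2 * Q * s) \<le> 0"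
        by (intro mult_nonpos_nonneg) auto
      also have "(2 * ((x s - y s) \<bullet> (V - W)) - 2 * Q * D s) * exp (- 2 * Q * s) =
          2 * ((x s - y s) \<bullet> (V - W)) * exp (- 2 * Q * s) + D s * (exp (- 2 * Q * s) * (- 2 * Q))"
        by (simp only: left_diff_distrib) simp
      finally show "\<exists>z. ((\<lambda>s. D s * exp (- 2 * Q * s)) has_real_derivative z) (at s) \<and> z \<le> 0"
        using der by blast
    qed
  qed simp
  moreover have "D 0 = 0" using eq by (simp add: D_def)
  ultimately have "D t * exp (- 2 * Q * t) \<le> 0" by simp
  then have "D t \<le> 0" by (simp add: mult_le_0_iff not_le)
  then show ?thesis by (simp add: D_def)
qed

lemma local_nonbranching:
  assumes \<delta>: "0 < \<delta>"
    and \<gamma>: "geodesic M d {-\<delta>..\<delta>} \<gamma>" and \<gamma>': "geodesic M d {-\<delta>..\<delta>} \<gamma>'"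
    and eq: "\<And>t. t \<in> {-\<delta>..0} \<Longrightarrow> \<gamma> t = \<gamma>' t" and \<gamma>0: "\<gamma> 0 = \<psi> x0"
  shows "\<exists>\<eta>>0. \<eta> \<le> \<delta> \<and> (\<forall>t\<in>{0..\<eta>}. \<gamma> t = \<gamma>' t)"
proof -
  \<comment> \<open>The bound r0/2 puts the geodesics into the chart, and R / (16K) into the ball of
    radius R/8, by \<open>d_comp\<close>.\<close>
  define \<epsilon> where "\<epsilon> = min (min \<delta> 1) (min (r0/2) (R / (16 * K)))"
  have \<epsilon>: "0 < \<epsilon>" "\<epsilon> \<le> 1" "\<epsilon> \<le> \<delta>" "\<epsilon> < r0" "K * \<epsilon> < R/8"
  proof -
    show "0 < \<epsilon>" using \<delta> r0 R K by (simp add: \<epsilon>_def)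
    show "\<epsilon> \<le> 1" "\<epsilon> \<le> \<delta>" by (simp_all add: \<epsilon>_def)
    have "\<epsilon> \<le> r0/2" "\<epsilon> \<le> R / (16 * K)" unfolding \<epsilon>_def by (meson min.cobounded1 min.cobounded2 order_trans)+
    then show "\<epsilon> < r0" "K * \<epsilon> < R/8" using r0 R K by (simp_all add: field_simps)
  qed
  have coords: "\<exists>x. x \<in> ball x0 (R/8) \<and> \<psi> x = \<gamma> t"
    if \<gamma>: "geodesic M d {-\<delta>..\<delta>} \<gamma>" "\<gamma> 0 = \<psi> x0" and t: "t \<in> {-\<epsilon>..\<epsilon>}" for \<gamma> t
  proof -
    have t': "t \<in> {-\<delta>..\<delta>}" "0 \<in> {-\<delta>..\<delta>}" using t \<epsilon> \<delta> by auto
    have dt: "d (\<psi> x0) (\<gamma> t) = \<bar>t\<bar>" using geodesic_dist[OF \<gamma>(1) t'(2,1)] \<gamma>(2) by simp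
    moreover have "\<gamma> t \<in> M" using geodesic_in[OF \<gamma>(1) t'(1)] .
    moreover have "\<bar>t\<bar> < r0" using t \<epsilon> by auto
    ultimately obtain x where x: "x \<in> ball x0 R" "\<psi> x = \<gamma> t" using near by (metis imageE)
    have "norm (x - x0) \<le> K * \<bar>t\<bar>" using d_comp[of x0 x] x R dt by simp
    also have "\<dots> \<le> K * \<epsilon>" using t K by (intro mult_left_mono) auto
    finally have "norm (x - x0) < R/8" using \<epsilon> by simp
    then show ?thesis using x by (auto simp: dist_norm norm_minus_commute)
  qed
  have \<gamma>'0: "\<gamma>' 0 = \<psi> x0" using eq[of 0] \<gamma>0 \<delta> by simp
  \<comment> \<open>Both curves are chosen by the same expression, so equality of points passes to
    the chosen coordinates.\<close>
  define x where "x t = (SOME x. x \<in> ball x0 (R/8) \<and> \<psi> x = \<gamma> t)" for t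
  define y where "y t = (SOME x. x \<in> ball x0 (R/8) \<and> \<psi> x = \<gamma>' t)" for t
  have x: "x t \<in> ball x0 (R/8)" "\<psi> (x t) = \<gamma> t" if "t \<in> {-\<epsilon>..\<epsilon>}" for t
    using someI_ex[OF coords[OF \<gamma> \<gamma>0 that]] unfolding x_def by blast+
  have y: "y t \<in> ball x0 (R/8)" "\<psi> (y t) = \<gamma>' t" if "t \<in> {-\<epsilon>..\<epsilon>}" for t
    using someI_ex[OF coords[OF \<gamma>' \<gamma>'0 that]] unfolding y_def by blast+
  have xy: "x t = y t" if "t \<in> {-\<epsilon>..0}" for t
    using eq[of t] that \<epsilon> by (simp add: x_def y_def)
  have iso: "d (\<gamma> s) (\<gamma> t) = \<bar>s - t\<bar>" "d (\<gamma>' s) (\<gamma>' t) = \<bar>s - t\<bar>"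
    if "s \<in> {-\<epsilon>..\<epsilon>}" "t \<in> {-\<epsilon>..\<epsilon>}" for s t
    using geodesic_dist[OF \<gamma>, of s t] geodesic_dist[OF \<gamma>', of s t] that \<epsilon> by auto
  have "x t = y t" if "t \<in> {0..\<epsilon>/2}" for t
    by (rule local_nonbranching_coordinates[OF \<epsilon>(1,2) _ _ _ _ _ _ that]) (use x y iso xy \<epsilon> in auto)
  then have "\<gamma> t = \<gamma>' t" if "t \<in> {0..\<epsilon>/2}" for t
    using x(2)[of t] y(2)[of t] that by auto
  then show ?thesis using \<epsilon> by (intro exI[of _ "\<epsilon>/2"]) auto
qed

end

text \<open>Continuation: T is the supremum of the parameters up to which the curves agree. They
  agree at T by continuity, and if T were less than b, the local statement at
  \<open>\<gamma> T\<close> would carry the agreement beyond T.\<close>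

lemma (in metric_on) nonbranching_of_local:
  assumes loc: "\<And>p. p \<in> M \<Longrightarrow> \<exists>(\<psi> :: 'e::euclidean_space \<Rightarrow> 'a) x0 R r0 K G DG.
      local_metric M d \<psi> x0 R r0 K G DG \<and> \<psi> x0 = p"
    and ac: "a < c" "c \<le> b"
    and \<gamma>: "geodesic M d {a..b} \<gamma>" and \<gamma>': "geodesic M d {a..b} \<gamma>'"
    and eq: "\<And>t. t \<in> {a..c} \<Longrightarrow> \<gamma> t = \<gamma>' t"
  shows "\<gamma> b = \<gamma>' b"
proof -
  define S where "S = {s \<in> {c..b}. \<forall>t\<in>{a..s}. \<gamma> t = \<gamma>' t}"
  define T where "T = Sup S"
  have cS: "c \<in> S" using ac eq by (simp add: S_def)
  have bdd: "bdd_above S" by (rule bdd_aboveI[of _ b]) (simp add: S_def)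
  have cT: "c \<le> T" unfolding T_def by (rule cSup_upper[OF cS bdd])
  have Tb: "T \<le> b" unfolding T_def using cS by (intro cSup_least) (auto simp: S_def)
  have lt: "\<gamma> t = \<gamma>' t" if "a \<le> t" "t < T" for t
  proof -
    have "\<exists>s\<in>S. t < s" using that cS bdd unfolding T_def by (subst (asm) less_cSup_iff) auto
    then obtain s where "s \<in> S" "t < s" by blast
    then show ?thesis using that by (simp add: S_def)
  qed
  have M: "\<gamma> t \<in> M" "\<gamma>' t \<in> M" if "t \<in> {a..b}" for t
    using geodesic_in[OF \<gamma> that] geodesic_in[OF \<gamma>' that] by auto
  have eqT: "\<gamma> T = \<gamma>' T"
  proof (rule ccontr)
    assume ne: "\<gamma> T \<noteq> \<gamma>' T"
    \<comment> \<open>The curves coincide at T - e, so their distance at T is at most 2e, which is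
      at most half of that distance.\<close>
    define e where "e = min (T - a) (d (\<gamma> T) (\<gamma>' T) / 4)"
    have TI: "T \<in> {a..b}" using ac cT Tb by simp
    have dpos: "d (\<gamma> T) (\<gamma>' T) > 0" using d_pos[OF M(1)[OF TI] M(2)[OF TI] ne] .
    have "e > 0" using ac cT dpos by (simp add: e_def)
    moreover have "e \<le> T - a" "e \<le> d (\<gamma> T) (\<gamma>' T) / 4"
      unfolding e_def by (rule min.cobounded1 min.cobounded2)+
    ultimately have e: "e > 0" "e \<le> T - a" "e \<le> d (\<gamma> T) (\<gamma>' T) / 4" .
    have TeI: "T - e \<in> {a..b}" using e Tb by simp
    have same: "\<gamma> (T - e) = \<gamma>' (T - e)" using lt e by simp
    have "d (\<gamma> T) (\<gamma>' T) \<le> d (\<gamma> T) (\<gamma> (T - e)) + d (\<gamma>' (T - e)) (\<gamma>' T)"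
      using d_triangle[OF M(1)[OF TI] M(1)[OF TeI] M(2)[OF TI]] same by simp
    also have "\<dots> = e + e"
      using geodesic_dist[OF \<gamma> TI TeI] geodesic_dist[OF \<gamma>' TeI TI] e by simp
    finally show False using e dpos by linarith
  qed
  have TS: "T \<in> S" using cT Tb lt eqT ac unfolding S_def by (auto simp: le_less)
  have "T = b"
  proof (rule ccontr)
    assume "T \<noteq> b"
    then have Tb: "T < b" using Tb by simp
    define \<delta> where "\<delta> = min (T - a) (b - T)"
    have \<delta>: "0 < \<delta>" "\<delta> \<le> T - a" "\<delta> \<le> b - T" using Tb ac cT by (auto simp: \<delta>_def)
    have "\<gamma> T \<in> M" using M[of T] cT ac Tb by auto
    then obtain \<psi> :: "'e \<Rightarrow> 'a" and x0 R r0 K G DG where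
      L: "local_metric M d \<psi> x0 R r0 K G DG" "\<psi> x0 = \<gamma> T" using loc by blast
    have g: "geodesic M d {-\<delta>..\<delta>} (\<lambda>t. \<gamma> (T + t))" if "geodesic M d {a..b} \<gamma>" for \<gamma>
    proof (rule geodesicI)
      show "\<gamma> (T + t) \<in> M" if "t \<in> {-\<delta>..\<delta>}" for t
        using geodesic_in[OF \<open>geodesic M d {a..b} \<gamma>\<close>, of "T + t"] that \<delta> by auto
      show "d (\<gamma> (T + s)) (\<gamma> (T + t)) = t - s" if "s \<in> {-\<delta>..\<delta>}" "t \<in> {-\<delta>..\<delta>}" "s < t" for s t
        using geodesic_dist[OF \<open>geodesic M d {a..b} \<gamma>\<close>, of "T + s" "T + t"] that \<delta> by auto
    qed simp
    have "\<exists>\<eta>>0. \<eta> \<le> \<delta> \<and> (\<forall>t\<in>{0..\<eta>}. \<gamma> (T + t) = \<gamma>' (T + t))"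
    proof (rule local_metric.local_nonbranching[OF L(1) \<delta>(1) g[OF \<gamma>] g[OF \<gamma>']])
      fix t assume t: "t \<in> {-\<delta>..0}"
      then show "\<gamma> (T + t) = \<gamma>' (T + t)" using lt[of "T + t"] eqT \<delta> by (cases "t = 0") auto
    qed (use L in simp)
    then obtain \<eta> where \<eta>: "\<eta> > 0" "\<eta> \<le> \<delta>" "\<forall>t\<in>{0..\<eta>}. \<gamma> (T + t) = \<gamma>' (T + t)" by blast
    have "T + \<eta> \<in> S"
      unfolding S_def
    proof (intro CollectI conjI ballI)
      fix t assume t: "t \<in> {a..T + \<eta>}"
      show "\<gamma> t = \<gamma>' t"
      proof (cases "t < T")
        case False
        then show ?thesis using \<eta>(3)[rule_format, of "t - T"] t by simp
      qed (use lt t in auto)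
    qed (use \<eta> \<delta> cT in auto)
    then have "T + \<eta> \<le> T" unfolding T_def by (rule cSup_upper[OF _ bdd])
    then show False using \<eta> by simp
  qed
  then show ?thesis using eqT by simp
qed

section \<open>Smooth bilinear forms\<close>

lemma Ck_on_imp_continuous_on: "Ck_on k f S \<Longrightarrow> continuous_on S f"
proof (cases k)
  case (Suc m)
  assume "Ck_on k f S"
  then have "\<forall>x\<in>S. f differentiable at x" using Suc by simp
  then show ?thesis
    by (intro continuous_at_imp_continuous_on ballI differentiable_imp_continuous_within) auto
qed simp

lemma smooth_on_imp_has_derivative:
  assumes "smooth_on f S" "x \<in> S"
  shows "(f has_derivative frechet_derivative f (at x)) (at x)"
proof -
  have "Ck_on 1 f S" using assms(1) by (simp add: smooth_on_def)
  then show ?thesis using assms(2) by (simp add: frechet_derivative_works[symmetric])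
qed

lemma smooth_on_imp_continuous_derivative:
  assumes "smooth_on f S"
  shows "continuous_on S (\<lambda>x. frechet_derivative f (at x) v)"
proof -
  have "Ck_on (Suc 1) f S" using assms by (simp add: smooth_on_def)
  then have "Ck_on 1 (\<lambda>x. frechet_derivative f (at x) v) S" by simp
  then show ?thesis by (rule Ck_on_imp_continuous_on)
qed

lemma smooth_on_imp_smooth_derivative:
  assumes "smooth_on f S"
  shows "smooth_on (\<lambda>x. frechet_derivative f (at x) v) S"
  unfolding smooth_on_def
proof
  fix k
  have "Ck_on (Suc k) f S" using assms unfolding smooth_on_def by blast
  then show "Ck_on k (\<lambda>x. frechet_derivative f (at x) v) S" by simp
qed

lemma smooth_on_imp_continuous_on: "smooth_on f S \<Longrightarrow> continuous_on S f"
  unfolding smooth_on_def using Ck_on_imp_continuous_on by blast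

section \<open>Uniform bounds on compact convex sets\<close>

lemma linear_bound_Basis:
  fixes l :: "'e::euclidean_space \<Rightarrow> real"
  assumes "linear l" "\<And>b. b \<in> Basis \<Longrightarrow> \<bar>l b\<bar> \<le> B b"
  shows "\<bar>l v\<bar> \<le> (\<Sum>b\<in>Basis. B b) * norm v"
proof -
  have "l v = l (\<Sum>b\<in>Basis. (v \<bullet> b) *\<^sub>R b)" by (simp only: euclidean_representation)
  also have "\<dots> = (\<Sum>b\<in>Basis. (v \<bullet> b) * l b)"
    by (simp add: linear_sum[OF assms(1)] linear_cmul[OF assms(1)])
  finally have "\<bar>l v\<bar> \<le> (\<Sum>b\<in>Basis. \<bar>(v \<bullet> b) * l b\<bar>)" by simp
  also have "\<dots> \<le> (\<Sum>b\<in>Basis. B b * norm v)"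
  proof (rule sum_mono)
    fix b :: 'e assume b: "b \<in> Basis"
    have "\<bar>(v \<bullet> b) * l b\<bar> \<le> norm v * B b"
      unfolding abs_mult using b assms(2) Basis_le_norm by (intro mult_mono) auto
    then show "\<bar>(v \<bullet> b) * l b\<bar> \<le> B b * norm v" by (simp add: mult.commute)
  qed
  finally show ?thesis by (simp add: sum_distrib_right)
qed

lemma compact_bound:
  fixes h :: "'e::euclidean_space \<Rightarrow> real"
  assumes "compact C" "continuous_on C h"
  shows "\<exists>B\<ge>0. \<forall>x\<in>C. \<bar>h x\<bar> \<le> B"
proof -
  have "bounded (h ` C)" using assms compact_continuous_image compact_imp_bounded by blast
  then obtain B where "B > 0" "\<forall>y\<in>h ` C. norm y \<le> B" using bounded_pos by blast
  then show ?thesis by (intro exI[of _ B]) auto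
qed

text \<open>\<open>smooth_on\<close> yields continuity of the derivative for each fixed direction.
  Bounds in the finitely many basis directions and linearity give one that is uniform in the
  direction.\<close>

lemma smooth_derivative_bound:
  fixes h :: "'e::euclidean_space \<Rightarrow> real"
  assumes h: "smooth_on h S" and C: "compact C" "C \<subseteq> S"
  shows "\<exists>L\<ge>0. \<forall>x\<in>C. \<forall>v. \<bar>frechet_derivative h (at x) v\<bar> \<le> L * norm v"
proof -
  have "\<forall>b. \<exists>B\<ge>0. \<forall>x\<in>C. \<bar>frechet_derivative h (at x) b\<bar> \<le> B"
    using compact_bound[OF C(1) continuous_on_subset[OF smooth_on_imp_continuous_derivative[OF h] C(2)]]
    by blast
  then obtain B where B: "\<And>b. B b \<ge> 0" "\<And>b x. x \<in> C \<Longrightarrow> \<bar>frechet_derivative h (at x) b\<bar> \<le> B b"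
    by metis
  show ?thesis
  proof (intro exI[of _ "\<Sum>b\<in>Basis. B b"] conjI ballI allI)
    show "0 \<le> (\<Sum>b\<in>Basis. B b)" using B(1) by (intro sum_nonneg) auto
    fix x v assume x: "x \<in> C"
    have "linear (frechet_derivative h (at x))"
      using smooth_on_imp_has_derivative[OF h] x C(2) has_derivative_linear by blast
    then show "\<bar>frechet_derivative h (at x) v\<bar> \<le> (\<Sum>b\<in>Basis. B b) * norm v"
      by (rule linear_bound_Basis) (use B(2)[OF x] in blast)
  qed
qed

lemma smooth_lipschitz:
  fixes h :: "'e::euclidean_space \<Rightarrow> real"
  assumes h: "smooth_on h S" and C: "compact C" "C \<subseteq> S" "convex C"
  shows "\<exists>L\<ge>0. \<forall>x\<in>C. \<forall>y\<in>C. \<bar>h y - h x\<bar> \<le> L * norm (y - x)"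
proof -
  obtain L where L: "L \<ge> 0" "\<And>x v. x \<in> C \<Longrightarrow> \<bar>frechet_derivative h (at x) v\<bar> \<le> L * norm v"
    using smooth_derivative_bound[OF h C(1,2)] by blast
  have "norm (h y - h x) \<le> L * norm (y - x)" if "x \<in> C" "y \<in> C" for x y
  proof (rule differentiable_bound[OF C(3) _ _ that(2,1)])
    fix z assume z: "z \<in> C"
    then show "(h has_derivative frechet_derivative h (at z)) (at z within C)"
      using smooth_on_imp_has_derivative[OF h] C(2) by (auto intro: has_derivative_at_withinI)
    show "onorm (frechet_derivative h (at z)) \<le> L"
      by (rule onorm_le) (use L(2)[OF z] in auto)
  qed
  then show ?thesis using L(1) by auto
qed

text \<open>The mean value inequality for h minus its linear part at x: the derivatives at z and x
  differ by at most a constant times |z - x|, and |z - x| \<le> |y - x| on the segment.\<close>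

lemma smooth_taylor:
  fixes h :: "'e::euclidean_space \<Rightarrow> real"
  assumes h: "smooth_on h S" and C: "compact C" "C \<subseteq> S" "convex C"
  shows "\<exists>L\<ge>0. \<forall>x\<in>C. \<forall>y\<in>C. \<bar>h y - h x - frechet_derivative h (at x) (y - x)\<bar> \<le> L * (norm (y - x))\<^sup>2"
proof -
  let ?D = "\<lambda>x. frechet_derivative h (at x)"
  have "\<forall>b. \<exists>L\<ge>0. \<forall>x\<in>C. \<forall>y\<in>C. \<bar>?D y b - ?D x b\<bar> \<le> L * norm (y - x)"
    using smooth_lipschitz[OF smooth_on_imp_smooth_derivative[OF h] C] by blast
  then obtain L where L: "\<And>b. L b \<ge> 0"
    "\<And>b x y. x \<in> C \<Longrightarrow> y \<in> C \<Longrightarrow> \<bar>?D y b - ?D x b\<bar> \<le> L b * norm (y - x)"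
    by metis
  define L' where "L' = (\<Sum>b\<in>Basis. L b)"
  have L': "L' \<ge> 0" unfolding L'_def using L(1) by (intro sum_nonneg) auto
  have lin: "linear (?D x)" if "x \<in> C" for x
    using smooth_on_imp_has_derivative[OF h] that C(2) has_derivative_linear by blast
  have "\<bar>h y - h x - ?D x (y - x)\<bar> \<le> L' * (norm (y - x))\<^sup>2" if xy: "x \<in> C" "y \<in> C" for x y
  proof -
    have seg: "closed_segment x y \<subseteq> C" using C(3) xy by (simp add: closed_segment_subset)
    have "norm (h y - h x - ?D x (y - x)) \<le> norm (y - x) * (L' * norm (y - x))"
    proof (rule differentiable_bound_linearization[where S = "closed_segment x y"])
      fix t :: real assume "t \<in> {0..1}"
      then show "x + t *\<^sub>R (y - x) \<in> closed_segment x y"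
        by (auto simp: in_segment algebra_simps intro!: exI[of _ t])
    next
      fix z assume z: "z \<in> closed_segment x y"
      then show "(h has_derivative ?D z) (at z within closed_segment x y)"
        using smooth_on_imp_has_derivative[OF h] seg C(2) by (blast intro: has_derivative_at_withinI)
      have zC: "z \<in> C" using z seg by blast
      show "onorm (?D z - ?D x) \<le> L' * norm (y - x)"
      proof (rule onorm_le)
        fix v
        have "linear (\<lambda>v. ?D z v - ?D x v)" using lin[OF zC] lin[OF xy(1)] by (rule linear_compose_sub)
        then have "\<bar>?D z v - ?D x v\<bar> \<le> (\<Sum>b\<in>Basis. L b * norm (z - x)) * norm v"
          by (rule linear_bound_Basis) (use L(2)[OF xy(1) zC] in blast)
        also have "\<dots> = L' * norm (z - x) * norm v" by (simp add: L'_def sum_distrib_right)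
        also have "\<dots> \<le> L' * norm (y - x) * norm v"
          using z L' segment_bound(1)[of z x y] by (intro mult_right_mono mult_left_mono) auto
        finally show "norm ((?D z - ?D x) v) \<le> L' * norm (y - x) * norm v" by simp
      qed
    qed simp
    then show ?thesis by (simp add: power2_eq_square mult_ac)
  qed
  then show ?thesis using L' by blast
qed

lemma bilinear_expand:
  fixes B :: "'e::euclidean_space \<Rightarrow> 'e \<Rightarrow> real"
  assumes "bilinear B"
  shows "B v w = (\<Sum>i\<in>Basis. \<Sum>j\<in>Basis. (v \<bullet> i) * (w \<bullet> j) * B i j)"
proof -
  have 1: "linear (\<lambda>v. B v w)" for w using assms by (simp add: bilinear_def)
  have 2: "linear (B v)" for v using assms by (simp add: bilinear_def)
  have "B v w = B (\<Sum>i\<in>Basis. (v \<bullet> i) *\<^sub>R i) w" by (simp only: euclidean_representation)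
  also have "\<dots> = (\<Sum>i\<in>Basis. (v \<bullet> i) * B i w)"
    by (simp add: linear_sum[OF 1] linear_cmul[OF 1])
  also have "\<dots> = (\<Sum>i\<in>Basis. (v \<bullet> i) * (\<Sum>j\<in>Basis. (w \<bullet> j) * B i j))"
  proof (intro sum.cong refl arg_cong2[where f = "(*)"])
    fix i
    have "B i w = B i (\<Sum>j\<in>Basis. (w \<bullet> j) *\<^sub>R j)" by (simp only: euclidean_representation)
    then show "B i w = (\<Sum>j\<in>Basis. (w \<bullet> j) * B i j)"
      by (simp add: linear_sum[OF 2] linear_cmul[OF 2])
  qed
  finally show ?thesis by (simp add: sum_distrib_left mult.assoc)
qed

lemma bilinear_Cauchy_Schwarz:
  fixes B :: "'e::real_vector \<Rightarrow> 'e \<Rightarrow> real"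
  assumes b: "bilinear B" and sym: "\<And>v w. B v w = B w v" and pos: "\<And>v. v \<noteq> 0 \<Longrightarrow> B v v > 0"
  shows "(B v w)\<^sup>2 \<le> B v v * B w w"
proof (cases "w = 0")
  case False
  define t where "t = B v w / B w w"
  have w: "B w w > 0" using pos False by blast
  have "0 \<le> B (v - t *\<^sub>R w) (v - t *\<^sub>R w)"
    using pos[of "v - t *\<^sub>R w"] bilinear_lzero[OF b] by (cases "v - t *\<^sub>R w = 0") auto
  also have "\<dots> = B v v - 2 * t * B v w + t\<^sup>2 * B w w"
    using sym[of w v]
    by (simp add: bilinear_lsub[OF b] bilinear_rsub[OF b] bilinear_lmul[OF b] bilinear_rmul[OF b] power2_eq_square algebra_simps)
  also have "\<dots> = B v v - (B v w)\<^sup>2 / B w w"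
    using w by (simp add: t_def power2_eq_square field_simps)
  finally show ?thesis using w by (simp add: field_simps)
qed (use b in \<open>simp add: bilinear_rzero\<close>)

lemma double_sum_bound:
  fixes v w :: "'e::euclidean_space"
  assumes "\<And>i j. \<bar>h i j\<bar> \<le> L i j * c"
  shows "\<bar>\<Sum>i\<in>Basis. \<Sum>j\<in>Basis. (v \<bullet> i) * (w \<bullet> j) * h i j\<bar> \<le>
    (\<Sum>i\<in>Basis. \<Sum>j\<in>Basis. L i j) * c * norm v * norm w"
proof -
  have "\<bar>\<Sum>i\<in>Basis. \<Sum>j\<in>Basis. (v \<bullet> i) * (w \<bullet> j) * h i j\<bar> \<le>
    (\<Sum>i\<in>Basis. \<Sum>j\<in>Basis. \<bar>(v \<bullet> i) * (w \<bullet> j) * h i j\<bar>)"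
    by (rule order_trans[OF sum_abs]) (intro sum_mono sum_abs)
  also have "\<dots> \<le> (\<Sum>i\<in>Basis. \<Sum>j\<in>Basis. norm v * norm w * (L i j * c))"
    unfolding abs_mult using assms Basis_le_norm
    by (intro sum_mono mult_mono) auto
  also have "\<dots> = (\<Sum>i\<in>Basis. \<Sum>j\<in>Basis. L i j) * c * norm v * norm w"
    by (simp add: sum_distrib_left sum_distrib_right mult_ac)
  finally show ?thesis .
qed

text \<open>Continuity in the base point is given for fixed arguments; expansion in coordinates
  allows the arguments to move.\<close>

lemma bilinear_field_continuous:
  fixes B :: "'e::euclidean_space \<Rightarrow> 'e \<Rightarrow> 'e \<Rightarrow> real"
  assumes bil: "\<And>x. x \<in> S \<Longrightarrow> bilinear (B x)"
    and cont: "\<And>v w. continuous_on S (\<lambda>x. B x v w)"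
    and f: "continuous_on T f" "f ` T \<subseteq> S" and v: "continuous_on T v" and w: "continuous_on T w"
  shows "continuous_on T (\<lambda>t. B (f t) (v t) (w t))"
proof -
  have "continuous_on T (\<lambda>t. \<Sum>i\<in>Basis. \<Sum>j\<in>Basis. (v t \<bullet> i) * (w t \<bullet> j) * B (f t) i j)"
    by (intro continuous_intros v w continuous_on_compose2[OF cont f])
  moreover have "B (f t) (v t) (w t) = (\<Sum>i\<in>Basis. \<Sum>j\<in>Basis. (v t \<bullet> i) * (w t \<bullet> j) * B (f t) i j)"
    if "t \<in> T" for t
    using f(2) that by (intro bilinear_expand bil) auto
  ultimately show ?thesis by (simp cong: continuous_on_cong)
qed

text \<open>All bounds but the lower one reduce to the finitely many coefficients
  \<open>G x i j\<close>. The lower one is a minimum over the product of C with the unit sphere,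
  which is attained and hence positive.\<close>

lemma metric_field_bounds:
  fixes G :: "'e::euclidean_space \<Rightarrow> 'e \<Rightarrow> 'e \<Rightarrow> real"
  assumes bil: "\<And>x. x \<in> S \<Longrightarrow> bilinear (G x)"
    and pos: "\<And>x v. x \<in> S \<Longrightarrow> v \<noteq> 0 \<Longrightarrow> G x v v > 0"
    and smooth: "\<And>v w. smooth_on (\<lambda>x. G x v w) S"
    and C: "compact C" "C \<subseteq> S" "convex C"
  shows "\<exists>K\<ge>1. \<exists>DG.
    (\<forall>x\<in>C. \<forall>v. (norm v)\<^sup>2 \<le> K * G x v v) \<and>
    (\<forall>x\<in>C. \<forall>v w. \<bar>G x v w\<bar> \<le> K * norm v * norm w) \<and>
    (\<forall>x\<in>C. \<forall>y\<in>C. \<forall>v w. \<bar>G y v w - G x v w\<bar> \<le> K * norm (y - x) * norm v * norm w) \<and>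
    (\<forall>x\<in>C. \<forall>v. linear (\<lambda>w. DG x w v)) \<and>
    (\<forall>x\<in>C. \<forall>w v. \<bar>DG x w v\<bar> \<le> K * norm w * (norm v)\<^sup>2) \<and>
    (\<forall>x\<in>C. \<forall>y\<in>C. \<forall>v. \<bar>G y v v - G x v v - DG x (y - x) v\<bar> \<le> K * (norm (y - x))\<^sup>2 * (norm v)\<^sup>2)"
proof -
  define D where "D x w i j = frechet_derivative (\<lambda>x. G x i j) (at x) w" for x w i j
  define DG where "DG x w v = (\<Sum>i\<in>Basis. \<Sum>j\<in>Basis. (v \<bullet> i) * (v \<bullet> j) * D x w i j)" for x w v
  note ex = bilinear_expand[OF bil[OF subsetD[OF C(2)]]]
  have "\<forall>i j. \<exists>B\<ge>0. \<forall>x\<in>C. \<bar>G x i j\<bar> \<le> B"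
    using compact_bound[OF C(1) continuous_on_subset[OF smooth_on_imp_continuous_on[OF smooth] C(2)]] by blast
  then obtain B where B: "\<And>i j x. x \<in> C \<Longrightarrow> \<bar>G x i j\<bar> \<le> B i j" by metis
  have "\<forall>i j. \<exists>L\<ge>0. \<forall>x\<in>C. \<forall>y\<in>C. \<bar>G y i j - G x i j\<bar> \<le> L * norm (y - x)"
    using smooth_lipschitz[OF smooth C] by blast
  then obtain L where L: "\<And>i j x y. x \<in> C \<Longrightarrow> y \<in> C \<Longrightarrow> \<bar>G y i j - G x i j\<bar> \<le> L i j * norm (y - x)"
    by metis
  have "\<forall>i j. \<exists>E\<ge>0. \<forall>x\<in>C. \<forall>w. \<bar>D x w i j\<bar> \<le> E * norm w"
    unfolding D_def using smooth_derivative_bound[OF smooth C(1,2)] by blast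
  then obtain E where E: "\<And>i j x w. x \<in> C \<Longrightarrow> \<bar>D x w i j\<bar> \<le> E i j * norm w" by metis
  have "\<forall>i j. \<exists>T\<ge>0. \<forall>x\<in>C. \<forall>y\<in>C. \<bar>G y i j - G x i j - D x (y - x) i j\<bar> \<le> T * (norm (y - x))\<^sup>2"
    unfolding D_def using smooth_taylor[OF smooth C] by blast
  then obtain T where T: "\<And>i j x y. x \<in> C \<Longrightarrow> y \<in> C \<Longrightarrow>
    \<bar>G y i j - G x i j - D x (y - x) i j\<bar> \<le> T i j * (norm (y - x))\<^sup>2"
    by metis
  have "\<exists>m>0. \<forall>x\<in>C. \<forall>v. m * (norm v)\<^sup>2 \<le> G x v v"
  proof (cases "C = {}")
    case False
    let ?P = "C \<times> sphere (0::'e) 1"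
    have "continuous_on ?P (\<lambda>p. G (fst p) (snd p) (snd p))"
      by (rule bilinear_field_continuous[OF bil smooth_on_imp_continuous_on[OF smooth]])
        (use C in \<open>auto intro!: continuous_intros\<close>)
    moreover have "compact ?P" using C(1) by (intro compact_Times) auto
    moreover have "?P \<noteq> {}"
    proof -
      obtain b :: 'e where "b \<in> Basis" using nonempty_Basis by blast
      then have "b \<in> sphere 0 1" by simp
      then show ?thesis using False by blast
    qed
    ultimately obtain p where p: "p \<in> ?P"
      "\<And>q. q \<in> ?P \<Longrightarrow> G (fst p) (snd p) (snd p) \<le> G (fst q) (snd q) (snd q)"
      using continuous_attains_inf[of ?P "\<lambda>p. G (fst p) (snd p) (snd p)"] by blast
    define m where "m = G (fst p) (snd p) (snd p)"
    have "m > 0" unfolding m_def using p(1) C(2) by (intro pos) auto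
    moreover have "m * (norm v)\<^sup>2 \<le> G x v v" if x: "x \<in> C" for x v
    proof (cases "v = 0")
      case False
      have "(x, v /\<^sub>R norm v) \<in> ?P" using x False by simp
      from p(2)[OF this] have "m \<le> G x (v /\<^sub>R norm v) (v /\<^sub>R norm v)" by (simp add: m_def)
      also have "\<dots> = G x v v / (norm v)\<^sup>2"
        using bil[of x] x C(2)
        by (simp add: bilinear_lmul bilinear_rmul subset_iff power2_eq_square divide_inverse)
      finally show ?thesis using False by (simp add: field_simps)
    qed (use bil[of x] x C(2) in \<open>auto simp: bilinear_lzero\<close>)
    ultimately show ?thesis by blast
  qed (auto intro: exI[of _ 1])
  then obtain m where m: "m > 0" "\<And>x v. x \<in> C \<Longrightarrow> m * (norm v)\<^sup>2 \<le> G x v v" by blast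
  let ?S = "\<lambda>f :: 'e \<Rightarrow> 'e \<Rightarrow> real. \<Sum>i\<in>Basis. \<Sum>j\<in>Basis. f i j"
  define K where "K = 1 + 1 / m + \<bar>?S B\<bar> + \<bar>?S L\<bar> + \<bar>?S E\<bar> + \<bar>?S T\<bar>"
  have K: "K \<ge> 1" "1 / m \<le> K" "?S B \<le> K" "?S L \<le> K" "?S E \<le> K" "?S T \<le> K"
    using m(1) divide_pos_pos[of 1 m] unfolding K_def by linarith+
  show ?thesis
  proof (intro exI[of _ K] exI[of _ DG] conjI ballI allI)
    show "1 \<le> K" by (rule K)
    fix x assume x: "x \<in> C"
    note exx = ex[OF x]
    show "(norm v)\<^sup>2 \<le> K * G x v v" for v
    proof -
      have "(norm v)\<^sup>2 \<le> (1 / m) * G x v v" using m(1) m(2)[OF x, of v] by (simp add: field_simps)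
      also have "\<dots> \<le> K * G x v v"
        using K(2) m(1) m(2)[OF x, of v] order_trans[of 0 "m * (norm v)\<^sup>2" "G x v v"]
        by (intro mult_right_mono) auto
      finally show ?thesis .
    qed
    show "\<bar>G x v w\<bar> \<le> K * norm v * norm w" for v w
    proof -
      have "\<bar>G x v w\<bar> \<le> ?S B * 1 * norm v * norm w"
        unfolding exx[of v w] by (rule double_sum_bound) (use B[OF x] in simp)
      also have "\<dots> \<le> K * norm v * norm w"
        using K(3) by (simp add: mult_right_mono)
      finally show ?thesis .
    qed
    show "linear (\<lambda>w. DG x w v)" for v
    proof -
      have "linear (\<lambda>w. D x w i j)" for i j
        unfolding D_def using smooth_on_imp_has_derivative[OF smooth] x C(2) has_derivative_linear by blast
      then show ?thesis unfolding DG_def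
        by (intro linear_compose_sum ballI) (simp_all add: linear_compose_scale_right[of "\<lambda>w. D x w _ _", unfolded real_scaleR_def])
    qed
    show "\<bar>DG x w v\<bar> \<le> K * norm w * (norm v)\<^sup>2" for w v
    proof -
      have "\<bar>DG x w v\<bar> \<le> ?S E * norm w * norm v * norm v"
        unfolding DG_def by (rule double_sum_bound) (rule E[OF x])
      also have "\<dots> \<le> K * norm w * norm v * norm v"
        using K(5) by (intro mult_right_mono) auto
      finally show ?thesis by (simp add: power2_eq_square mult.assoc)
    qed
    fix y assume y: "y \<in> C"
    note exy = ex[OF y]
    show "\<bar>G y v w - G x v w\<bar> \<le> K * norm (y - x) * norm v * norm w" for v w
    proof -
      have "G y v w - G x v w = (\<Sum>i\<in>Basis. \<Sum>j\<in>Basis. (v \<bullet> i) * (w \<bullet> j) * (G y i j - G x i j))"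
        unfolding exx[of v w] exy[of v w] by (simp add: sum_subtractf right_diff_distrib)
      then have "\<bar>G y v w - G x v w\<bar> \<le> ?S L * norm (y - x) * norm v * norm w"
        by (simp only:) (rule double_sum_bound, rule L[OF x y])
      also have "\<dots> \<le> K * norm (y - x) * norm v * norm w"
        using K(4) by (intro mult_right_mono) auto
      finally show ?thesis .
    qed
    show "\<bar>G y v v - G x v v - DG x (y - x) v\<bar> \<le> K * (norm (y - x))\<^sup>2 * (norm v)\<^sup>2" for v
    proof -
      have "G y v v - G x v v - DG x (y - x) v =
        (\<Sum>i\<in>Basis. \<Sum>j\<in>Basis. (v \<bullet> i) * (v \<bullet> j) * (G y i j - G x i j - D x (y - x) i j))"
        unfolding exx[of v v] exy[of v v] DG_def by (simp add: sum_subtractf right_diff_distrib)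
      then have "\<bar>G y v v - G x v v - DG x (y - x) v\<bar> \<le> ?S T * (norm (y - x))\<^sup>2 * norm v * norm v"
        by (simp only:) (rule double_sum_bound, rule T[OF x y])
      also have "\<dots> \<le> K * (norm (y - x))\<^sup>2 * norm v * norm v"
        using K(6) by (intro mult_right_mono) auto
      finally show ?thesis by (simp add: power2_eq_square mult.assoc)
    qed
  qed
qed

section \<open>The Riemannian distance\<close>

context riemannian_manifold
begin

lemma chart_subset: "(U, \<phi>) \<in> \<A> \<Longrightarrow> U \<subseteq> topspace X"
  using chart_domain_open openin_subset by blast

lemma chart_inj:
  assumes "(U, \<phi>) \<in> \<A>"
  shows "inj_on \<phi> U"
  using homeomorphic_imp_injective_map[OF chart_homeomorphic[OF assms]] chart_subset[OF assms]
  by (simp add: inf.absorb2)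

lemma chart_continuous:
  assumes "(U, \<phi>) \<in> \<A>"
  shows "continuous_map (subtopology X U) euclidean \<phi>"
  using homeomorphic_imp_continuous_map[OF chart_homeomorphic[OF assms]]
  by (simp add: continuous_map_in_subtopology)

lemma chart_inverse_continuous:
  assumes "(U, \<phi>) \<in> \<A>"
  shows "continuous_map (top_of_set (\<phi> ` U)) X (inv_into U \<phi>)"
proof -
  obtain h where h: "homeomorphic_maps (subtopology X U) (top_of_set (\<phi> ` U)) \<phi> h"
    using chart_homeomorphic[OF assms] homeomorphic_map_maps by blast
  then have "continuous_map (top_of_set (\<phi> ` U)) (subtopology X U) h"
    by (simp add: homeomorphic_maps_def)
  then have "continuous_map (top_of_set (\<phi> ` U)) X h"
    by (simp add: continuous_map_in_subtopology)
  moreover have "inv_into U \<phi> y = h y" if "y \<in> \<phi> ` U" for y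
    using h that chart_subset[OF assms] chart_inj[OF assms]
    by (auto simp: homeomorphic_maps_def inf.absorb2)
  ultimately show ?thesis by (auto elim: continuous_map_eq)
qed

lemma chart_preimage_open:
  assumes "(U, \<phi>) \<in> \<A>" "open W" "W \<subseteq> \<phi> ` U"
  shows "openin X (inv_into U \<phi> ` W)"
proof -
  have "openin (subtopology X U) {p \<in> topspace (subtopology X U). \<phi> p \<in> W}"
    using chart_continuous[OF assms(1)] assms(2) by (intro openin_continuous_map_preimage) auto
  moreover have "{p \<in> topspace (subtopology X U). \<phi> p \<in> W} = inv_into U \<phi> ` W"
  proof (intro equalityI subsetI)
    fix p assume p: "p \<in> {p \<in> topspace (subtopology X U). \<phi> p \<in> W}"
    then have "inv_into U \<phi> (\<phi> p) = p" using chart_inj[OF assms(1)] by simp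
    then show "p \<in> inv_into U \<phi> ` W" using p by (metis (mono_tags, lifting) imageI mem_Collect_eq)
  next
    fix p assume "p \<in> inv_into U \<phi> ` W"
    then obtain w where w: "w \<in> W" "p = inv_into U \<phi> w" by blast
    then have "w \<in> \<phi> ` U" using assms(3) by blast
    then show "p \<in> {p \<in> topspace (subtopology X U). \<phi> p \<in> W}"
      using w chart_subset[OF assms(1)] inv_into_into[of w \<phi> U] f_inv_into_f[of w \<phi> U] by auto
  qed
  ultimately show ?thesis
    using chart_domain_open[OF assms(1)] openin_trans_full by metis
qed

lemma chart_at:
  assumes "p \<in> topspace X"
  obtains U \<phi> where "(U, \<phi>) \<in> \<A>" "p \<in> U"
proof -
  have "p \<in> (\<Union>(U, \<phi>)\<in>\<A>. U)" using assms charts_cover by simp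
  then show ?thesis using that by blast
qed

lemma path_stays:
  assumes "pathin X c" "openin X U" "t \<in> {0..1}" "c t \<in> U"
  shows "\<exists>e>0. \<forall>s\<in>{0..1}. dist s t < e \<longrightarrow> c s \<in> U"
proof -
  have "openin (top_of_set {0..1}) {s \<in> topspace (top_of_set {0..1}). c s \<in> U}"
    using assms(1,2) unfolding pathin_def by (rule openin_continuous_map_preimage)
  then show ?thesis
    using assms(3,4) unfolding openin_euclidean_subtopology_iff by auto
qed

text \<open>The chart of the speed is chosen by \<open>SOME\<close>, hence this independence of the chart.\<close>

lemma velocity_change_chart:
  assumes A: "(U, \<phi>) \<in> \<A>" "(V, \<theta>) \<in> \<A>" and c: "pathin X c"
    and t: "t \<in> I" "I \<subseteq> {0..1}" "c t \<in> U" "c t \<in> V"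
    and D: "((\<phi> \<circ> c) has_vector_derivative D) (at t within I)"
  obtains D' where "((\<theta> \<circ> c) has_vector_derivative D') (at t within I)"
    "g (V, \<theta>) (\<theta> (c t)) D' D' = g (U, \<phi>) (\<phi> (c t)) D D"
proof -
  let ?T = "transition (U, \<phi>) (V, \<theta>)"
  let ?F = "frechet_derivative ?T (at (\<phi> (c t)))"
  have x: "\<phi> (c t) \<in> \<phi> ` (U \<inter> V)" using t by blast
  have F: "(?T has_derivative ?F) (at (\<phi> (c t)))"
    by (rule smooth_on_imp_has_derivative[OF transition_smooth[OF A] x])
  have T: "?T (\<phi> p) = \<theta> p" if "p \<in> U" for p
    using that chart_inj[OF A(1)] by (simp add: transition_def)
  have T': "((?T \<circ> (\<phi> \<circ> c)) has_vector_derivative ?F D) (at t within I)"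
    by (rule vector_derivative_diff_chain_within[OF D has_derivative_at_withinI]) (use F in simp)
  obtain e where e: "e > 0" "\<And>s. s \<in> I \<Longrightarrow> dist s t < e \<Longrightarrow> c s \<in> U"
    using path_stays[OF c chart_domain_open[OF A(1)], of t] t by blast
  have "((\<theta> \<circ> c) has_vector_derivative ?F D) (at t within I)"
    by (rule has_vector_derivative_transform_within[OF T' e(1) t(1)]) (use T e(2) in auto)
  then show ?thesis
  proof (rule that)
    show "g (V, \<theta>) (\<theta> (c t)) (?F D) (?F D) = g (U, \<phi>) (\<phi> (c t)) D D"
      using metric_transition[OF A x, of D D] T[OF t(3)] by simp
  qed
qed

text \<open>On a closed piece this speed is one-sided at the ends and therefore continuous there,
  whereas the two-sided derivative in \<open>curve_speed\<close> may not exist at a break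
  point.\<close>

definition speed_within :: "(real \<Rightarrow> 'a) \<Rightarrow> real set \<Rightarrow> real \<Rightarrow> real" where
  "speed_within c I t =
     (let \<kappa> = (SOME \<kappa>. \<kappa> \<in> \<A> \<and> c t \<in> fst \<kappa>);
          v = vector_derivative (snd \<kappa> \<circ> c) (at t within I)
      in sqrt (g \<kappa> (snd \<kappa> (c t)) v v))"

lemma curve_speed_eq: "curve_speed \<A> g c t = speed_within c UNIV t"
  by (simp add: curve_speed_def speed_within_def)

lemma some_chart:
  assumes "p \<in> topspace X"
  obtains V \<theta> where "(SOME \<kappa>. \<kappa> \<in> \<A> \<and> p \<in> fst \<kappa>) = (V, \<theta>)" "(V, \<theta>) \<in> \<A>" "p \<in> V"
proof -
  obtain U \<phi> where "(U, \<phi>) \<in> \<A>" "p \<in> U" using chart_at[OF assms] .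
  then have "\<exists>\<kappa>. \<kappa> \<in> \<A> \<and> p \<in> fst \<kappa>" by (intro exI[of _ "(U, \<phi>)"]) auto
  from someI_ex[OF this] show ?thesis
    by (cases "SOME \<kappa>. \<kappa> \<in> \<A> \<and> p \<in> fst \<kappa>") (use that in auto)
qed

lemma speed_within_chart:
  assumes A: "(U, \<phi>) \<in> \<A>" and c: "pathin X c"
    and t: "a < b" "t \<in> {a..b}" "{a..b} \<subseteq> {0..1}" "c t \<in> U"
    and D: "((\<phi> \<circ> c) has_vector_derivative D) (at t within {a..b})"
  shows "speed_within c {a..b} t = sqrt (g (U, \<phi>) (\<phi> (c t)) D D)"
proof -
  have "c t \<in> topspace X" using chart_subset[OF A] t(4) by blast
  then obtain V \<theta> where V: "(SOME \<kappa>. \<kappa> \<in> \<A> \<and> c t \<in> fst \<kappa>) = (V, \<theta>)" "(V, \<theta>) \<in> \<A>" "c t \<in> V"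
    by (rule some_chart)
  obtain D' where D': "((\<theta> \<circ> c) has_vector_derivative D') (at t within {a..b})"
    "g (V, \<theta>) (\<theta> (c t)) D' D' = g (U, \<phi>) (\<phi> (c t)) D D"
    by (rule velocity_change_chart[OF A V(2) c t(2,3,4) V(3) D])
  have "vector_derivative (\<theta> \<circ> c) (at t within {a..b}) = D'"
    by (rule vector_derivative_within_closed_interval[OF t(1,2) D'(1)])
  then show ?thesis unfolding speed_within_def V(1) using D'(2) by simp
qed

lemma curve_speed_chart:
  assumes A: "(U, \<phi>) \<in> \<A>" and c: "pathin X c" and t: "0 < t" "t < 1" "c t \<in> U"
    and D: "((\<phi> \<circ> c) has_vector_derivative D) (at t)"
  shows "curve_speed \<A> g c t = sqrt (g (U, \<phi>) (\<phi> (c t)) D D)"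
proof -
  have at: "at t within {0..1} = at t" using t by (intro at_within_interior) (simp add: interior_atLeastAtMost_real)
  have "speed_within c {0..1} t = sqrt (g (U, \<phi>) (\<phi> (c t)) D D)"
    by (rule speed_within_chart[OF A c]) (use t D at in auto)
  then show ?thesis unfolding curve_speed_eq speed_within_def at by simp
qed

lemma curve_speed_nonneg: "curve_speed \<A> g c t \<ge> 0" if "c t \<in> topspace X"
proof -
  obtain V \<theta> where V: "(SOME \<kappa>. \<kappa> \<in> \<A> \<and> c t \<in> fst \<kappa>) = (V, \<theta>)" "(V, \<theta>) \<in> \<A>" "c t \<in> V"
    using some_chart[OF \<open>c t \<in> topspace X\<close>] .
  have x: "\<theta> (c t) \<in> \<theta> ` V" using V by blast
  have "g (V, \<theta>) (\<theta> (c t)) v v \<ge> 0" for v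
    using metric_positive[OF V(2) x, of v] bilinear_lzero[OF metric_bilinear[OF V(2) x]]
    by (cases "v = 0") auto
  then show ?thesis unfolding curve_speed_def V(1) by (simp add: Let_def)
qed

lemma C1_piece_speed:
  assumes c: "pathin X c" and ab: "a < b" "{a..b} \<subseteq> {0..1}" and C1: "C1_curve_on \<A> a b c"
  shows "continuous_on {a..b} (speed_within c {a..b})"
    and "\<And>t. t \<in> {a<..<b} \<Longrightarrow> curve_speed \<A> g c t = speed_within c {a..b} t"
proof -
  show "continuous_on {a..b} (speed_within c {a..b})"
    unfolding continuous_on_eq_continuous_within
  proof
    fix t assume t: "t \<in> {a..b}"
    have "c t \<in> topspace X" using path_image_subset_topspace[OF c] t ab by auto
    then obtain U \<phi> where U: "(U, \<phi>) \<in> \<A>" "c t \<in> U" by (rule chart_at)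
    define J where "J = {s \<in> {a..b}. c s \<in> U}"
    obtain D where D: "continuous_on J D"
      "\<And>s. s \<in> J \<Longrightarrow> ((\<phi> \<circ> c) has_vector_derivative D s) (at s within {a..b})"
      using C1 U(1) unfolding C1_curve_on_def J_def by fastforce
    have cont: "continuous_on J (\<phi> \<circ> c)"
      unfolding continuous_on_eq_continuous_within
    proof
      fix s assume s: "s \<in> J"
      have "continuous (at s within {a..b}) (\<phi> \<circ> c)"
        using D(2)[OF s] by (rule has_vector_derivative_continuous)
      then show "continuous (at s within J) (\<phi> \<circ> c)"
        by (rule continuous_within_subset) (auto simp: J_def)
    qed
    have "continuous_on J (\<lambda>s. g (U, \<phi>) ((\<phi> \<circ> c) s) (D s) (D s))"
      by (rule bilinear_field_continuous[where S = "\<phi> ` U", OF metric_bilinear[OF U(1)]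
          smooth_on_imp_continuous_on[OF metric_smooth[OF U(1)]] cont _ D(1) D(1)]) (auto simp: J_def)
    then have "continuous_on J (\<lambda>s. sqrt (g (U, \<phi>) ((\<phi> \<circ> c) s) (D s) (D s)))"
      by (rule continuous_on_real_sqrt)
    moreover have "speed_within c {a..b} s = sqrt (g (U, \<phi>) ((\<phi> \<circ> c) s) (D s) (D s))" if "s \<in> J" for s
      using speed_within_chart[OF U(1) c ab(1) _ ab(2) _ D(2)[OF that]] that by (simp add: J_def)
    ultimately have "continuous_on J (speed_within c {a..b})" by (simp cong: continuous_on_cong)
    then have cJ: "continuous (at t within J) (speed_within c {a..b})"
      using t U(2) by (simp add: continuous_on_eq_continuous_within J_def)
    obtain e where e: "e > 0" "\<And>s. s \<in> {0..1} \<Longrightarrow> dist s t < e \<Longrightarrow> c s \<in> U"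
      using path_stays[OF c chart_domain_open[OF U(1)], of t] t ab U(2) by blast
    \<comment> \<open>The curve stays in the chart domain near t, so continuity within J is
      continuity within the whole piece.\<close>
    have "at t within J = at t within {a..b}"
      by (rule at_within_nhd[where S = "ball t e"])
        (use e ab in \<open>auto simp: J_def dist_commute\<close>)
    then show "continuous (at t within {a..b}) (speed_within c {a..b})" using cJ by simp
  qed
  fix t assume t: "t \<in> {a<..<b}"
  have "at t within {a..b} = at t" using t by (intro at_within_interior) (simp add: interior_atLeastAtMost_real)
  then show "curve_speed \<A> g c t = speed_within c {a..b} t"
    by (simp add: curve_speed_eq speed_within_def)
qed

text \<open>The break points are named because reversal and concatenation transform them.\<close>

definition breaks :: "(real \<Rightarrow> 'a) \<Rightarrow> real set \<Rightarrow> bool" where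
  "breaks c S \<longleftrightarrow> finite S \<and>
     (\<forall>a b. 0 \<le> a \<and> a < b \<and> b \<le> 1 \<and> {a<..<b} \<inter> S = {} \<longrightarrow> C1_curve_on \<A> a b c)"

lemma piecewise_C1_curve_iff: "piecewise_C1_curve X \<A> c \<longleftrightarrow> pathin X c \<and> (\<exists>S. breaks c S)"
  by (simp add: piecewise_C1_curve_def breaks_def)

text \<open>Splitting at a break point inside the interval lowers their number. On an interval
  without inner break points, the speed differs from the continuous \<open>speed_within\<close> at
  most at the two ends.\<close>

lemma speed_integrable_on_subinterval:
  assumes c: "pathin X c" "breaks c S" and ab: "0 \<le> a" "a \<le> b" "b \<le> 1"
  shows "curve_speed \<A> g c integrable_on {a..b}"
  using ab
proof (induction "card (S \<inter> {a<..<b})" arbitrary: a b rule: less_induct)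
  case less
  have fin: "finite S" using c(2) by (simp add: breaks_def)
  consider "a = b" | "a < b" "S \<inter> {a<..<b} = {}" | s where "s \<in> S" "a < s" "s < b"
    using less.prems by fastforce
  then show ?case
  proof cases
    case 1
    then show ?thesis using integrable_on_refl[of _ a] by simp
  next
    case 2
    then have C1: "C1_curve_on \<A> a b c" using c(2) less.prems unfolding breaks_def by blast
    have sub: "{a..b} \<subseteq> {0..1}" using less.prems by auto
    show ?thesis
    proof (rule integrable_spike_finite[of "{a, b}"])
      show "speed_within c {a..b} integrable_on {a..b}"
        by (rule integrable_continuous_interval[OF C1_piece_speed(1)[OF c(1) 2(1) sub C1]])
      show "curve_speed \<A> g c t = speed_within c {a..b} t" if "t \<in> {a..b} - {a, b}" for t
        by (rule C1_piece_speed(2)[OF c(1) 2(1) sub C1]) (use that in auto)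
    qed simp
  next
    case 3
    have "card (S \<inter> {a<..<s}) < card (S \<inter> {a<..<b})" "card (S \<inter> {s<..<b}) < card (S \<inter> {a<..<b})"
      using fin 3 by (intro psubset_card_mono; auto)+
    then have "curve_speed \<A> g c integrable_on {a..s}" "curve_speed \<A> g c integrable_on {s..b}"
      using less 3 by auto
    then show ?thesis using 3 by (intro Henstock_Kurzweil_Integration.integrable_combine[of a s b]) auto
  qed
qed

lemma speed_integrable:
  assumes "piecewise_C1_curve X \<A> c" "0 \<le> a" "a \<le> b" "b \<le> 1"
  shows "curve_speed \<A> g c integrable_on {a..b}"
  using assms speed_integrable_on_subinterval unfolding piecewise_C1_curve_iff by blast

lemma speed_nonneg:
  assumes "piecewise_C1_curve X \<A> c" "t \<in> {0..1}"
  shows "curve_speed \<A> g c t \<ge> 0"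
  using assms path_image_subset_topspace unfolding piecewise_C1_curve_iff
  by (blast intro: curve_speed_nonneg)

lemma curve_length_nonneg: "piecewise_C1_curve X \<A> c \<Longrightarrow> curve_length \<A> g c \<ge> 0"
  unfolding curve_length_def by (intro integral_nonneg speed_integrable speed_nonneg) auto

lemma differentiable_off_breaks:
  assumes c: "breaks c S" and t: "0 < t" "t < 1" "t \<notin> S" and U: "(U, \<phi>) \<in> \<A>" "c t \<in> U"
  obtains D where "((\<phi> \<circ> c) has_vector_derivative D) (at t)"
proof -
  have "finite S" using c by (simp add: breaks_def)
  then have "open (- S \<inter> {0<..<1})" by (intro open_Int) (auto simp: finite_imp_closed open_Compl)
  moreover have "t \<in> - S \<inter> {0<..<1}" using t by simp
  ultimately obtain e where e: "e > 0" "cball t e \<subseteq> - S \<inter> {0<..<1}"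
    using open_contains_cball by metis
  define a where "a = t - e"
  define b where "b = t + e"
  have cb: "cball t e = {a..b}" by (simp add: cball_eq_atLeastAtMost a_def b_def)
  then have ab: "a \<in> {0<..<1}" "b \<in> {0<..<1}" "{a<..<b} \<inter> S = {}" "a < t" "t < b"
    using e by (auto simp: a_def b_def subset_iff)
  then have "C1_curve_on \<A> a b c" using c unfolding breaks_def by auto
  then obtain D where D: "\<And>s. s \<in> {a..b} \<Longrightarrow> c s \<in> U \<Longrightarrow>
      ((\<phi> \<circ> c) has_vector_derivative D s) (at s within {a..b})"
    using U(1) unfolding C1_curve_on_def by fastforce
  have "at t within {a..b} = at t" using ab by (intro at_within_interior) (simp add: interior_atLeastAtMost_real)
  then show ?thesis using that[of "D t"] D[of t] U(2) ab by simp
qed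

text \<open>One lemma for reversal, with m = -1, and for both halves of a concatenation, with m =
  2.\<close>

lemma C1_curve_affine:
  assumes C1: "C1_curve_on \<A> a b c"
    and c': "\<And>t. t \<in> {a'..b'} \<Longrightarrow> m * t + q \<in> {a..b} \<and> c' t = c (m * t + q)"
  shows "C1_curve_on \<A> a' b' c'"
  unfolding C1_curve_on_def
proof (intro ballI, clarify)
  fix U \<phi> assume U: "(U, \<phi>) \<in> \<A>"
  obtain D where D: "continuous_on {t \<in> {a..b}. c t \<in> U} D"
    "\<And>s. s \<in> {a..b} \<Longrightarrow> c s \<in> U \<Longrightarrow> ((\<phi> \<circ> c) has_vector_derivative D s) (at s within {a..b})"
    using C1 U unfolding C1_curve_on_def by fastforce
  show "\<exists>D. continuous_on {t \<in> {a'..b'}. c' t \<in> U} D \<and>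
      (\<forall>t\<in>{a'..b'}. c' t \<in> U \<longrightarrow> ((\<phi> \<circ> c') has_vector_derivative D t) (at t within {a'..b'}))"
  proof (intro exI[of _ "\<lambda>t. m *\<^sub>R D (m * t + q)"] conjI ballI impI)
    show "continuous_on {t \<in> {a'..b'}. c' t \<in> U} (\<lambda>t. m *\<^sub>R D (m * t + q))"
      by (intro continuous_intros continuous_on_compose2[OF D(1)]) (use c' in auto)
    fix t assume t: "t \<in> {a'..b'}" "c' t \<in> U"
    have "((\<lambda>t. m * t + q) has_vector_derivative m) (at t within {a'..b'})"
      by (auto intro!: derivative_eq_intros)
    moreover have "((\<phi> \<circ> c) has_vector_derivative D (m * t + q)) (at (m * t + q) within (\<lambda>t. m * t + q) ` {a'..b'})"
      by (rule has_vector_derivative_within_subset[OF D(2)]) (use c' t in auto)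
    ultimately have "(((\<phi> \<circ> c) \<circ> (\<lambda>t. m * t + q)) has_vector_derivative m *\<^sub>R D (m * t + q)) (at t within {a'..b'})"
      by (rule vector_diff_chain_within)
    then show "((\<phi> \<circ> c') has_vector_derivative m *\<^sub>R D (m * t + q)) (at t within {a'..b'})"
      by (rule has_vector_derivative_transform[OF t(1), rotated]) (use c' in auto)
  qed
qed

lemma curve_speed_affine:
  assumes c: "pathin X c" "breaks c S" and c': "pathin X c'"
    and t: "0 < t" "t < 1" and s: "0 < m * t + q" "m * t + q < 1" "m * t + q \<notin> S"
    and eq: "\<And>u. u \<in> J \<Longrightarrow> c' u = c (m * u + q)" and J: "open J" "t \<in> J"
  shows "curve_speed \<A> g c' t = \<bar>m\<bar> * curve_speed \<A> g c (m * t + q)"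
proof -
  let ?s = "m * t + q"
  have "c ?s \<in> topspace X" using path_image_subset_topspace[OF c(1)] s by auto
  then obtain U \<phi> where U: "(U, \<phi>) \<in> \<A>" "c ?s \<in> U" by (rule chart_at)
  obtain D where D: "((\<phi> \<circ> c) has_vector_derivative D) (at ?s)"
    using differentiable_off_breaks[OF c(2) s U] .
  have "((\<lambda>t. m * t + q) has_vector_derivative m) (at t)" by (auto intro!: derivative_eq_intros)
  from vector_diff_chain_at[OF this D]
  have "(((\<phi> \<circ> c) \<circ> (\<lambda>t. m * t + q)) has_vector_derivative m *\<^sub>R D) (at t)" .
  then have D': "((\<phi> \<circ> c') has_vector_derivative m *\<^sub>R D) (at t)"
    by (rule has_vector_derivative_transform_within_open[OF _ J]) (simp add: eq)
  have x: "\<phi> (c ?s) \<in> \<phi> ` U" using U(2) by blast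
  have "curve_speed \<A> g c' t = sqrt (g (U, \<phi>) (\<phi> (c' t)) (m *\<^sub>R D) (m *\<^sub>R D))"
    by (rule curve_speed_chart[OF U(1) c' t _ D']) (use U eq J in simp)
  also have "\<dots> = sqrt (m\<^sup>2 * g (U, \<phi>) (\<phi> (c ?s)) D D)"
    using metric_bilinear[OF U(1) x] eq[OF J(2)]
    by (simp add: bilinear_lmul bilinear_rmul power2_eq_square)
  also have "\<dots> = \<bar>m\<bar> * curve_speed \<A> g c ?s"
    using curve_speed_chart[OF U(1) c(1) s(1,2) U(2) D] by (simp add: real_sqrt_mult)
  finally show ?thesis .
qed


text \<open>Change of variables: the factor |m| of the speed cancels that of the interval. The
  premise \<open>img\<close> describes the interval in the form that
  \<open>has_integral_affinity\<close> produces.\<close>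

lemma has_integral_speed_affine:
  assumes c: "pathin X c" "breaks c S" and c': "pathin X c'"
    and ab: "0 \<le> a" "b \<le> 1" and m: "m \<noteq> 0"
    and img: "(\<lambda>x. (1 / m) *\<^sub>R x + - ((1 / m) *\<^sub>R q)) ` cbox 0 1 = {a..b}"
    and eq: "\<And>t. t \<in> {a..b} \<Longrightarrow> c' t = c (m * t + q)"
  shows "(curve_speed \<A> g c' has_integral curve_length \<A> g c) {a..b}"
proof -
  have "(curve_speed \<A> g c has_integral curve_length \<A> g c) (cbox 0 1)"
    unfolding curve_length_def cbox_interval
    using speed_integrable_on_subinterval[OF c, of 0 1] by (simp add: integrable_integral)
  from has_integral_affinity[OF this m, of q]
  have "((\<lambda>t. curve_speed \<A> g c (m * t + q)) has_integral (1 / \<bar>m\<bar>) * curve_length \<A> g c) {a..b}"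
    unfolding img by simp
  from has_integral_mult_right[OF this, of "\<bar>m\<bar>"]
  have int: "((\<lambda>t. \<bar>m\<bar> * curve_speed \<A> g c (m * t + q)) has_integral curve_length \<A> g c) {a..b}"
    using m by simp
  \<comment> \<open>The finitely many parameters at which the speeds need not match: the ends, and
    the preimages of break points and of 0 and 1.\<close>
  let ?N = "{a, b} \<union> (\<lambda>t. m * t + q) -` (S \<union> {0, 1})"
  show ?thesis
  proof (rule has_integral_spike_finite[OF _ _ int])
    have "finite S" using c(2) by (simp add: breaks_def)
    moreover have "inj (\<lambda>t. m * t + q)" using m by (auto simp: inj_on_def)
    ultimately show "finite ?N" by (intro finite_UnI finite_vimageI) auto
    fix t assume t: "t \<in> {a..b} - ?N"
    have "t \<in> (\<lambda>x. (1 / m) *\<^sub>R x + - ((1 / m) *\<^sub>R q)) ` cbox 0 1" using t img by simp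
    then obtain x where x: "x \<in> {0..1}" "t = x / m - q / m" by auto
    then have mt: "m * t + q = x" using m by (simp add: field_simps)
    show "curve_speed \<A> g c' t = \<bar>m\<bar> * curve_speed \<A> g c (m * t + q)"
    proof (rule curve_speed_affine[OF c c'])
      show "open {a<..<b}" by simp
      show "t \<in> {a<..<b}" using t by auto
      show "c' u = c (m * u + q)" if "u \<in> {a<..<b}" for u using eq that by auto
      show "0 < t" "t < 1" using t ab by auto
      show "0 < m * t + q" "m * t + q < 1" "m * t + q \<notin> S" using t x(1) mt by auto
    qed
  qed
qed

section \<open>Constant, reversed, concatenated and straight curves\<close>

lemma const_curve:
  assumes "p \<in> topspace X"
  shows "piecewise_C1_curve X \<A> (\<lambda>_. p)" "curve_length \<A> g (\<lambda>_. p) = 0"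
proof -
  have "C1_curve_on \<A> a b (\<lambda>_. p)" for a b
    unfolding C1_curve_on_def by (auto simp: o_def intro!: exI[of _ "\<lambda>_. 0"] derivative_eq_intros)
  then show "piecewise_C1_curve X \<A> (\<lambda>_. p)"
    unfolding piecewise_C1_curve_def using assms by auto
  obtain U \<phi> where U: "(U, \<phi>) \<in> \<A>" "p \<in> U" using chart_at[OF assms] .
  have "\<phi> p \<in> \<phi> ` U" using U(2) by blast
  from bilinear_lzero[OF metric_bilinear[OF U(1) this]]
  have sp: "curve_speed \<A> g (\<lambda>_. p) t = 0" if "0 < t" "t < 1" for t
    using curve_speed_chart[OF U(1), of "\<lambda>_. p" t 0] that assms U(2) by (simp add: o_def)
  have "(curve_speed \<A> g (\<lambda>_. p) has_integral 0) {0..1}"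
    by (rule has_integral_spike_finite[of "{0, 1}" _ _ "\<lambda>_. 0"]) (auto intro: sp)
  then show "curve_length \<A> g (\<lambda>_. p) = 0"
    unfolding curve_length_def by (rule integral_unique)
qed

lemma reverse_curve:
  assumes "piecewise_C1_curve X \<A> c"
  shows "piecewise_C1_curve X \<A> (\<lambda>t. c (1 - t))" "curve_length \<A> g (\<lambda>t. c (1 - t)) = curve_length \<A> g c"
proof -
  obtain S where c: "pathin X c" "breaks c S" using assms unfolding piecewise_C1_curve_iff by blast
  have "continuous_map (top_of_set {0..1}) (top_of_set {0..1}) (\<lambda>t::real. 1 - t)"
    by (auto simp: continuous_map_in_subtopology intro!: continuous_intros)
  from continuous_map_compose[OF this c(1)[unfolded pathin_def]]
  have path: "pathin X (\<lambda>t. c (1 - t))" by (simp add: pathin_def o_def)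
  have "breaks (\<lambda>t. c (1 - t)) ((\<lambda>t. 1 - t) ` S)"
    unfolding breaks_def
  proof (intro conjI allI impI)
    show "finite ((\<lambda>t. 1 - t) ` S)" using c(2) by (simp add: breaks_def)
    fix a b :: real assume ab: "0 \<le> a \<and> a < b \<and> b \<le> 1 \<and> {a<..<b} \<inter> (\<lambda>t. 1 - t) ` S = {}"
    have "{1 - b<..<1 - a} \<inter> S = {}"
    proof (rule ccontr)
      assume "{1 - b<..<1 - a} \<inter> S \<noteq> {}"
      then obtain s where "s \<in> S" "1 - b < s" "s < 1 - a" by auto
      then have "1 - s \<in> {a<..<b} \<inter> (\<lambda>t. 1 - t) ` S" by auto
      then show False using ab by blast
    qed
    then have "C1_curve_on \<A> (1 - b) (1 - a) c" using c(2) ab unfolding breaks_def by auto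
    then show "C1_curve_on \<A> a b (\<lambda>t. c (1 - t))"
      by (rule C1_curve_affine[where m = "-1" and q = 1]) auto
  qed
  with path show "piecewise_C1_curve X \<A> (\<lambda>t. c (1 - t))"
    unfolding piecewise_C1_curve_iff by blast
  have img: "(\<lambda>x::real. (1 / (- 1)) *\<^sub>R x + - ((1 / (- 1)) *\<^sub>R 1)) ` cbox 0 1 = {0..1}"
    by (auto simp: image_iff intro!: bexI[of _ "1 - _"])
  have "(curve_speed \<A> g (\<lambda>t. c (1 - t)) has_integral curve_length \<A> g c) {0..1}"
    by (rule has_integral_speed_affine[OF c path _ _ _ img]) auto
  then show "curve_length \<A> g (\<lambda>t. c (1 - t)) = curve_length \<A> g c"
    by (simp add: curve_length_def[of \<A> g "\<lambda>t. c (1 - t)"] integral_unique)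
qed

lemma concat_curves:
  assumes c: "piecewise_C1_curve X \<A> c" and c': "piecewise_C1_curve X \<A> c'" and end_eq: "c 1 = c' 0"
  defines "e \<equiv> \<lambda>t. if t \<le> 1/2 then c (2 * t) else c' (2 * t - 1)"
  shows "piecewise_C1_curve X \<A> e" "curve_length \<A> g e = curve_length \<A> g c + curve_length \<A> g c'"
proof -
  obtain S where S: "pathin X c" "breaks c S" using c unfolding piecewise_C1_curve_iff by blast
  obtain S' where S': "pathin X c'" "breaks c' S'" using c' unfolding piecewise_C1_curve_iff by blast
  have low: "e t = c (2 * t)" if "t \<le> 1/2" for t using that by (simp add: e_def)
  have high: "e t = c' (2 * t - 1)" if "t \<ge> 1/2" for t
  proof (cases "t = 1/2")
    case True
    then show ?thesis unfolding True e_def using end_eq by simp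
  qed (use that in \<open>simp add: e_def\<close>)
  have path: "pathin X e"
    unfolding pathin_def e_def
  proof (rule continuous_map_cases_le)
    have "continuous_map (top_of_set ({0..1} \<inter> {t. t \<le> 1/2})) (top_of_set {0..1}) (\<lambda>t::real. 2 * t)"
      by (auto simp: continuous_map_in_subtopology intro!: continuous_intros)
    from continuous_map_compose[OF this S(1)[unfolded pathin_def]]
    moreover have "{0..1} \<inter> {x \<in> topspace (top_of_set {0..1}). x \<le> 1/2} = {0..1} \<inter> {t. t \<le> (1/2::real)}"
      by auto
    ultimately show "continuous_map (subtopology (top_of_set {0..1}) {x \<in> topspace (top_of_set {0..1}). x \<le> 1/2}) X (\<lambda>t. c (2 * t))"
      unfolding subtopology_subtopology by (simp only: o_def)
    have "continuous_map (top_of_set ({0..1} \<inter> {t. 1/2 \<le> t})) (top_of_set {0..1}) (\<lambda>t::real. 2 * t - 1)"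
      by (auto simp: continuous_map_in_subtopology intro!: continuous_intros)
    from continuous_map_compose[OF this S'(1)[unfolded pathin_def]]
    moreover have "{0..1} \<inter> {x \<in> topspace (top_of_set {0..1}). 1/2 \<le> x} = {0..1} \<inter> {t. 1/2 \<le> (t::real)}"
      by auto
    ultimately show "continuous_map (subtopology (top_of_set {0..1}) {x \<in> topspace (top_of_set {0..1}). 1/2 \<le> x}) X (\<lambda>t. c' (2 * t - 1))"
      unfolding subtopology_subtopology by (simp only: o_def)
    show "c (2 * t) = c' (2 * t - 1)" if "t = 1/2" for t
      unfolding that using end_eq by simp
  qed auto
  \<comment> \<open>The derivative may jump at 1/2, where the curves are joined.\<close>
  let ?N = "{1/2} \<union> (\<lambda>t. 2 * t) -` S \<union> (\<lambda>t. 2 * t - 1) -` S'"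
  have "breaks e ?N"
    unfolding breaks_def
  proof (intro conjI allI impI)
    have "finite S" "finite S'" using S S' by (simp_all add: breaks_def)
    then show "finite ?N" by (intro finite_UnI finite_vimageI) (auto simp: inj_on_def)
    fix a b :: real assume ab: "0 \<le> a \<and> a < b \<and> b \<le> 1 \<and> {a<..<b} \<inter> ?N = {}"
    then have N: "t \<notin> ?N" if "a < t" "t < b" for t using that by auto
    have "b \<le> 1/2 \<or> 1/2 \<le> a"
      by (rule ccontr) (use N[of "1/2"] in \<open>auto simp: not_le\<close>)
    then show "C1_curve_on \<A> a b e"
    proof
      assume b: "b \<le> 1/2"
      have "s \<notin> S" if "2 * a < s" "s < 2 * b" for s
        using N[of "s/2"] that by auto
      then have "{2 * a<..<2 * b} \<inter> S = {}" by auto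
      then have "C1_curve_on \<A> (2 * a) (2 * b) c" using S(2) ab b unfolding breaks_def by simp
      then show ?thesis
        by (rule C1_curve_affine[where m = 2 and q = 0]) (use b low in auto)
    next
      assume a: "1/2 \<le> a"
      have N': "2 * u - 1 \<notin> S'" if "a < u" "u < b" for u using N[OF that] by simp
      have "s \<notin> S'" if "2 * a - 1 < s" "s < 2 * b - 1" for s
      proof -
        have "2 * ((s + 1) / 2) - 1 \<notin> S'" by (rule N') (use that in \<open>simp_all add: field_simps\<close>)
        moreover have "2 * ((s + 1) / 2) - 1 = s" by (simp add: field_simps)
        ultimately show ?thesis by simp
      qed
      then have "{2 * a - 1<..<2 * b - 1} \<inter> S' = {}" by auto
      then have "C1_curve_on \<A> (2 * a - 1) (2 * b - 1) c'" using S'(2) ab a unfolding breaks_def by simp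
      then show ?thesis
        by (rule C1_curve_affine[where m = 2 and q = "-1"]) (use a high in auto)
    qed
  qed
  with path show "piecewise_C1_curve X \<A> e" unfolding piecewise_C1_curve_iff by blast
  have img: "(\<lambda>x::real. (1 / 2) *\<^sub>R x + - ((1 / 2) *\<^sub>R 0)) ` cbox 0 1 = {0..1/2}"
    by (auto simp: image_iff intro!: bexI[of _ "2 * _"])
  have img': "(\<lambda>x::real. (1 / 2) *\<^sub>R x + - ((1 / 2) *\<^sub>R (- 1))) ` cbox 0 1 = {1/2..1}"
  proof (intro equalityI subsetI)
    fix t :: real assume "t \<in> {1/2..1}"
    then show "t \<in> (\<lambda>x. (1 / 2) *\<^sub>R x + - ((1 / 2) *\<^sub>R (- 1))) ` cbox 0 1"
      by (intro image_eqI[of _ _ "2 * t - 1"]) (auto simp: field_simps)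
  qed auto
  have 1: "(curve_speed \<A> g e has_integral curve_length \<A> g c) {0..1/2}"
    by (rule has_integral_speed_affine[OF S path _ _ _ img]) (use low in auto)
  have 2: "(curve_speed \<A> g e has_integral curve_length \<A> g c') {1/2..1}"
    by (rule has_integral_speed_affine[OF S' path _ _ _ img']) (use high in auto)
  have "(curve_speed \<A> g e has_integral curve_length \<A> g c + curve_length \<A> g c') {0..1}"
    by (rule has_integral_combine[OF _ _ 1 2]) auto
  then show "curve_length \<A> g e = curve_length \<A> g c + curve_length \<A> g c'"
    unfolding curve_length_def[of \<A> g e] by (rule integral_unique)
qed

lemma segment_curve:
  assumes U: "(U, \<phi>) \<in> \<A>" and seg: "closed_segment x y \<subseteq> \<phi> ` U"
  defines "c \<equiv> \<lambda>t. inv_into U \<phi> (x + t *\<^sub>R (y - x))"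
  shows "piecewise_C1_curve X \<A> c"
    and "\<And>t. t \<in> {0<..<1} \<Longrightarrow>
      curve_speed \<A> g c t = sqrt (g (U, \<phi>) (x + t *\<^sub>R (y - x)) (y - x) (y - x))"
proof -
  let ?l = "\<lambda>t. x + t *\<^sub>R (y - x)"
  have l: "?l t \<in> \<phi> ` U" if "t \<in> {0..1}" for t
  proof -
    have "?l t \<in> closed_segment x y" using that by (auto simp: in_segment algebra_simps intro!: exI[of _ t])
    then show ?thesis using seg by blast
  qed
  have cU: "c t \<in> U" "\<phi> (c t) = ?l t" if "t \<in> {0..1}" for t
    using inv_into_into[OF l[OF that]] f_inv_into_f[OF l[OF that]] by (simp_all add: c_def)
  have "continuous_map (top_of_set {0..1}) (top_of_set (\<phi> ` U)) ?l"
    using l by (auto simp: continuous_map_in_subtopology intro!: continuous_intros)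
  from continuous_map_compose[OF this chart_inverse_continuous[OF U]]
  have path: "pathin X c" by (simp add: pathin_def o_def c_def)
  have "C1_curve_on \<A> a b c" if ab: "0 \<le> a" "b \<le> 1" for a b
    unfolding C1_curve_on_def
  proof (intro ballI, clarify)
    fix V \<theta> assume V: "(V, \<theta>) \<in> \<A>"
    let ?T = "transition (U, \<phi>) (V, \<theta>)"
    let ?J = "{t \<in> {a..b}. c t \<in> V}"
    have lJ: "?l t \<in> \<phi> ` (U \<inter> V)" if "t \<in> ?J" for t
      using cU[of t] that ab by (metis (no_types, lifting) IntI atLeastAtMost_iff image_eqI mem_Collect_eq order_trans)
    \<comment> \<open>In another chart the curve is a transition map composed with an affine map,
      which gives its derivative there.\<close>
    have eq: "\<theta> \<circ> c = ?T \<circ> ?l" by (simp add: fun_eq_iff transition_def c_def)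
    show "\<exists>D. continuous_on ?J D \<and>
      (\<forall>t\<in>{a..b}. c t \<in> V \<longrightarrow> ((\<theta> \<circ> c) has_vector_derivative D t) (at t within {a..b}))"
    proof (intro exI conjI ballI impI)
      show "continuous_on ?J (\<lambda>t. frechet_derivative ?T (at (?l t)) (y - x))"
        by (rule continuous_on_compose2[OF smooth_on_imp_continuous_derivative[OF transition_smooth[OF U V]], where f = ?l])
          (use lJ in \<open>auto intro!: continuous_intros\<close>)
      fix t assume t: "t \<in> {a..b}" "c t \<in> V"
      have "(?l has_vector_derivative (y - x)) (at t within {a..b})"
        by (auto intro!: derivative_eq_intros)
      moreover have "(?T has_derivative frechet_derivative ?T (at (?l t))) (at (?l t))"
        by (rule smooth_on_imp_has_derivative[OF transition_smooth[OF U V] lJ]) (use t in simp)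
      from has_derivative_at_withinI[OF this]
      have "(?T has_derivative frechet_derivative ?T (at (?l t))) (at (?l t) within ?l ` {a..b})" .
      ultimately show "((\<theta> \<circ> c) has_vector_derivative frechet_derivative ?T (at (?l t)) (y - x)) (at t within {a..b})"
        unfolding eq by (rule vector_derivative_diff_chain_within)
    qed
  qed
  then show "piecewise_C1_curve X \<A> c"
    unfolding piecewise_C1_curve_def using path by blast
  fix t :: real assume t: "t \<in> {0<..<1}"
  have "(?l has_vector_derivative (y - x)) (at t)" by (auto intro!: derivative_eq_intros)
  then have "((\<phi> \<circ> c) has_vector_derivative (y - x)) (at t)"
    by (rule has_vector_derivative_transform_within_open[of _ _ _ "{0<..<1}"]) (use t cU(2) in auto)
  from curve_speed_chart[OF U path _ _ _ this]
  show "curve_speed \<A> g c t = sqrt (g (U, \<phi>) (?l t) (y - x) (y - x))"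
    using t cU[of t] by auto
qed

section \<open>The distance as an infimum of lengths\<close>

abbreviation "M \<equiv> topspace X"
abbreviation "dist_M \<equiv> riemannian_dist X \<A> g"

definition curve_between :: "(real \<Rightarrow> 'a) \<Rightarrow> 'a \<Rightarrow> 'a \<Rightarrow> bool" where
  "curve_between c p q \<longleftrightarrow> piecewise_C1_curve X \<A> c \<and> c 0 = p \<and> c 1 = q"

lemma curve_between_trans:
  assumes "curve_between c p q" "curve_between c' q r"
  obtains e where "curve_between e p r" "curve_length \<A> g e = curve_length \<A> g c + curve_length \<A> g c'"
  using concat_curves[of c c'] assms
  by (intro that[of "\<lambda>t. if t \<le> 1/2 then c (2 * t) else c' (2 * t - 1)"]) (auto simp: curve_between_def)

lemma curve_between_sym:
  assumes "curve_between c p q"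
  obtains e where "curve_between e q p" "curve_length \<A> g e = curve_length \<A> g c"
  using reverse_curve[of c] assms that[of "\<lambda>t. c (1 - t)"] by (auto simp: curve_between_def)

lemma curve_between_refl: "p \<in> M \<Longrightarrow> curve_between (\<lambda>_. p) p p"
  using const_curve(1) by (simp add: curve_between_def)

lemma locally_reachable:
  assumes "p \<in> M"
  shows "\<exists>W. openin X W \<and> p \<in> W \<and> (\<forall>q\<in>W. \<exists>c. curve_between c p q)"
proof -
  obtain U \<phi> where U: "(U, \<phi>) \<in> \<A>" "p \<in> U" using chart_at[OF assms] .
  obtain r where r: "r > 0" "ball (\<phi> p) r \<subseteq> \<phi> ` U"
    using chart_range_open[OF U(1)] U(2) open_contains_ball by blast
  have inv: "inv_into U \<phi> (\<phi> p) = p" using chart_inj[OF U(1)] U(2) by simp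
  show ?thesis
  proof (intro exI[of _ "inv_into U \<phi> ` ball (\<phi> p) r"] conjI ballI)
    show "openin X (inv_into U \<phi> ` ball (\<phi> p) r)" by (rule chart_preimage_open[OF U(1) open_ball r(2)])
    show "p \<in> inv_into U \<phi> ` ball (\<phi> p) r" using inv r(1) by (metis centre_in_ball imageI)
    fix q assume "q \<in> inv_into U \<phi> ` ball (\<phi> p) r"
    then obtain y where y: "y \<in> ball (\<phi> p) r" "q = inv_into U \<phi> y" by blast
    have "closed_segment (\<phi> p) y \<subseteq> ball (\<phi> p) r"
      using y r(1) by (intro closed_segment_subset convex_ball) auto
    then have "closed_segment (\<phi> p) y \<subseteq> \<phi> ` U" using r(2) by blast
    from segment_curve(1)[OF U(1) this] show "\<exists>c. curve_between c p q"
      using y inv by (intro exI) (auto simp: curve_between_def)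
  qed
qed

text \<open>The points reachable from p form an open set with open complement, since straight
  segments in charts reach a neighbourhood of every point. This keeps the infimum in the distance
  from being taken over the empty set.\<close>

lemma curve_exists:
  assumes "p \<in> M" "q \<in> M"
  shows "\<exists>c. curve_between c p q"
proof -
  define R where "R = {q \<in> M. \<exists>c. curve_between c p q}"
  have "openin X R"
  proof (subst openin_subopen, intro ballI)
    fix q assume "q \<in> R"
    then obtain c where q: "q \<in> M" "curve_between c p q" by (auto simp: R_def)
    obtain W where W: "openin X W" "q \<in> W" "\<And>r. r \<in> W \<Longrightarrow> \<exists>c. curve_between c q r"
      using locally_reachable[OF q(1)] by blast
    have "W \<subseteq> R"
    proof
      fix r assume r: "r \<in> W"
      then have "r \<in> M" using openin_subset[OF W(1)] by blast
      moreover obtain c' where "curve_between c' q r" using W(3)[OF r] by blast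
      then obtain e where "curve_between e p r" by (rule curve_between_trans[OF q(2)])
      ultimately show "r \<in> R" by (auto simp: R_def)
    qed
    then show "\<exists>T. openin X T \<and> q \<in> T \<and> T \<subseteq> R" using W by blast
  qed
  moreover have "openin X (M - R)"
  proof (subst openin_subopen, intro ballI)
    fix q assume q: "q \<in> M - R"
    obtain W where W: "openin X W" "q \<in> W" "\<And>r. r \<in> W \<Longrightarrow> \<exists>c. curve_between c q r"
      using locally_reachable[of q] q by blast
    have "W \<subseteq> M - R"
    proof
      fix r assume r: "r \<in> W"
      then have "r \<in> M" using openin_subset[OF W(1)] by blast
      moreover have "r \<notin> R"
      proof
        assume "r \<in> R"
        then obtain c where c: "curve_between c p r" by (auto simp: R_def)
        obtain c' where "curve_between c' q r" using W(3)[OF r] by blast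
        then obtain c'' where "curve_between c'' r q" by (rule curve_between_sym)
        then obtain e where "curve_between e p q" by (rule curve_between_trans[OF c])
        then show False using q by (auto simp: R_def)
      qed
      ultimately show "r \<in> M - R" by blast
    qed
    then show "\<exists>T. openin X T \<and> q \<in> T \<and> T \<subseteq> M - R" using W by blast
  qed
  moreover have "R \<subseteq> M" by (auto simp: R_def)
  ultimately have "R = {} \<or> R = M"
    using connected unfolding connected_space_clopen_in closedin_def by blast
  moreover have "p \<in> R" using assms(1) curve_between_refl by (auto simp: R_def)
  ultimately show ?thesis using assms(2) by (auto simp: R_def)
qed

lemma dist_M_eq: "dist_M p q = Inf {curve_length \<A> g c | c. curve_between c p q}"
  by (simp add: riemannian_dist_def curve_between_def)

lemma dist_M_le: "curve_between c p q \<Longrightarrow> dist_M p q \<le> curve_length \<A> g c"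
  unfolding dist_M_eq
  by (rule cInf_lower) (auto simp: curve_between_def intro!: bdd_belowI[of _ 0] curve_length_nonneg)

lemma dist_M_ge:
  assumes "p \<in> M" "q \<in> M" "\<And>c. curve_between c p q \<Longrightarrow> B \<le> curve_length \<A> g c"
  shows "B \<le> dist_M p q"
  unfolding dist_M_eq using curve_exists[OF assms(1,2)] assms(3) by (intro cInf_greatest) auto

lemma dist_M_nonneg: "p \<in> M \<Longrightarrow> q \<in> M \<Longrightarrow> 0 \<le> dist_M p q"
  by (rule dist_M_ge) (auto simp: curve_between_def curve_length_nonneg)

lemma dist_M_refl: "p \<in> M \<Longrightarrow> dist_M p p = 0"
  using dist_M_le[OF curve_between_refl[of p]] const_curve(2)[of p] dist_M_nonneg[of p p] by simp

lemma dist_M_sym: "p \<in> M \<Longrightarrow> q \<in> M \<Longrightarrow> dist_M p q = dist_M q p"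
proof (rule antisym)
  show "dist_M p q \<le> dist_M q p" if "p \<in> M" "q \<in> M" for p q
    by (rule dist_M_ge[OF that(2,1)]) (metis curve_between_sym dist_M_le)
  then show "p \<in> M \<Longrightarrow> q \<in> M \<Longrightarrow> dist_M q p \<le> dist_M p q" .
qed

lemma dist_M_triangle:
  assumes "p \<in> M" "q \<in> M" "r \<in> M"
  shows "dist_M p r \<le> dist_M p q + dist_M q r"
proof -
  have "dist_M p r - dist_M p q \<le> dist_M q r"
  proof (rule dist_M_ge[OF assms(2,3)])
    fix c' assume c': "curve_between c' q r"
    have "dist_M p r - curve_length \<A> g c' \<le> dist_M p q"
    proof (rule dist_M_ge[OF assms(1,2)])
      fix c assume "curve_between c p q"
      then obtain e where "curve_between e p r" "curve_length \<A> g e = curve_length \<A> g c + curve_length \<A> g c'"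
        using curve_between_trans c' by metis
      then show "dist_M p r - curve_length \<A> g c' \<le> curve_length \<A> g c" using dist_M_le[of e p r] by simp
    qed
    then show "dist_M p r - dist_M p q \<le> curve_length \<A> g c'" by simp
  qed
  then show ?thesis by simp
qed

section \<open>Charts and the conclusion\<close>

lemma curve_continuous_in_chart:
  assumes U: "(U, \<phi>) \<in> \<A>" and c: "pathin X c" and T: "T \<le> 1" "\<And>t. t \<in> {0..T} \<Longrightarrow> c t \<in> U"
  shows "continuous_on {0..T} (\<phi> \<circ> c)"
proof -
  have "continuous_map (top_of_set {0..T}) X c"
    by (rule continuous_map_from_subtopology_mono[OF c[unfolded pathin_def]]) (use T in auto)
  then have "continuous_map (top_of_set {0..T}) (subtopology X U) c"
    using T(2) by (auto simp: continuous_map_in_subtopology)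
  from continuous_map_compose[OF this chart_continuous[OF U]]
  show ?thesis by simp
qed

text \<open>A calibration argument: a linear functional dominated by the Riemannian norm along the
  curve, integrated over the velocity, is at most the length; by the fundamental theorem of calculus
  this integral depends on the end points only. All lower bounds for lengths in a chart rest on
  it.\<close>

lemma curve_length_lower_bound:
  assumes U: "(U, \<phi>) \<in> \<A>" and c: "piecewise_C1_curve X \<A> c" and T: "0 \<le> T" "T \<le> 1"
    and inU: "\<And>t. t \<in> {0..T} \<Longrightarrow> c t \<in> U"
    and l: "linear l" "\<And>t v. t \<in> {0..T} \<Longrightarrow> l v \<le> sqrt (g (U, \<phi>) (\<phi> (c t)) v v)"
  shows "l (\<phi> (c T) - \<phi> (c 0)) \<le> curve_length \<A> g c"
proof -
  obtain S where S: "pathin X c" "breaks c S" using c unfolding piecewise_C1_curve_iff by blast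
  have finS: "finite S" using S(2) by (simp add: breaks_def)
  have bl: "bounded_linear l" using l(1) by (simp add: linear_conv_bounded_linear)
  define f' where "f' t = l (vector_derivative (\<phi> \<circ> c) (at t))" for t
  define N where "N = S \<union> {0, T}"
  have der: "((\<phi> \<circ> c) has_vector_derivative vector_derivative (\<phi> \<circ> c) (at t)) (at t)"
    if t: "t \<in> {0<..<T} - S" for t
  proof -
    obtain D where "((\<phi> \<circ> c) has_vector_derivative D) (at t)"
      by (rule differentiable_off_breaks[OF S(2) _ _ _ U inU]) (use t T in auto)
    then show ?thesis by (simp add: vector_derivative_at)
  qed
  have "(f' has_integral (l \<circ> (\<phi> \<circ> c)) T - (l \<circ> (\<phi> \<circ> c)) 0) {0..T}"
  proof (rule fundamental_theorem_of_calculus_interior_strong[OF finS T(1)])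
    show "((l \<circ> (\<phi> \<circ> c)) has_vector_derivative f' t) (at t)" if "t \<in> {0<..<T} - S" for t
      unfolding f'_def comp_def[of l]
      by (rule bounded_linear.has_vector_derivative[OF bl der[OF that]])
    show "continuous_on {0..T} (l \<circ> (\<phi> \<circ> c))"
      by (intro continuous_on_compose curve_continuous_in_chart[OF U S(1) T(2) inU] linear_continuous_on bl)
  qed
  then have f': "(f' has_integral l (\<phi> (c T) - \<phi> (c 0))) {0..T}"
    by (simp add: linear_diff[OF l(1)])
  have finN: "finite N" using finS by (simp add: N_def)
  \<comment> \<open>At points of N the velocity is not under control, but the speed is nonnegative
    there; the value 0 makes the comparison hold pointwise.\<close>
  have int: "((\<lambda>t. if t \<in> N then 0 else f' t) has_integral l (\<phi> (c T) - \<phi> (c 0))) {0..T}"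
    by (rule has_integral_spike_finite[OF finN _ f']) auto
  have "l (\<phi> (c T) - \<phi> (c 0)) \<le> integral {0..T} (curve_speed \<A> g c)"
  proof (rule has_integral_le[OF int integrable_integral[OF speed_integrable[OF c order_refl T]]])
    fix t assume t: "t \<in> {0..T}"
    show "(if t \<in> N then 0 else f' t) \<le> curve_speed \<A> g c t"
    proof (cases "t \<in> N")
      case False
      then have t': "t \<in> {0<..<T} - S" using t by (auto simp: N_def)
      have "curve_speed \<A> g c t =
        sqrt (g (U, \<phi>) (\<phi> (c t)) (vector_derivative (\<phi> \<circ> c) (at t)) (vector_derivative (\<phi> \<circ> c) (at t)))"
        by (rule curve_speed_chart[OF U S(1) _ _ inU der[OF t']]) (use t' T in auto)
      then show ?thesis using l(2)[OF t] False by (simp add: f'_def)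
    qed (use speed_nonneg[OF c] t T in simp)
  qed
  also have "\<dots> \<le> curve_length \<A> g c"
    unfolding curve_length_def
    by (rule integral_subset_le) (use T speed_integrable[OF c] speed_nonneg[OF c] in auto)
  finally show ?thesis .
qed

lemma curve_length_le:
  assumes c: "piecewise_C1_curve X \<A> c" and B: "\<And>t. t \<in> {0<..<1} \<Longrightarrow> curve_speed \<A> g c t \<le> B" "B \<ge> 0"
  shows "curve_length \<A> g c \<le> B"
proof -
  let ?f = "\<lambda>t. if t \<in> {0, 1} then 0 else curve_speed \<A> g c t"
  have int: "(curve_speed \<A> g c has_integral curve_length \<A> g c) {0..1}"
    unfolding curve_length_def by (intro integrable_integral speed_integrable[OF c]) auto
  have "(?f has_integral curve_length \<A> g c) {0..1}"
    by (rule has_integral_spike_finite[OF _ _ int, of "{0, 1}"]) auto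
  moreover have "((\<lambda>t. B) has_integral B) {0..1::real}"
    using has_integral_const_real[of B 0 1] by simp
  ultimately show ?thesis
    by (rule has_integral_le) (use B in auto)
qed

section \<open>Estimates for the distance in a chart\<close>

lemma mem_inv_image_iff:
  assumes U: "(U, \<phi>) \<in> \<A>" and B: "B \<subseteq> \<phi> ` U"
  shows "q \<in> inv_into U \<phi> ` B \<longleftrightarrow> q \<in> U \<and> \<phi> q \<in> B"
proof
  assume "q \<in> inv_into U \<phi> ` B"
  then obtain y where "y \<in> B" "q = inv_into U \<phi> y" by blast
  then show "q \<in> U \<and> \<phi> q \<in> B" using B inv_into_into[of y \<phi> U] f_inv_into_f[of y \<phi> U] by auto
next
  assume "q \<in> U \<and> \<phi> q \<in> B"
  then show "q \<in> inv_into U \<phi> ` B" using chart_inj[OF U] by (intro image_eqI[of _ _ "\<phi> q"]) auto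
qed

text \<open>Let T be the first time outside the open ball. Before T the curve is in the closed ball,
  which is compact and hence closed in X by the Hausdorff property, so the curve is in it at T too
  and lies on the sphere. In a space that is not Hausdorff, a curve could leave the chart without
  meeting the sphere.\<close>

lemma curve_exits_ball:
  assumes U: "(U, \<phi>) \<in> \<A>" and c: "pathin X c" and c0: "c 0 \<in> U" "\<phi> (c 0) = x"
    and \<rho>: "\<rho> > 0" "cball x \<rho> \<subseteq> \<phi> ` U"
  obtains "\<And>t. t \<in> {0..1} \<Longrightarrow> c t \<in> U \<and> \<phi> (c t) \<in> cball x \<rho>" "\<phi> (c 1) \<in> ball x \<rho>"
  | T where "T \<in> {0..1}" "\<And>t. t \<in> {0..T} \<Longrightarrow> c t \<in> U \<and> \<phi> (c t) \<in> cball x \<rho>" "norm (\<phi> (c T) - x) = \<rho>"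
proof -
  have bsub: "ball x \<rho> \<subseteq> \<phi> ` U" using \<rho>(2) by auto
  define W where "W = inv_into U \<phi> ` ball x \<rho>"
  define Q where "Q = inv_into U \<phi> ` cball x \<rho>"
  have W: "q \<in> W \<longleftrightarrow> q \<in> U \<and> \<phi> q \<in> ball x \<rho>" for q unfolding W_def by (rule mem_inv_image_iff[OF U bsub])
  have Q: "q \<in> Q \<longleftrightarrow> q \<in> U \<and> \<phi> q \<in> cball x \<rho>" for q unfolding Q_def by (rule mem_inv_image_iff[OF U \<rho>(2)])
  have WQ: "W \<subseteq> Q" unfolding W_def Q_def by (intro image_mono) auto
  have openW: "openin X W" unfolding W_def by (rule chart_preimage_open[OF U open_ball bsub])
  have "compactin (top_of_set (\<phi> ` U)) (cball x \<rho>)" using \<rho>(2) by (simp add: compactin_subtopology)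
  then have "compactin X Q" unfolding Q_def by (rule image_compactin[OF _ chart_inverse_continuous[OF U]])
  then have closedQ: "closedin X Q" by (rule compactin_imp_closedin[OF Hausdorff])
  define B where "B = {t \<in> {0..1}. c t \<notin> W}"
  have cM: "c t \<in> M" if "t \<in> {0..1}" for t using path_image_subset_topspace[OF c] that by auto
  have "closedin (top_of_set {0..1}) {t \<in> topspace (top_of_set {0..1}). c t \<in> M - W}"
    using openW c unfolding pathin_def by (intro closedin_continuous_map_preimage) auto
  moreover have "{t \<in> topspace (top_of_set {0..1}). c t \<in> M - W} = B"
    using cM by (auto simp: B_def)
  ultimately have closedB: "closed B" using closedin_closed_trans[of "{0..1}" B] by simp
  show ?thesis
  proof (cases "B = {}")
    case True
    then have "c t \<in> W" if "t \<in> {0..1}" for t using that by (auto simp: B_def)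
    then have "c t \<in> U \<and> \<phi> (c t) \<in> ball x \<rho>" if "t \<in> {0..1}" for t using W that by blast
    then show ?thesis using that(1) by (simp add: less_imp_le)
  next
    case False
    define T where "T = Inf B"
    have bdd: "bdd_below B" by (rule bdd_belowI[of _ 0]) (simp add: B_def)
    have TB: "T \<in> B" unfolding T_def by (rule closed_contains_Inf[OF False bdd closedB])
    then have T01: "T \<in> {0..1}" and cT: "c T \<notin> W" by (auto simp: B_def)
    have before: "c t \<in> W" if "t \<in> {0..<T}" for t
      using cInf_lower[OF _ bdd, of t] that T01 by (force simp: B_def T_def)
    have "c 0 \<in> W" using W c0 \<rho>(1) by simp
    then have T0: "T > 0" using cT T01 by (cases "T = 0") auto
    have "closedin (top_of_set {0..1}) {t \<in> topspace (top_of_set {0..1}). c t \<in> Q}"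
      using closedQ c unfolding pathin_def by (intro closedin_continuous_map_preimage) auto
    from closedin_closed_trans[OF this] have "closed {t \<in> {0..1}. c t \<in> Q}" by simp
    moreover have "{0..<T} \<subseteq> {t \<in> {0..1}. c t \<in> Q}" using before WQ T01 by auto
    ultimately have "closure {0..<T} \<subseteq> {t \<in> {0..1}. c t \<in> Q}" by (simp add: closure_minimal)
    then have inQ: "c t \<in> Q" if "t \<in> {0..T}" for t using T0 that by (auto simp: closure_atLeastLessThan)
    have "norm (\<phi> (c T) - x) = \<rho>"
      using inQ[of T] T0 cT W Q by (auto simp: dist_norm norm_minus_commute)
    then show ?thesis using that(2)[OF T01] inQ Q by blast
  qed
qed

text \<open>The squared distance is compared with the form at a base point up to a cubic error:
  straight segments give the upper bound, and calibration by a covector at the base point gives the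
  lower one.\<close>

lemma local_chart:
  assumes p: "p \<in> M" and met: "metric_on M dist_M"
  shows "\<exists>(\<psi> :: 'e \<Rightarrow> 'a) x0 R r0 K G DG. local_metric M dist_M \<psi> x0 R r0 K G DG \<and> \<psi> x0 = p"
proof -
  obtain U \<phi> where U: "(U, \<phi>) \<in> \<A>" "p \<in> U" using chart_at[OF p] .
  define x0 where "x0 = \<phi> p"
  define \<psi> where "\<psi> = inv_into U \<phi>"
  define G where "G = g (U, \<phi>)"
  have "x0 \<in> \<phi> ` U" using U(2) by (simp add: x0_def)
  then obtain R1 where R1: "R1 > 0" "cball x0 R1 \<subseteq> \<phi> ` U"
    using chart_range_open[OF U(1)] open_contains_cball by blast
  obtain k DG where k: "k \<ge> 1" and bounds:
    "(\<forall>x\<in>cball x0 R1. \<forall>v. (norm v)\<^sup>2 \<le> k * G x v v) \<and>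
     (\<forall>x\<in>cball x0 R1. \<forall>v w. \<bar>G x v w\<bar> \<le> k * norm v * norm w) \<and>
     (\<forall>x\<in>cball x0 R1. \<forall>y\<in>cball x0 R1. \<forall>v w. \<bar>G y v w - G x v w\<bar> \<le> k * norm (y - x) * norm v * norm w) \<and>
     (\<forall>x\<in>cball x0 R1. \<forall>v. linear (\<lambda>w. DG x w v)) \<and>
     (\<forall>x\<in>cball x0 R1. \<forall>w v. \<bar>DG x w v\<bar> \<le> k * norm w * (norm v)\<^sup>2) \<and>
     (\<forall>x\<in>cball x0 R1. \<forall>y\<in>cball x0 R1. \<forall>v.
       \<bar>G y v v - G x v v - DG x (y - x) v\<bar> \<le> k * (norm (y - x))\<^sup>2 * (norm v)\<^sup>2)"
    using metric_field_bounds[OF metric_bilinear[OF U(1)] metric_positive[OF U(1)] metric_smooth[OF U(1)]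
        compact_cball R1(2) convex_cball, folded G_def]
    by blast
  have lower: "(norm v)\<^sup>2 \<le> k * G x v v"
    and upper: "\<bar>G x v w\<bar> \<le> k * norm v * norm w"
    and DG_lin: "linear (\<lambda>w. DG x w v)"
    and DG_bound: "\<bar>DG x w v\<bar> \<le> k * norm w * (norm v)\<^sup>2"
    if "x \<in> cball x0 R1" for x v w
    using bounds that by blast+
  have lip: "\<bar>G y v w - G x v w\<bar> \<le> k * norm (y - x) * norm v * norm w"
    and taylor: "\<bar>G y v v - G x v v - DG x (y - x) v\<bar> \<le> k * (norm (y - x))\<^sup>2 * (norm v)\<^sup>2"
    if "x \<in> cball x0 R1" "y \<in> cball x0 R1" for x y v w
    using bounds that by blast+
  have k_pow: "k \<le> k ^ n" if "n \<ge> 1" for n using power_increasing[OF that, of k] k by simp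
  \<comment> \<open>For x, y in the ball of radius R, the ball around x of radius k^2 |y - x| \<le>
    2 k^2 R must lie in the ball of radius R1, where the bounds hold; R + 2 k^2 R \<le> 4 k^2 R =
    R1.\<close>
  define R where "R = R1 / (4 * k\<^sup>2)"
  have k2: "k\<^sup>2 \<ge> 1" using k by (simp add: one_le_power)
  have R: "R > 0" using R1 k by (simp add: R_def)
  have R_R1: "4 * k\<^sup>2 * R = R1" using k by (simp add: R_def)
  have "4 * R \<le> 4 * k\<^sup>2 * R" using k2 R by (intro mult_right_mono) auto
  then have R4: "4 * R \<le> R1" using R_R1 by simp
  have bR: "x \<in> cball x0 R1" if "x \<in> ball x0 R" for x using that R4 R by simp
  have bU: "x \<in> \<phi> ` U" if "x \<in> cball x0 R1" for x using that R1(2) by blast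
  have psi: "\<psi> x \<in> U" "\<phi> (\<psi> x) = x" if "x \<in> cball x0 R1" for x
    using inv_into_into[OF bU[OF that]] f_inv_into_f[OF bU[OF that]] by (simp_all add: \<psi>_def)
  have psiM: "\<psi> x \<in> M" if "x \<in> cball x0 R1" for x using psi(1)[OF that] chart_subset[OF U(1)] by blast
  have psi_x0: "\<psi> x0 = p" using chart_inj[OF U(1)] U(2) by (simp add: \<psi>_def x0_def)
  note G_bil = metric_bilinear[OF U(1) bU, folded G_def]
  note G_pos = metric_positive[OF U(1) bU, folded G_def]
  note G_sym = metric_symmetric[OF U(1) bU, folded G_def]
  \<comment> \<open>Calibration with the constant covector u / (k |u|), which is dominated by the
    metric on the whole ball of radius R1.\<close>
  have crude: "norm (\<phi> (c T) - \<phi> (c 0)) \<le> k * curve_length \<A> g c"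
    if c: "piecewise_C1_curve X \<A> c" and T: "T \<in> {0..1}"
      and in_ball: "\<And>t. t \<in> {0..T} \<Longrightarrow> c t \<in> U \<and> \<phi> (c t) \<in> cball x0 R1" for c T
  proof -
    define u where "u = \<phi> (c T) - \<phi> (c 0)"
    define l where "l v = (v \<bullet> (u /\<^sub>R norm u)) / k" for v
    have "l (\<phi> (c T) - \<phi> (c 0)) \<le> curve_length \<A> g c"
    proof (rule curve_length_lower_bound[OF U(1) c])
      show "linear l" unfolding l_def by (rule linearI) (simp_all add: inner_add_left add_divide_distrib distrib_left)
      fix t v assume t: "t \<in> {0..T}"
      have "l v \<le> norm v / k"
        unfolding l_def using k norm_cauchy_schwarz[of v "u /\<^sub>R norm u"]
        by (intro divide_right_mono) (cases "u = 0"; simp)+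
      also have "\<dots> \<le> sqrt (G (\<phi> (c t)) v v)"
      proof (rule real_le_rsqrt)
        have "(norm v / k)\<^sup>2 \<le> (norm v)\<^sup>2 / k"
          using k k_pow[of 2] by (simp add: power_divide frac_le)
        also have "\<dots> \<le> G (\<phi> (c t)) v v"
          using lower[of "\<phi> (c t)" v] in_ball[OF t] k by (simp add: pos_divide_le_eq mult.commute)
        finally show "(norm v / k)\<^sup>2 \<le> G (\<phi> (c t)) v v" .
      qed
      finally show "l v \<le> sqrt (g (U, \<phi>) (\<phi> (c t)) v v)" unfolding G_def .
    qed (use T in_ball in auto)
    moreover have "l u = norm u / k"
      unfolding l_def by (cases "u = 0") (simp_all add: dot_square_norm power2_eq_square)
    ultimately show ?thesis using k unfolding u_def[symmetric] by (simp add: pos_divide_le_eq mult.commute)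
  qed
  \<comment> \<open>This dichotomy disposes of curves that leave the chart and have no coordinates
    there: they are long.\<close>
  have curve_cases: "(\<forall>t\<in>{0..1}. c t \<in> U \<and> \<phi> (c t) \<in> cball x \<rho>) \<and> c 1 \<in> \<psi> ` ball x \<rho> \<or> \<rho> \<le> k * curve_length \<A> g c"
    if x: "x \<in> ball x0 R" and \<rho>: "0 < \<rho>" "R + \<rho> \<le> R1" and c: "curve_between c (\<psi> x) q" for x \<rho> c q
  proof -
    have sub: "cball x \<rho> \<subseteq> cball x0 R1"
    proof
      fix y assume "y \<in> cball x \<rho>"
      then show "y \<in> cball x0 R1" using dist_triangle[of x0 y x] x \<rho> by simp
    qed
    have c': "piecewise_C1_curve X \<A> c" "pathin X c" "c 0 = \<psi> x"
      using c by (auto simp: curve_between_def piecewise_C1_curve_def)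
    have c0: "c 0 \<in> U" "\<phi> (c 0) = x" using psi[OF bR[OF x]] c'(3) by simp_all
    show ?thesis
    proof (rule curve_exits_ball[OF U(1) c'(2) c0 \<rho>(1) order_trans[OF sub R1(2)]])
      assume stay: "\<And>t. t \<in> {0..1} \<Longrightarrow> c t \<in> U \<and> \<phi> (c t) \<in> cball x \<rho>" and c1: "\<phi> (c 1) \<in> ball x \<rho>"
      have "c 1 = \<psi> (\<phi> (c 1))" using stay[of 1] chart_inj[OF U(1)] by (simp add: \<psi>_def)
      then show ?thesis using stay c1 by blast
    next
      fix T assume T: "T \<in> {0..1}" "\<And>t. t \<in> {0..T} \<Longrightarrow> c t \<in> U \<and> \<phi> (c t) \<in> cball x \<rho>"
        "norm (\<phi> (c T) - x) = \<rho>"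
      then show ?thesis using crude[OF c'(1) T(1)] sub c0(2) by blast
    qed
  qed
  \<comment> \<open>The straight segment is a competitor. Along it the form differs from the one at
    x by at most k s times s^2, which is the cubic error.\<close>
  have d_upper: "(dist_M (\<psi> x) (\<psi> y))\<^sup>2 \<le> G x (y - x) (y - x) + k * norm (y - x) ^ 3"
    if xy: "x \<in> ball x0 R" "y \<in> ball x0 R" for x y
  proof -
    define s where "s = norm (y - x)"
    define Q where "Q = G x (y - x) (y - x) + k * s ^ 3"
    have seg: "closed_segment x y \<subseteq> cball x0 R1"
      using bR[OF xy(1)] bR[OF xy(2)] by (intro closed_segment_subset convex_cball)
    then have segU: "closed_segment x y \<subseteq> \<phi> ` U" using R1(2) by blast
    define c where "c = (\<lambda>t. \<psi> (x + t *\<^sub>R (y - x)))"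
    note sc = segment_curve[OF U(1) segU, folded \<psi>_def, folded c_def, folded G_def]
    have Q0: "Q \<ge> 0"
      using lower[OF bR[OF xy(1)], of "y - x"] k unfolding Q_def s_def
      by (intro add_nonneg_nonneg) (auto simp: zero_le_mult_iff dest: order_trans[OF zero_le_power2])
    have speed: "curve_speed \<A> g c t \<le> sqrt Q" if t: "t \<in> {0<..<1}" for t
    proof -
      let ?z = "x + t *\<^sub>R (y - x)"
      have "?z \<in> closed_segment x y" using t by (auto simp: in_segment algebra_simps intro!: exI[of _ t])
      then have z: "?z \<in> cball x0 R1" using seg by blast
      have "G ?z (y - x) (y - x) - G x (y - x) (y - x) \<le> k * norm (?z - x) * s * s"
        using lip[OF bR[OF xy(1)] z, of "y - x" "y - x"] by (simp add: s_def)
      also have "\<dots> \<le> k * s * s * s"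
        using t k by (intro mult_right_mono mult_left_mono) (auto simp: s_def intro!: mult_left_le_one_le)
      finally have "G ?z (y - x) (y - x) \<le> Q" by (simp add: Q_def power3_eq_cube mult.assoc)
      then show ?thesis using sc(2)[OF t] by simp
    qed
    have "dist_M (\<psi> x) (\<psi> y) \<le> curve_length \<A> g c"
      by (rule dist_M_le) (use sc(1) in \<open>simp add: curve_between_def c_def\<close>)
    also have "\<dots> \<le> sqrt Q" by (rule curve_length_le[OF sc(1) speed]) (use Q0 in simp_all)
    finally have "(dist_M (\<psi> x) (\<psi> y))\<^sup>2 \<le> (sqrt Q)\<^sup>2"
      using dist_M_nonneg[OF psiM[OF bR[OF xy(1)]] psiM[OF bR[OF xy(2)]]] by (rule power_mono)
    then show ?thesis using Q0 by (simp add: Q_def s_def)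
  qed
  have rho: "R + k\<^sup>2 * norm (y - x) \<le> R1" if "x \<in> ball x0 R" "y \<in> ball x0 R" for x y
  proof -
    have "norm (y - x) = dist y x" by (simp add: dist_norm)
    also have "\<dots> \<le> dist x0 y + dist x0 x" by (rule dist_triangle3)
    finally have "norm (y - x) \<le> 2 * R" using that by simp
    then have "k\<^sup>2 * norm (y - x) \<le> k\<^sup>2 * (2 * R)" using k2 by (intro mult_left_mono) auto
    moreover have "R \<le> k\<^sup>2 * R" using k2 R by simp
    moreover have "k\<^sup>2 * R \<ge> 0" using R by simp
    ultimately show ?thesis using R_R1 by linarith
  qed
  have d_comp: "norm (y - x) \<le> k * dist_M (\<psi> x) (\<psi> y)" if xy: "x \<in> ball x0 R" "y \<in> ball x0 R" for x y
  proof (cases "x = y")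
    case False
    define s where "s = norm (y - x)"
    have s: "s > 0" using False by (simp add: s_def)
    have "s / k \<le> dist_M (\<psi> x) (\<psi> y)"
    proof (rule dist_M_ge[OF psiM[OF bR[OF xy(1)]] psiM[OF bR[OF xy(2)]]])
      fix c assume c: "curve_between c (\<psi> x) (\<psi> y)"
      have "s \<le> k * curve_length \<A> g c"
      proof -
        have "(\<forall>t\<in>{0..1}. c t \<in> U \<and> \<phi> (c t) \<in> cball x (k\<^sup>2 * s)) \<and> c 1 \<in> \<psi> ` ball x (k\<^sup>2 * s)
            \<or> k\<^sup>2 * s \<le> k * curve_length \<A> g c"
          by (rule curve_cases[OF xy(1) _ _ c]) (use s k rho[OF xy] in \<open>auto simp: s_def\<close>)
        then show ?thesis
        proof
          assume stay: "(\<forall>t\<in>{0..1}. c t \<in> U \<and> \<phi> (c t) \<in> cball x (k\<^sup>2 * s)) \<and> c 1 \<in> \<psi> ` ball x (k\<^sup>2 * s)"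
          have "norm (\<phi> (c 1) - \<phi> (c 0)) \<le> k * curve_length \<A> g c"
          proof (rule crude[of c 1])
            fix t :: real assume "t \<in> {0..1}"
            then have t: "c t \<in> U" "\<phi> (c t) \<in> cball x (k\<^sup>2 * s)" using stay by auto
            have "dist x0 (\<phi> (c t)) \<le> dist x0 x + dist x (\<phi> (c t))" by (rule dist_triangle)
            then show "c t \<in> U \<and> \<phi> (c t) \<in> cball x0 R1"
              using t xy(1) rho[OF xy] by (simp add: s_def)
          qed (use c in \<open>auto simp: curve_between_def\<close>)
          then show ?thesis
            using c psi[OF bR[OF xy(1)]] psi[OF bR[OF xy(2)]] by (simp add: curve_between_def s_def)
        next
          assume "k\<^sup>2 * s \<le> k * curve_length \<A> g c"
          moreover have "1 * s \<le> k\<^sup>2 * s" using k2 s by (intro mult_right_mono) auto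
          ultimately show ?thesis by simp
        qed
      qed
      then show "s / k \<le> curve_length \<A> g c" using k by (simp add: pos_divide_le_eq mult.commute)
    qed
    then show ?thesis using k by (simp add: pos_divide_le_eq mult.commute s_def)
  qed (use k dist_M_nonneg[OF psiM psiM] bR xy in simp)
  have d_lower: "G x (y - x) (y - x) \<le> (dist_M (\<psi> x) (\<psi> y))\<^sup>2 + k ^ 5 * norm (y - x) ^ 3"
    if xy: "x \<in> ball x0 R" "y \<in> ball x0 R" for x y
  proof (cases "x = y")
    case True
    then show ?thesis using bilinear_lzero[OF G_bil[OF bR[OF xy(1)]]] k by simp
  next
    case False
    define s where "s = norm (y - x)"
    define q where "q = G x (y - x) (y - x)"
    \<comment> \<open>For z within k^2 s of x the form at z is at least a times the form at x: the
      Lipschitz bound loses k^3 s |v|^2, and |v|^2 is at most k times the form at x.\<close>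
    define a where "a = 1 - k ^ 4 * s"
    have s: "s > 0" using False by (simp add: s_def)
    have q: "q > 0" unfolding q_def using False by (intro G_pos[OF bR[OF xy(1)]]) auto
    have q_le: "q \<le> k * s\<^sup>2"
      using upper[OF bR[OF xy(1)], of "y - x" "y - x"] by (simp add: q_def s_def power2_eq_square mult.assoc)
    have main: "a * q \<le> (dist_M (\<psi> x) (\<psi> y))\<^sup>2"
    proof (cases "a \<le> 0")
      case True
      then have "a * q \<le> 0" using q by (simp add: mult_nonpos_nonneg)
      then show ?thesis by (rule order_trans) simp
    next
      case a: False
      then have a1: "0 < a" "a \<le> 1" using s k by (auto simp: a_def)
      have "sqrt (a * q) \<le> dist_M (\<psi> x) (\<psi> y)"
      proof (rule dist_M_ge[OF psiM[OF bR[OF xy(1)]] psiM[OF bR[OF xy(2)]]])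
        fix c assume c: "curve_between c (\<psi> x) (\<psi> y)"
        have "(\<forall>t\<in>{0..1}. c t \<in> U \<and> \<phi> (c t) \<in> cball x (k\<^sup>2 * s)) \<and> c 1 \<in> \<psi> ` ball x (k\<^sup>2 * s)
            \<or> k\<^sup>2 * s \<le> k * curve_length \<A> g c"
          by (rule curve_cases[OF xy(1) _ _ c]) (use s k rho[OF xy] in \<open>auto simp: s_def\<close>)
        then show "sqrt (a * q) \<le> curve_length \<A> g c"
        proof
          assume "k\<^sup>2 * s \<le> k * curve_length \<A> g c"
          \<comment> \<open>The radius \<open>k\<^sup>2 * s\<close> is chosen for curves that leave
            the ball: their length is at least k s, and so is k s compared with
            \<open>sqrt (a * q)\<close>.\<close>
          then have "k * s \<le> curve_length \<A> g c" using k by (simp add: power2_eq_square)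
          moreover have "sqrt (a * q) \<le> k * s"
          proof (rule real_le_lsqrt)
            have "a * q \<le> 1 * q" using a1 q by (intro mult_right_mono) auto
            also have "\<dots> \<le> k * s\<^sup>2" using q_le by simp
            also have "\<dots> \<le> k\<^sup>2 * s\<^sup>2" using k_pow[of 2] by (intro mult_right_mono) auto
            finally show "a * q \<le> (k * s)\<^sup>2" by (simp add: power_mult_distrib)
          qed (use k s in auto)
          ultimately show ?thesis by simp
        next
          assume stay: "(\<forall>t\<in>{0..1}. c t \<in> U \<and> \<phi> (c t) \<in> cball x (k\<^sup>2 * s)) \<and> c 1 \<in> \<psi> ` ball x (k\<^sup>2 * s)"
          \<comment> \<open>The normalised covector at x dual to y - x. By Cauchy-Schwarz it is
            dominated by the norm at x, and with the factor \<open>sqrt a\<close> by the norm at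
            every z in the ball of radius k^2 s.\<close>
          define l where "l v = sqrt a * (G x v (y - x) / sqrt q)" for v
          have "l (\<phi> (c 1) - \<phi> (c 0)) \<le> curve_length \<A> g c"
          proof (rule curve_length_lower_bound[OF U(1)])
            note b = G_bil[OF bR[OF xy(1)]]
            show "linear l" unfolding l_def
              by (rule linearI) (simp_all add: bilinear_ladd[OF b] bilinear_lmul[OF b] add_divide_distrib distrib_left)
            fix t :: real and v assume "t \<in> {0..1}"
            then have t: "c t \<in> U" "\<phi> (c t) \<in> cball x (k\<^sup>2 * s)" using stay by auto
            define z where "z = \<phi> (c t)"
            have "dist x0 z \<le> dist x0 x + dist x z" by (rule dist_triangle)
            then have z: "z \<in> cball x0 R1" using t xy(1) rho[OF xy] by (simp add: s_def z_def)
            have zx: "norm (z - x) \<le> k\<^sup>2 * s" using t(2) by (simp add: z_def dist_norm norm_minus_commute)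
            have "G x v v - G z v v \<le> k * norm (z - x) * norm v * norm v"
              using lip[OF bR[OF xy(1)] z, of v v] by simp
            also have "\<dots> \<le> k * (k\<^sup>2 * s) * norm v * norm v"
              using zx k by (intro mult_right_mono mult_left_mono) auto
            also have "\<dots> = k ^ 3 * s * (norm v)\<^sup>2" by (simp add: power_numeral_reduce)
            also have "\<dots> \<le> k ^ 3 * s * (k * G x v v)"
              using lower[OF bR[OF xy(1)], of v] k s by (intro mult_left_mono) auto
            finally have aG: "a * G x v v \<le> G z v v" by (simp add: a_def algebra_simps power_numeral_reduce)
            have cs: "(G x v (y - x))\<^sup>2 \<le> G x v v * q"
              unfolding q_def
              by (rule bilinear_Cauchy_Schwarz[OF b G_sym[OF bR[OF xy(1)]] G_pos[OF bR[OF xy(1)]]])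
            have "(l v)\<^sup>2 = a * ((G x v (y - x))\<^sup>2 / q)"
              using a1 q by (simp add: l_def power_mult_distrib power_divide)
            also have "\<dots> \<le> a * G x v v"
              using cs q a1 by (intro mult_left_mono) (auto simp: pos_divide_le_eq)
            also have "\<dots> \<le> G z v v" by (rule aG)
            finally show "l v \<le> sqrt (g (U, \<phi>) (\<phi> (c t)) v v)"
              unfolding z_def G_def by (rule real_le_rsqrt)
          qed (use c stay in \<open>auto simp: curve_between_def\<close>)
          moreover have "\<phi> (c 1) - \<phi> (c 0) = y - x"
            using c psi[OF bR[OF xy(1)]] psi[OF bR[OF xy(2)]] by (simp add: curve_between_def)
          moreover have "l (y - x) = sqrt (a * q)"
            using q unfolding l_def q_def[symmetric] by (simp add: real_sqrt_mult real_div_sqrt)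
          ultimately show ?thesis by simp
        qed
      qed
      then have "(sqrt (a * q))\<^sup>2 \<le> (dist_M (\<psi> x) (\<psi> y))\<^sup>2" using a1 q by (intro power_mono) auto
      then show ?thesis using a1 q by simp
    qed
    have "k ^ 4 * s * q \<le> k ^ 4 * s * (k * s\<^sup>2)" using q_le k s by (intro mult_left_mono) auto
    also have "\<dots> = k ^ 5 * s ^ 3" by (simp add: power_numeral_reduce)
    finally have "q \<le> a * q + k ^ 5 * s ^ 3" by (simp add: a_def algebra_simps)
    then show ?thesis using main by (simp add: q_def s_def)
  qed
  \<comment> \<open>The value \<open>R / k\<close>, taken for \<open>r0\<close>, is the length that
    \<open>curve_cases\<close> guarantees for a curve that leaves the ball of radius R.\<close>
  have near: "q \<in> \<psi> ` ball x0 R" if q: "q \<in> M" "dist_M (\<psi> x0) q < R / k" for q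
  proof (rule ccontr)
    assume no: "q \<notin> \<psi> ` ball x0 R"
    have "R / k \<le> dist_M (\<psi> x0) q"
    proof (rule dist_M_ge[OF _ q(1)])
      show "\<psi> x0 \<in> M" using p psi_x0 by simp
      fix c assume c: "curve_between c (\<psi> x0) q"
      have "(\<forall>t\<in>{0..1}. c t \<in> U \<and> \<phi> (c t) \<in> cball x0 R) \<and> c 1 \<in> \<psi> ` ball x0 R \<or> R \<le> k * curve_length \<A> g c"
        by (rule curve_cases[OF _ _ _ c]) (use R R4 in auto)
      then have "R \<le> k * curve_length \<A> g c" using no c by (auto simp: curve_between_def)
      then show "R / k \<le> curve_length \<A> g c" using k by (simp add: pos_divide_le_eq mult.commute)
    qed
    then show False using q(2) by simp
  qed
  \<comment> \<open>The power comes from \<open>d_lower\<close>: k^4 from the factor a, and k from q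
    \<le> k s^2. The other bounds hold with k and hence with K.\<close>
  define K where "K = k ^ 5"
  have K: "K \<ge> 1" "k \<le> K" using k k_pow[of 5] by (simp_all add: K_def one_le_power)
  have mono: "a \<le> K * b" if "a \<le> k * b" "b \<ge> 0" for a b :: real
    using that mult_right_mono[OF K(2) that(2)] by linarith
  have "local_metric M dist_M \<psi> x0 R (R / k) K G DG"
  proof (rule local_metric.intro[OF met], rule local_metric_axioms.intro)
    fix x assume x: "x \<in> ball x0 R"
    note x1 = bR[OF x]
    show "\<psi> x \<in> M" by (rule psiM[OF x1])
    show "bilinear (G x)" by (rule G_bil[OF x1])
    show "G x v w = G x w v" for v w by (rule G_sym[OF x1])
    have Gnn: "G x v v \<ge> 0" for v
      using G_pos[OF x1, of v] bilinear_lzero[OF G_bil[OF x1]] by (cases "v = 0") auto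
    show "(norm v)\<^sup>2 \<le> K * G x v v" for v using lower[OF x1] Gnn by (rule mono)
    show "\<bar>G x v w\<bar> \<le> K * norm v * norm w" for v w
      using mono[of "\<bar>G x v w\<bar>" "norm v * norm w"] upper[OF x1, of v w] by (simp add: mult.assoc)
    show "linear (\<lambda>w. DG x w v)" for v by (rule DG_lin[OF x1])
    show "\<bar>DG x w v\<bar> \<le> K * norm w * (norm v)\<^sup>2" for w v
      using mono[of "\<bar>DG x w v\<bar>" "norm w * (norm v)\<^sup>2"] DG_bound[OF x1, of w v] by (simp add: mult.assoc)
    fix y assume y: "y \<in> ball x0 R"
    note y1 = bR[OF y]
    show "\<bar>G y v w - G x v w\<bar> \<le> K * norm (y - x) * norm v * norm w" for v w
      using mono[of "\<bar>G y v w - G x v w\<bar>" "norm (y - x) * norm v * norm w"] lip[OF x1 y1, of v w]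
      by (simp add: mult.assoc)
    show "\<bar>G y v v - G x v v - DG x (y - x) v\<bar> \<le> K * (norm (y - x))\<^sup>2 * (norm v)\<^sup>2" for v
      using mono[of "\<bar>G y v v - G x v v - DG x (y - x) v\<bar>" "(norm (y - x))\<^sup>2 * (norm v)\<^sup>2"]
        taylor[OF x1 y1, of v]
      by (simp add: mult.assoc)
    show "(dist_M (\<psi> x) (\<psi> y))\<^sup>2 \<le> G x (y - x) (y - x) + K * norm (y - x) ^ 3"
      using d_upper[OF x y] mult_right_mono[OF K(2), of "norm (y - x) ^ 3"] by simp
    show "G x (y - x) (y - x) \<le> (dist_M (\<psi> x) (\<psi> y))\<^sup>2 + K * norm (y - x) ^ 3"
      using d_lower[OF x y] by (simp add: K_def)
    show "norm (y - x) \<le> K * dist_M (\<psi> x) (\<psi> y)"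
      using d_comp[OF x y] dist_M_nonneg[OF psiM[OF x1] psiM[OF y1]] by (rule mono)
  qed (use R k K near in auto)
  then show ?thesis using psi_x0 by blast
qed

section \<open>Verification of the abstract geodesic space\<close>

lemma two_points: "\<exists>p\<in>M. \<exists>q\<in>M. p \<noteq> q"
proof -
  obtain p where p: "p \<in> M" using nonempty by blast
  obtain U \<phi> where U: "(U, \<phi>) \<in> \<A>" "p \<in> U" using chart_at[OF p] .
  have "open (\<phi> ` U)" "\<phi> ` U \<noteq> {}" using chart_range_open[OF U(1)] U(2) by auto
  \<comment> \<open>The model space has dimension at least 1, so a nonempty open set in it is
    infinite.\<close>
  then have "infinite (\<phi> ` U)" using finite_imp_not_open by blast
  then have "infinite U" by blast
  then have "\<not> U \<subseteq> {p}" using finite_subset by blast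
  then show ?thesis using p chart_subset[OF U(1)] by blast
qed

lemma geodesic_space_if:
  assumes "uniquely_geodesic M dist_M"
    and "\<And>I \<gamma>. local_geodesic M dist_M I \<gamma> \<Longrightarrow> geodesic M dist_M I \<gamma>"
  shows "geodesic_space M dist_M"
proof -
  interpret metric_on M dist_M
  proof
    \<comment> \<open>Positivity of the distance is read off from a geodesic between p and q, whose
      length b - a is positive.\<close>
    fix p q assume pq: "p \<in> M" "q \<in> M" "p \<noteq> q"
    then obtain a b \<gamma> where "a \<le> b" "geodesic M dist_M {a..b} \<gamma>" "\<gamma> a = p" "\<gamma> b = q"
      using assms(1) unfolding uniquely_geodesic_def geodesic_segment_def by metis
    moreover from this have "a < b" using pq(3) by (cases "a = b") auto
    ultimately have "dist_M q p = b - a" by (auto simp: geodesic_def)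
    then show "dist_M p q > 0" using \<open>a < b\<close> dist_M_sym pq by simp
  qed (fact dist_M_refl dist_M_sym dist_M_triangle)+
  show ?thesis
  proof unfold_locales
    show "\<gamma> b = \<gamma>' b"
      if "a < c" "c \<le> b" "geodesic M dist_M {a..b} \<gamma>" "geodesic M dist_M {a..b} \<gamma>'"
        "\<And>t. t \<in> {a..c} \<Longrightarrow> \<gamma> t = \<gamma>' t" for a b c \<gamma> \<gamma>'
      by (rule nonbranching_of_local[OF local_chart[OF _ metric_on_axioms] that])
  qed (use assms in auto)
qed

end

theorem theorem1p2:
  fixes X :: "'a topology"
    and \<A> :: "('a, 'e::euclidean_space) chart set"
    and g :: "('a, 'e) chart \<Rightarrow> 'e \<Rightarrow> 'e \<Rightarrow> 'e \<Rightarrow> real"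
    and M :: "'a set"
    and d :: "'a \<Rightarrow> 'a \<Rightarrow> real"
    and n :: nat
  assumes "riemannian_manifold X \<A> g"
    and "M = topspace X"
    and "d = riemannian_dist X \<A> g"
    and "uniquely_geodesic M d"
    and "\<And>I \<gamma>. local_geodesic M d I \<gamma> \<Longrightarrow> geodesic M d I \<gamma>"
    and "n > 0"
  shows "int (max_AP3 M d n) = \<lceil>(real n)\<^sup>2 / 2\<rceil> \<and>
    (\<forall>A. A \<subseteq> M \<and> finite A \<and> card A = n \<and> int (card (AP3 d A)) = \<lceil>(real n)\<^sup>2 / 2\<rceil> \<longrightarrow>
       (\<exists>I \<gamma>. geodesic M d I \<gamma> \<and> A \<subseteq> \<gamma> ` I))"
proof -
  interpret riemannian_manifold X \<A> g by fact
  have "uniquely_geodesic (topspace X) (riemannian_dist X \<A> g)" using assms(2-4) by simp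
  moreover have "geodesic (topspace X) (riemannian_dist X \<A> g) I \<gamma>"
    if "local_geodesic (topspace X) (riemannian_dist X \<A> g) I \<gamma>" for I \<gamma>
    using assms(2,3,5) that by simp
  ultimately have "geodesic_space (topspace X) (riemannian_dist X \<A> g)" by (rule geodesic_space_if)
  then interpret geodesic_space M d using assms(2,3) by simp
  have n: "n \<ge> 1" using assms(6) by simp
  \<comment> \<open>A geodesic between two points provides sets of every size n.\<close>
  obtain p q where pq: "p \<in> M" "q \<in> M" "p \<noteq> q" using two_points assms(2) by blast
  have max: "max_AP3 M d n = n + max_proper_AP3 n" by (rule max_AP3_eq[OF pq n])
  show ?thesis
  proof (intro conjI allI impI)
    show "int (max_AP3 M d n) = \<lceil>(real n)\<^sup>2 / 2\<rceil>"
      unfolding max by (rule max_proper_AP3_ceiling[OF n])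
    fix A assume A: "A \<subseteq> M \<and> finite A \<and> card A = n \<and> int (card (AP3 d A)) = \<lceil>(real n)\<^sup>2 / 2\<rceil>"
    then have "int (card (AP3 d A)) = int (n + max_proper_AP3 n)"
      by (simp only: max_proper_AP3_ceiling[OF n])
    then have "card (AP3 d A) = card A + max_proper_AP3 (card A)" using A by simp
    then show "\<exists>I \<gamma>. geodesic M d I \<gamma> \<and> A \<subseteq> \<gamma> ` I"
      using A n by (intro extremal_AP3_geodesic) auto
  qed
qed

end
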